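(* Let $X$ be a zero-dimensional $\mu$-complete space which is both a $\bar\aleph_k$-space and a $k_{\mathbb R}$-space. Then: (1) $C_k(X,2)$ is metrizable if and only if $C_k(X,2)$ is Fréchet-Urysohn if and only if $X$ is a cosmic $k_\omega$-space. (2) $C_k(X,2)$ is sequential if and only if $X$ is either a cosmic $k_\omega$-space or a Polish space with compact set $X'$ of non-isolated points. (3) $C_k(X,2)$ is a $k$-space if and only if either $X$ is a topological sum $K\oplus D$ of a cosmic $k_\omega$-space $K$ and a discrete space $D$, or $X$ is metrizable and has compact set $X'$ of non-isolated points. (4) $C_k(X,2)$ is a $k_{\mathbb R}$-space if and only if $C_k(X,2)$ is Ascoli if and only if $C_k(X,2)$ contains no strong $\mathrm{Fin}^\omega$-fans if and only if $X$ is either a topological sum of cosmic $k_\omega$-spaces or $X$ is metrizable and has compact set $X'$ of non-isolated points.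
   Context: $C_k(X,2)$ is the set of continuous functions $f:X\to\{0,1\}$ with the compact-open topology; $C_k(Y)$ is the space of continuous real-valued functions on $Y$ with the compact-open topology. "Regular" includes $T_1$. A space is zero-dimensional if its clopen subsets form a base of the topology. A topological sum is a disjoint topological union. A family $\mathcal N$ of subsets of a space $Y$ is a network if for each $y\in Y$ and neighborhood $O_y$ of $y$ there is $N\in\mathcal N$ with $y\in N\subset O_y$; it is a $k$-network if for each open $U\subset Y$ and compact $K\subset U$ there is a finite $\mathcal F\subset\mathcal N$ with $K\subset\bigcup\mathcal F\subset U$; it is compact-countable if each compact subset of $Y$ meets at most countably many members of $\mathcal N$. A regular space is cosmic if it has a countable network, and a $\bar\aleph_k$-space if it has a compact-countable $k$-network consisting of closed sets. $Y$ is a $k$-space if $A\subset Y$ is closed whenever $A\cap K$ is closed in $K$ for every compact $K\subset Y$. $Y$ is a $k_\omega$-space if it has a countable cover $\mathcal K$ by compact subsets such that $F\subset Y$ is closed iff $F\cap K$ is closed in $K$ for all $K\in\mathcal K$. $Y$ is a $k_{\mathbb R}$-space if every function $f:Y\to\mathbb R$ whose restriction to each compact subset of $Y$ is continuous is continuous. A Tychonoff space $Y$ is Ascoli if for each compact $K\subset C_k(Y)$ the evaluation map $K\times Y\to\mathbb R$ is continuous. $Y$ is sequential if for each non-closed $A\subset Y$ some sequence of points of $A$ converges to a point of $Y\setminus A$; $Y$ is Fréchet-Urysohn if for each $A\subset Y$ and $a\in\overline A$ some sequence of points of $A$ converges to $a$. A subset $B\subset Y$ is bounded if every locally finite family of open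 subsets of $Y$ each meeting $B$ is finite; $Y$ is $\mu$-complete if each closed bounded subset of $Y$ is compact. A family $(F_n)_{n\in\omega}$ of subsets of $Y$ is locally finite if each point of $Y$ has a neighborhood meeting $F_n$ for only finitely many $n$; it is compact-finite if each compact subset of $Y$ meets $F_n$ for only finitely many $n$. A set $U\subset Y$ is $\mathbb R$-open if for each $y\in U$ there is a continuous $f:Y\to[0,1]$ with $f(y)=1$ and $f(Y\setminus U)\subset\{0\}$. A $\mathrm{Fin}^\omega$-fan in $Y$ is a family $(F_n)_{n\in\omega}$ of finite subsets of $Y$ that is compact-finite but not locally finite; it is strong if each $F_n$ has an $\mathbb R$-open neighborhood $U_n\supset F_n$ such that $(U_n)_{n\in\omega}$ is compact-finite. *)

theory Defs
  imports "HOL-Analysis.Analysis"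
begin

section \<open>Function spaces with the compact-open topology\<close>

text \<open>Spaces are abstract topologies, so continuous maps are only determined on the
  carrier; requiring them to be extensional makes each map correspond to exactly one HOL function.\<close>

definition continuous_maps :: "'a topology \<Rightarrow> 'b topology \<Rightarrow> ('a \<Rightarrow> 'b) set" where
  "continuous_maps X Y = {f. continuous_map X Y f \<and> f \<in> extensional (topspace X)}"

definition compact_open_topology :: "'a topology \<Rightarrow> 'b topology \<Rightarrow> ('a \<Rightarrow> 'b) topology" where
  "compact_open_topology X Y = topology_generated_by
     {{f \<in> continuous_maps X Y. f ` K \<subseteq> U} | K U. compactin X K \<and> openin Y U}"

lemma topspace_compact_open_topology [simp]:
  "topspace (compact_open_topology X Y) = continuous_maps X Y"
proof -
  have "{f \<in> continuous_maps X Y. f ` {} \<subseteq> {}} \<in>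
      {{f \<in> continuous_maps X Y. f ` K \<subseteq> U} | K U. compactin X K \<and> openin Y U}"
    using compactin_empty openin_empty by blast
  then show ?thesis
    unfolding compact_open_topology_def topology_generated_by_topspace by auto
qed

definition Ck :: "'a topology \<Rightarrow> ('a \<Rightarrow> real) topology" where
  "Ck X = compact_open_topology X euclideanreal"

definition Ck2 :: "'a topology \<Rightarrow> ('a \<Rightarrow> nat) topology" where
  "Ck2 X = compact_open_topology X (discrete_topology {0, 1})"


section \<open>Separation, dimension and networks\<close>

definition zero_dimensional :: "'a topology \<Rightarrow> bool" where
  "zero_dimensional X \<longleftrightarrow>
     (\<forall>U x. openin X U \<and> x \<in> U \<longrightarrow> (\<exists>V. openin X V \<and> closedin X V \<and> x \<in> V \<and> V \<subseteq> U))"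

definition tychonoff_space :: "'a topology \<Rightarrow> bool" where
  "tychonoff_space X \<longleftrightarrow> completely_regular_space X \<and> t1_space X"

definition network :: "'a topology \<Rightarrow> 'a set set \<Rightarrow> bool" where
  "network X \<N> \<longleftrightarrow> (\<forall>N\<in>\<N>. N \<subseteq> topspace X) \<and>
     (\<forall>U x. openin X U \<and> x \<in> U \<longrightarrow> (\<exists>N\<in>\<N>. x \<in> N \<and> N \<subseteq> U))"

definition k_network :: "'a topology \<Rightarrow> 'a set set \<Rightarrow> bool" where
  "k_network X \<N> \<longleftrightarrow> (\<forall>N\<in>\<N>. N \<subseteq> topspace X) \<and>
     (\<forall>U K. openin X U \<and> compactin X K \<and> K \<subseteq> U \<longrightarrow>
        (\<exists>\<F>. finite \<F> \<and> \<F> \<subseteq> \<N> \<and> K \<subseteq> \<Union>\<F> \<and> \<Union>\<F> \<subseteq> U))"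

definition compact_countable :: "'a topology \<Rightarrow> 'a set set \<Rightarrow> bool" where
  "compact_countable X \<N> \<longleftrightarrow> (\<forall>K. compactin X K \<longrightarrow> countable {N \<in> \<N>. N \<inter> K \<noteq> {}})"

text \<open>The library's \<open>regular_space\<close> does not include the \<open>T\<^sub>1\<close> axiom.\<close>

definition cosmic_space :: "'a topology \<Rightarrow> bool" where
  "cosmic_space X \<longleftrightarrow> regular_space X \<and> t1_space X \<and> (\<exists>\<N>. countable \<N> \<and> network X \<N>)"

definition bar_aleph_k_space :: "'a topology \<Rightarrow> bool" where
  "bar_aleph_k_space X \<longleftrightarrow> regular_space X \<and> t1_space X \<and>
     (\<exists>\<N>. k_network X \<N> \<and> compact_countable X \<N> \<and> (\<forall>N\<in>\<N>. closedin X N))"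

definition polish_space :: "'a topology \<Rightarrow> bool" where
  "polish_space X \<longleftrightarrow> completely_metrizable_space X \<and> separable_space X"

definition non_isolated_points :: "'a topology \<Rightarrow> 'a set" where
  "non_isolated_points X = {x \<in> topspace X. \<not> openin X {x}}"


section \<open>Compactly generated, sequential and related spaces\<close>

definition k_omega_space :: "'a topology \<Rightarrow> bool" where
  "k_omega_space X \<longleftrightarrow>
     (\<exists>\<K>. countable \<K> \<and> (\<forall>K\<in>\<K>. compactin X K) \<and> \<Union>\<K> = topspace X \<and>
        (\<forall>F. F \<subseteq> topspace X \<longrightarrow>
           (closedin X F \<longleftrightarrow> (\<forall>K\<in>\<K>. closedin (subtopology X K) (F \<inter> K)))))"

definition k_R_space :: "'a topology \<Rightarrow> bool" where
  "k_R_space X \<longleftrightarrow>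
     (\<forall>f :: 'a \<Rightarrow> real.
        (\<forall>K. compactin X K \<longrightarrow> continuous_map (subtopology X K) euclideanreal f) \<longrightarrow>
        continuous_map X euclideanreal f)"

definition ascoli_space :: "'a topology \<Rightarrow> bool" where
  "ascoli_space X \<longleftrightarrow> tychonoff_space X \<and>
     (\<forall>K. compactin (Ck X) K \<longrightarrow>
        continuous_map (prod_topology (subtopology (Ck X) K) X) euclideanreal (\<lambda>(f, x). f x))"

definition sequential_space :: "'a topology \<Rightarrow> bool" where
  "sequential_space X \<longleftrightarrow>
     (\<forall>A. A \<subseteq> topspace X \<and> \<not> closedin X A \<longrightarrow>
        (\<exists>s l. range s \<subseteq> A \<and> l \<in> topspace X - A \<and> limitin X s l sequentially))"

definition frechet_urysohn_space :: "'a topology \<Rightarrow> bool" where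
  "frechet_urysohn_space X \<longleftrightarrow>
     (\<forall>A a. A \<subseteq> topspace X \<and> a \<in> X closure_of A \<longrightarrow>
        (\<exists>s. range s \<subseteq> A \<and> limitin X s a sequentially))"

text \<open>Families of sets may be taken unindexed here: in a locally finite indexed family, a set
  meeting \<open>B\<close> occurs only finitely often.\<close>

definition bounded_subset :: "'a topology \<Rightarrow> 'a set \<Rightarrow> bool" where
  "bounded_subset X B \<longleftrightarrow> B \<subseteq> topspace X \<and>
     (\<forall>\<U>. locally_finite_in X \<U> \<and> (\<forall>U\<in>\<U>. openin X U \<and> U \<inter> B \<noteq> {}) \<longrightarrow> finite \<U>)"

definition mu_complete_space :: "'a topology \<Rightarrow> bool" where
  "mu_complete_space X \<longleftrightarrow> (\<forall>B. closedin X B \<and> bounded_subset X B \<longrightarrow> compactin X B)"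


section \<open>Fans\<close>

text \<open>Sequences of sets are indexed families, with repetitions counted; hence the library's
  \<open>locally_finite_in\<close>, which is about sets of sets, does not apply.\<close>

definition locally_finite_seq :: "'a topology \<Rightarrow> (nat \<Rightarrow> 'a set) \<Rightarrow> bool" where
  "locally_finite_seq X F \<longleftrightarrow>
     (\<forall>x\<in>topspace X. \<exists>V. openin X V \<and> x \<in> V \<and> finite {n. V \<inter> F n \<noteq> {}})"

definition compact_finite_seq :: "'a topology \<Rightarrow> (nat \<Rightarrow> 'a set) \<Rightarrow> bool" where
  "compact_finite_seq X F \<longleftrightarrow> (\<forall>K. compactin X K \<longrightarrow> finite {n. K \<inter> F n \<noteq> {}})"

definition R_open :: "'a topology \<Rightarrow> 'a set \<Rightarrow> bool" where
  "R_open X U \<longleftrightarrow> U \<subseteq> topspace X \<and>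
     (\<forall>x\<in>U. \<exists>f :: 'a \<Rightarrow> real. continuous_map X (top_of_set {0..1}) f \<and> f x = 1 \<and>
        f ` (topspace X - U) \<subseteq> {0})"

definition Fin_fan :: "'a topology \<Rightarrow> (nat \<Rightarrow> 'a set) \<Rightarrow> bool" where
  "Fin_fan X F \<longleftrightarrow> (\<forall>n. finite (F n) \<and> F n \<subseteq> topspace X) \<and>
     compact_finite_seq X F \<and> \<not> locally_finite_seq X F"

definition strong_Fin_fan :: "'a topology \<Rightarrow> (nat \<Rightarrow> 'a set) \<Rightarrow> bool" where
  "strong_Fin_fan X F \<longleftrightarrow> Fin_fan X F \<and>
     (\<exists>U. (\<forall>n. R_open X (U n) \<and> F n \<subseteq> U n) \<and> compact_finite_seq X U)"


section \<open>Topological sums\<close>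

definition sum_of_cosmic_k_omega_and_discrete :: "'a topology \<Rightarrow> bool" where
  "sum_of_cosmic_k_omega_and_discrete X \<longleftrightarrow>
     (\<exists>(K :: 'a topology) (D :: 'a set). cosmic_space K \<and> k_omega_space K \<and>
        X homeomorphic_space sum_topology (\<lambda>b. if b then K else discrete_topology D) UNIV)"

text \<open>Taking the summands and the index set in the type of the points of \<open>X\<close> loses no
  generality: summands embed into \<open>X\<close>, empty ones can be dropped, and a nonempty summand
  can be indexed by (the image of) one of its points.\<close>

definition sum_of_cosmic_k_omega_spaces :: "'a topology \<Rightarrow> bool" where
  "sum_of_cosmic_k_omega_spaces X \<longleftrightarrow>
     (\<exists>(I :: 'a set) (Y :: 'a \<Rightarrow> 'a topology).
        (\<forall>i\<in>I. cosmic_space (Y i) \<and> k_omega_space (Y i)) \<and>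
        X homeomorphic_space sum_topology Y I)"

end

theory Submission
  imports Defs
begin

text \<open>A set of two-valued functions with finitely many traces on every compact set is relatively compact
  (this uses the \<open>k\<^sub>\<real>\<close>-property of \<open>X\<close>), and compact sets of functions have finite traces. There are
  two obstructions in \<open>X\<close>. The first is a sequence of closed noncompact sets that shrinks to a compact
  set, as in the metric fan; if there is none, then the compact-countable \<open>k\<close>-network can be refined
  to one by compact sets, so \<open>X\<close> splits into clopen hemicompact pieces. The second is a sequence of
  infinite compact sets whose traces escape from every compact set; if there is none, then the
  non-isolated points form a compact set with a countable neighbourhood base. Adding up bump
  functions for both obstructions gives a strong fan in \<open>C\<^sub>k(X,2)\<close>. Hence, in the absence of strong
  fans, either \<open>C\<^sub>k(X,2)\<close> is a product of metrizable spaces or it is, locally, a union of countably many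
  compact sets whose topology can be controlled by hand.\<close>

subsection \<open>Implications between the topological properties\<close>

text \<open>Every property in (1) to (3) implies \<open>k_R_space\<close>, and (4) is a cycle: a
  Tychonoff \<open>k_R_space\<close> is Ascoli, an Ascoli space has no strong fan, and without
  strong fans \<open>X\<close> has one of two structures, each of which gives
  \<open>k_R_space\<close> back. So (1) to (3) only ask which spaces of these two kinds qualify, and
  that is a matter of counting: all pieces of the partition, the pieces with non-isolated points, or
  the isolated points. A fan needs both obstructions because it is a double sequence of functions
  and each obstruction controls one index: on a compact family of functions the shrinking sets bound
  the first index, and infinitely many traces on one compact set bound the second. The first
  obstruction alone already destroys the Frechet-Urysohn property. The classes in the statement are
  replaced by notions that are easier to handle: hemicompactness of clopen sets for cosmic
  k-omega-spaces, and a countable clopen base at the compact set \<open>X'\<close> of non-isolated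
  points for metrizability.\<close>

lemma continuous_map_realI:
  fixes f :: "'a \<Rightarrow> real"
  assumes "\<And>x e. x \<in> topspace X \<Longrightarrow> 0 < e \<Longrightarrow> \<exists>U. openin X U \<and> x \<in> U \<and> (\<forall>y\<in>U. \<bar>f y - f x\<bar> < e)"
  shows "continuous_map X euclideanreal f"
  unfolding continuous_map_def
proof (intro conjI allI impI)
  show "f \<in> topspace X \<rightarrow> topspace euclideanreal" by simp
next
  fix V :: "real set" assume "openin euclideanreal V"
  then have V: "open V" by simp
  show "openin X {x \<in> topspace X. f x \<in> V}"
  proof (subst openin_subopen, clarify)
    fix x assume x: "x \<in> topspace X" "f x \<in> V"
    then obtain e where e: "e > 0" "ball (f x) e \<subseteq> V"
      using V open_contains_ball by blast
    then obtain U where U: "openin X U" "x \<in> U" "\<forall>y\<in>U. \<bar>f y - f x\<bar> < e"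
      using assms[OF x(1) e(1)] by blast
    have "f y \<in> V" if "y \<in> U" for y
      using U(3) that e(2) by (auto simp: dist_real_def subset_iff abs_minus_commute)
    then show "\<exists>T. openin X T \<and> x \<in> T \<and> T \<subseteq> {x \<in> topspace X. f x \<in> V}"
      using U openin_subset by blast
  qed
qed

lemma limitin_topology_generated_by:
  assumes l: "l \<in> topspace (topology_generated_by S)"
    and ev: "\<And>U. U \<in> S \<Longrightarrow> l \<in> U \<Longrightarrow> eventually (\<lambda>n. f n \<in> U) F"
  shows "limitin (topology_generated_by S) f l F"
proof -
  have "l \<in> W \<longrightarrow> eventually (\<lambda>n. f n \<in> W) F" if "generate_topology_on S W" for W
    using that
  proof induction
    case (Int a b)
    then show ?case by (auto intro: eventually_conj)
  next
    case (UN K)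
    show ?case
    proof
      assume "l \<in> \<Union>K"
      then obtain k where "k \<in> K" "eventually (\<lambda>n. f n \<in> k) F"
        using UN.IH by blast
      then show "eventually (\<lambda>n. f n \<in> \<Union>K) F"
        by (auto elim: eventually_mono)
    qed
  qed (use ev in auto)
  then show ?thesis
    using l by (auto simp: limitin_def openin_topology_generated_by_iff)
qed

lemma k_space_imp_k_R_space:
  assumes "k_space Y" shows "k_R_space Y"
  unfolding k_R_space_def
proof (intro allI impI)
  fix f :: "'a \<Rightarrow> real"
  assume f: "\<forall>K. compactin Y K \<longrightarrow> continuous_map (subtopology Y K) euclideanreal f"
  show "continuous_map Y euclideanreal f"
    unfolding continuous_map_closedin
  proof (intro conjI allI impI)
    fix C :: "real set" assume C: "closedin euclideanreal C"
    have "closedin (subtopology Y K) (K \<inter> {x \<in> topspace Y. f x \<in> C})" if K: "compactin Y K" for K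
    proof -
      have "closedin (subtopology Y K) {x \<in> topspace (subtopology Y K). f x \<in> C}"
        using f K C closedin_continuous_map_preimage by blast
      moreover have "{x \<in> topspace (subtopology Y K). f x \<in> C} = K \<inter> {x \<in> topspace Y. f x \<in> C}"
        by auto
      ultimately show ?thesis by simp
    qed
    then show "closedin Y {x \<in> topspace Y. f x \<in> C}"
      using assms unfolding k_space_def by (metis (lifting) mem_Collect_eq subsetI)
  qed auto
qed

text \<open>A sequence that leaves \<open>S\<close> in the limit forms, with its limit, a compact
  set on which the trace of \<open>S\<close> is not closed.\<close>

lemma sequential_imp_k_space:
  assumes "sequential_space Y" shows "k_space Y"
  unfolding k_space_def
proof (intro allI impI iffI)
  fix S K assume "closedin Y S" "compactin Y K"
  then show "closedin (subtopology Y K) (K \<inter> S)"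
    by (metis closedin_subtopology_Int_closed)
next
  fix S assume S: "S \<subseteq> topspace Y"
    and *: "\<forall>K. compactin Y K \<longrightarrow> closedin (subtopology Y K) (K \<inter> S)"
  show "closedin Y S"
  proof (rule ccontr)
    assume "\<not> closedin Y S"
    then obtain s l where s: "range s \<subseteq> S" and l: "l \<in> topspace Y - S"
      and lim: "limitin Y s l sequentially"
      using assms S unfolding sequential_space_def by blast
    let ?L = "insert l (range s)"
    have "compactin Y ?L"
      using compactin_sequence_with_limit[OF lim subset_refl] s S by blast
    then have "closedin (subtopology Y ?L) (?L \<inter> S)" using * by blast
    then obtain T where T: "closedin Y T" "?L \<inter> S = T \<inter> ?L"
      by (auto simp: closedin_subtopology)
    have "l \<in> T"
    proof (rule limitin_closedin[OF lim T(1)])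
      have "s n \<in> T" for n using T(2) s by blast
      then show "eventually (\<lambda>n. s n \<in> T) sequentially" by simp
    qed simp
    then show False using T(2) l by blast
  qed
qed

lemma frechet_urysohn_imp_sequential:
  assumes "frechet_urysohn_space Y" shows "sequential_space Y"
  unfolding sequential_space_def
proof (intro allI impI)
  fix A assume A: "A \<subseteq> topspace Y \<and> \<not> closedin Y A"
  then obtain a where a: "a \<in> Y closure_of A" "a \<notin> A"
    by (metis closure_of_subset_eq subsetI)
  then obtain s where "range s \<subseteq> A" "limitin Y s a sequentially"
    using assms A unfolding frechet_urysohn_space_def by blast
  moreover have "a \<in> topspace Y - A"
    using a by (auto simp: in_closure_of)
  ultimately show "\<exists>s l. range s \<subseteq> A \<and> l \<in> topspace Y - A \<and> limitin Y s l sequentially"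
    by blast
qed

lemma metrizable_imp_frechet_urysohn:
  assumes "metrizable_space Y" shows "frechet_urysohn_space Y"
proof -
  obtain M d where "Metric_space M d" and Y: "Y = Metric_space.mtopology M d"
    using assms metrizable_space_def by blast
  then interpret Metric_space M d by simp
  show ?thesis
    unfolding frechet_urysohn_space_def Y
  proof (intro allI impI)
    fix A a assume Aa: "A \<subseteq> topspace mtopology \<and> a \<in> mtopology closure_of A"
    then have "\<exists>y\<in>A. y \<in> mball a r" if "r > 0" for r
      using that by (simp add: metric_closure_of)
    then have "\<exists>y. y \<in> A \<and> y \<in> mball a (1 / real (Suc n))" for n
      by (metis of_nat_0_less_iff zero_less_Suc zero_less_divide_1_iff)
    then obtain s where s: "\<And>n. s n \<in> A" "\<And>n. s n \<in> mball a (1 / real (Suc n))"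
      by metis
    have "limitin mtopology s a sequentially"
      unfolding limit_metric_sequentially
    proof (intro conjI allI impI)
      show "a \<in> M" using s(2)[of 0] by simp
      fix e :: real assume "e > 0"
      then obtain N where N: "1 / real (Suc N) < e"
        using nat_approx_posE by (metis of_nat_Suc)
      have "s n \<in> M \<and> d (s n) a < e" if "n \<ge> N" for n
      proof -
        have "1 / real (Suc n) \<le> 1 / real (Suc N)" using that by (simp add: frac_le)
        then show ?thesis using s(2)[of n] N commute by auto
      qed
      then show "\<exists>N. \<forall>n\<ge>N. s n \<in> M \<and> d (s n) a < e" by blast
    qed
    then show "\<exists>s. range s \<subseteq> A \<and> limitin mtopology s a sequentially"
      using s by blast
  qed
qed

section \<open>Compact sets of real-valued functions and the Ascoli property\<close>

lemma topspace_Ck [simp]: "topspace (Ck X) = continuous_maps X euclideanreal"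
  by (simp add: Ck_def)

lemma openin_Ck_subbase:
  assumes "compactin X K" "open U"
  shows "openin (Ck X) {f \<in> continuous_maps X euclideanreal. f ` K \<subseteq> U}"
  unfolding Ck_def compact_open_topology_def openin_topology_generated_by_iff
  by (rule generate_topology_on.Basis) (use assms in auto)

lemma continuous_map_Ck_eval:
  assumes "x \<in> topspace X"
  shows "continuous_map (Ck X) euclideanreal (\<lambda>f. f x)"
proof (rule continuous_map_realI)
  fix f and e :: real assume f: "f \<in> topspace (Ck X)" "e > 0"
  let ?U = "{g \<in> continuous_maps X euclideanreal. g ` {x} \<subseteq> ball (f x) e}"
  have "openin (Ck X) ?U" using assms by (intro openin_Ck_subbase) auto
  moreover have "f \<in> ?U" using f by auto
  moreover have "\<forall>g\<in>?U. \<bar>g x - f x\<bar> < e" by (auto simp: dist_real_def)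
  ultimately show "\<exists>U. openin (Ck X) U \<and> f \<in> U \<and> (\<forall>g\<in>U. \<bar>g x - f x\<bar> < e)" by blast
qed

text \<open>The sets \<open>{y \<in> L. \<bar>f y - f z\<bar> \<le> e/3}\<close> are compact neighbourhoods of \<open>z\<close> in \<open>L\<close>, so each of
  them constrains a neighbourhood of \<open>f\<close> in the compact-open topology.\<close>

lemma compact_Ck_equicontinuous_on_compact:
  assumes K: "compactin (Ck X) K" and L: "compactin X L" and z: "z \<in> topspace X" and e: "0 < e"
  shows "\<exists>V. openin X V \<and> z \<in> V \<and> (\<forall>y\<in>V \<inter> L. \<forall>f\<in>K. \<bar>f y - f z\<bar> < e)"
proof -
  define V where "V f = {y \<in> topspace X. \<bar>f y - f z\<bar> < e / 3}" for f
  \<comment> \<open>The point \<open>z\<close> is inserted because it need not lie in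
    \<open>L\<close>: membership of \<open>g\<close> in \<open>W f\<close> has to control
    \<open>g z\<close> as well as \<open>g y\<close>. Both are then within \<open>e / 2\<close> of
    \<open>f z\<close>.\<close>
  define N where "N f = insert z (L \<inter> {y \<in> topspace X. \<bar>f y - f z\<bar> \<le> e / 3})" for f
  define W where "W f = {g \<in> continuous_maps X euclideanreal. g ` N f \<subseteq> ball (f z) (e / 2)}" for f
  have KC: "K \<subseteq> continuous_maps X euclideanreal"
    using compactin_subset_topspace[OF K] by simp
  have cont: "continuous_map X euclideanreal (\<lambda>y. \<bar>f y - f z\<bar>)" if "f \<in> K" for f
    using that KC by (intro continuous_intros) (auto simp: continuous_maps_def)
  have V: "openin X (V f)" if "f \<in> K" for f
    using openin_continuous_map_preimage[OF cont[OF that], of "{..<e/3}"] by (simp add: V_def)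
  have N: "compactin X (N f)" if "f \<in> K" for f
  proof -
    have "closedin X {y \<in> topspace X. \<bar>f y - f z\<bar> \<le> e / 3}"
      using closedin_continuous_map_preimage[OF cont[OF that], of "{..e/3}"] by simp
    then have "compactin X (L \<inter> {y \<in> topspace X. \<bar>f y - f z\<bar> \<le> e / 3})"
      using L compact_Int_closedin by blast
    then show ?thesis
      using z compactin_Un[of X "{z}"] by (simp add: N_def)
  qed
  have W: "openin (Ck X) (W f)" "f \<in> W f" if "f \<in> K" for f
  proof -
    show "openin (Ck X) (W f)"
      unfolding W_def using N that by (intro openin_Ck_subbase) auto
    show "f \<in> W f"
      using that KC e by (auto simp: W_def N_def dist_real_def abs_minus_commute)
  qed
  have "\<exists>\<F>. finite \<F> \<and> \<F> \<subseteq> W ` K \<and> K \<subseteq> \<Union>\<F>"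
    using W by (intro compactinD[OF K]) auto
  then obtain F where F: "finite F" "F \<subseteq> K" "K \<subseteq> (\<Union>f\<in>F. W f)"
    by (metis finite_subset_image)
  let ?V = "topspace X \<inter> (\<Inter>f\<in>F. V f)"
  have "openin X ?V"
    using F V by (intro openin_Int_Inter) auto
  moreover have "z \<in> ?V"
    using z e by (auto simp: V_def)
  moreover have "\<bar>g y - g z\<bar> < e" if y: "y \<in> ?V" "y \<in> L" and g: "g \<in> K" for g y
  proof -
    obtain f where f: "f \<in> F" "g \<in> W f" using F g by blast
    have "y \<in> N f" "z \<in> N f" using y f by (auto simp: N_def V_def)
    then have "\<bar>g y - f z\<bar> < e / 2" "\<bar>g z - f z\<bar> < e / 2"
      using f(2) by (auto simp: W_def dist_real_def abs_minus_commute subset_iff)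
    then show ?thesis by linarith
  qed
  ultimately show ?thesis by blast
qed

text \<open>The supremum \<open>d y\<close> of the oscillations between \<open>y\<close> and
  \<open>y0\<close> over a compact family is continuous on compact sets by equicontinuity there,
  hence continuous. Since \<open>d y0 = 0\<close>, the family is equicontinuous at \<open>y0\<close>
  in the whole space, which yields joint continuity of evaluation.\<close>

lemma k_R_imp_ascoli:
  assumes "tychonoff_space Y" and kR: "k_R_space Y"
  shows "ascoli_space Y"
  unfolding ascoli_space_def
proof (intro conjI allI impI)
  show "tychonoff_space Y" by fact
  fix K assume K: "compactin (Ck Y) K"
  show "continuous_map (prod_topology (subtopology (Ck Y) K) Y) euclideanreal (\<lambda>(f, x). f x)"
  proof (rule continuous_map_realI, clarify)
    fix f0 y0 and e :: real
    assume fy: "(f0, y0) \<in> topspace (prod_topology (subtopology (Ck Y) K) Y)" and e: "0 < e"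
    then have f0: "f0 \<in> K" and y0: "y0 \<in> topspace Y" by auto
    define d where "d y = (SUP f\<in>K. \<bar>f y - f y0\<bar>)" for y
    have bdd: "bdd_above ((\<lambda>f. \<bar>f y - f y0\<bar>) ` K)" if y: "y \<in> topspace Y" for y
    proof -
      have "continuous_map (Ck Y) euclideanreal (\<lambda>f. \<bar>f y - f y0\<bar>)"
        using continuous_map_Ck_eval[OF y] continuous_map_Ck_eval[OF y0]
        by (intro continuous_intros) auto
      then have "compactin euclideanreal ((\<lambda>f. \<bar>f y - f y0\<bar>) ` K)"
        using K image_compactin by blast
      then show ?thesis
        by (simp add: compact_imp_bounded bounded_imp_bdd_above)
    qed
    have le: "d y \<le> d z + r"
      if yz: "y \<in> topspace Y" "z \<in> topspace Y" and r: "\<And>f. f \<in> K \<Longrightarrow> \<bar>f y - f z\<bar> \<le> r" for y z r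
      unfolding d_def
    proof (rule cSUP_least)
      show "K \<noteq> {}" using f0 by auto
      fix f assume f: "f \<in> K"
      have "\<bar>f z - f y0\<bar> \<le> (SUP f\<in>K. \<bar>f z - f y0\<bar>)"
        using bdd[OF yz(2)] f by (rule cSUP_upper2) simp
      then show "\<bar>f y - f y0\<bar> \<le> (SUP f\<in>K. \<bar>f z - f y0\<bar>) + r"
        using r[OF f] by linarith
    qed
    have "continuous_map (subtopology Y L) euclideanreal d" if L: "compactin Y L" for L
    proof (rule continuous_map_realI)
      fix z and r :: real assume z: "z \<in> topspace (subtopology Y L)" and r: "0 < r"
      then obtain V where V: "openin Y V" "z \<in> V" "\<forall>y\<in>V \<inter> L. \<forall>f\<in>K. \<bar>f y - f z\<bar> < r / 2"
        using compact_Ck_equicontinuous_on_compact[OF K L, of z "r/2"] by auto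
      have "\<bar>d y - d z\<bar> < r" if "y \<in> L \<inter> V" for y
      proof -
        have y: "y \<in> topspace Y" using that V openin_subset by blast
        have r2: "\<bar>f y - f z\<bar> \<le> r / 2" if "f \<in> K" for f
          using V(3) \<open>y \<in> L \<inter> V\<close> that by (simp add: less_imp_le)
        then have "\<bar>f z - f y\<bar> \<le> r / 2" if "f \<in> K" for f
          using that by (subst abs_minus_commute)
        then have "d y \<le> d z + r / 2" "d z \<le> d y + r / 2"
          using r2 le[of y z "r/2"] le[of z y "r/2"] y z by auto
        then show ?thesis using r by linarith
      qed
      moreover have "openin (subtopology Y L) (L \<inter> V)"
        using V openin_subtopology_Int2 by blast
      ultimately show "\<exists>U. openin (subtopology Y L) U \<and> z \<in> U \<and> (\<forall>y\<in>U. \<bar>d y - d z\<bar> < r)"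
        using z V by auto
    qed
    then have cd: "continuous_map Y euclideanreal d"
      using kR unfolding k_R_space_def by blast
    let ?V = "{y \<in> topspace Y. d y < e / 2}"
    let ?W = "{f \<in> topspace (Ck Y). \<bar>f y0 - f0 y0\<bar> < e / 2}"
    have V: "openin Y ?V"
      using openin_continuous_map_preimage[OF cd, of "{..<e/2}"] by simp
    have "continuous_map (Ck Y) euclideanreal (\<lambda>f. \<bar>f y0 - f0 y0\<bar>)"
      using continuous_map_Ck_eval[OF y0] by (intro continuous_intros) auto
    then have W: "openin (Ck Y) ?W"
      using openin_continuous_map_preimage[of "Ck Y" euclideanreal _ "{..<e/2}"] by auto
    have "d y0 = 0"
      using f0 by (auto simp: d_def intro!: cSUP_const)
    then have "(f0, y0) \<in> (K \<inter> ?W) \<times> ?V"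
      using fy e by auto
    moreover have "openin (prod_topology (subtopology (Ck Y) K) Y) ((K \<inter> ?W) \<times> ?V)"
      using V W openin_subtopology_Int2 openin_prod_Times_iff by blast
    moreover have "\<bar>f y - f0 y0\<bar> < e" if "(f, y) \<in> (K \<inter> ?W) \<times> ?V" for f y
    proof -
      have "\<bar>f y - f y0\<bar> \<le> d y"
        unfolding d_def using bdd that by (intro cSUP_upper2) auto
      moreover have "\<bar>f y0 - f0 y0\<bar> < e / 2" "d y < e / 2" using that by auto
      ultimately show ?thesis by linarith
    qed
    ultimately show "\<exists>U. openin (prod_topology (subtopology (Ck Y) K) Y) U \<and> (f0, y0) \<in> U \<and>
             (\<forall>y\<in>U. \<bar>(case y of (f, x) \<Rightarrow> f x) - f0 y0\<bar> < e)"
      by (intro exI[of _ "(K \<inter> ?W) \<times> ?V"]) auto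
  qed
qed

text \<open>Bump functions of the members of a strong fan converge to zero in \<open>C\<^sub>k(Y)\<close>, but they are large
  arbitrarily close to a point where the fan is not locally finite.\<close>

lemma ascoli_imp_no_strong_Fin_fan:
  assumes "ascoli_space Y" shows "\<not> strong_Fin_fan Y F"
proof
  assume "strong_Fin_fan Y F"
  then obtain U where fin: "\<And>n. finite (F n)" and FY: "\<And>n. F n \<subseteq> topspace Y"
    and nlf: "\<not> locally_finite_seq Y F" and RU: "\<And>n. R_open Y (U n)" and FU: "\<And>n. F n \<subseteq> U n"
    and cfU: "compact_finite_seq Y U"
    unfolding strong_Fin_fan_def Fin_fan_def by blast
  \<comment> \<open>R-openness gives one function per point of \<open>F n\<close>. Their sum over
    the finite set is at least 1 on all of \<open>F n\<close> and still vanishes off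
    \<open>U n\<close>; values above 1 do no harm.\<close>
  have "\<exists>g. continuous_map Y euclideanreal g \<and> (\<forall>x\<in>F n. g x \<ge> 1) \<and> (\<forall>x\<in>topspace Y - U n. g x = 0)" for n
  proof -
    have "\<forall>x\<in>F n. \<exists>h. continuous_map Y (top_of_set {0..1::real}) h \<and> h x = 1 \<and> h ` (topspace Y - U n) \<subseteq> {0}"
      using RU[of n] FU[of n] unfolding R_open_def by blast
    then obtain h where h: "\<And>x. x \<in> F n \<Longrightarrow> continuous_map Y (top_of_set {0..1::real}) (h x)"
      "\<And>x. x \<in> F n \<Longrightarrow> h x x = 1" "\<And>x. x \<in> F n \<Longrightarrow> h x ` (topspace Y - U n) \<subseteq> {0}"
      by metis
    let ?g = "\<lambda>y. \<Sum>x\<in>F n. h x y"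
    have "continuous_map Y euclideanreal ?g"
      using h(1) fin continuous_map_into_fulltopology by (intro continuous_map_sum) blast+
    moreover have "?g y \<ge> 1" if "y \<in> F n" for y
    proof -
      have "h x y \<ge> 0" if "x \<in> F n" for x
        using h(1)[OF that] FY[of n] \<open>y \<in> F n\<close>
        by (auto simp: continuous_map_in_subtopology Pi_iff subset_iff)
      then have "h y y \<le> ?g y"
        using that fin by (intro member_le_sum) auto
      then show ?thesis using h(2)[OF that] by simp
    qed
    moreover have "?g y = 0" if "y \<in> topspace Y - U n" for y
      using h(3) that by (intro sum.neutral) blast
    ultimately show ?thesis by blast
  qed
  then obtain g where gc: "\<And>n. continuous_map Y euclideanreal (g n)"
    and g1: "\<And>n x. x \<in> F n \<Longrightarrow> g n x \<ge> 1"
    and g0: "\<And>n x. x \<in> topspace Y - U n \<Longrightarrow> g n x = 0" by metis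
  define f where "f n = restrict (g n) (topspace Y)" for n
  define z where "z = restrict (\<lambda>_. 0::real) (topspace Y)"
  have fC: "f n \<in> continuous_maps Y euclideanreal" for n
    using gc[of n] unfolding continuous_maps_def f_def
    by (auto intro: continuous_map_eq)
  have zC: "z \<in> continuous_maps Y euclideanreal"
    unfolding continuous_maps_def z_def by (auto intro: continuous_map_eq[of _ _ "\<lambda>_. 0"])
  have lim: "limitin (Ck Y) f z sequentially"
    unfolding Ck_def compact_open_topology_def
  proof (rule limitin_topology_generated_by)
    show "z \<in> topspace (topology_generated_by
       {{f \<in> continuous_maps Y euclideanreal. f ` K \<subseteq> U} |K U. compactin Y K \<and> openin euclideanreal U})"
      using zC topspace_Ck unfolding Ck_def compact_open_topology_def by blast
    fix W assume "W \<in> {{f \<in> continuous_maps Y euclideanreal. f ` K \<subseteq> U} |K U. compactin Y K \<and> openin euclideanreal U}"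
      and zW: "z \<in> W"
    then obtain K V where W: "W = {f \<in> continuous_maps Y euclideanreal. f ` K \<subseteq> V}" and K: "compactin Y K"
      by blast
    have KY: "K \<subseteq> topspace Y" using K compactin_subset_topspace by blast
    have "f n \<in> W" if "K \<inter> U n = {}" for n
    proof -
      have "f n x = z x" if "x \<in> K" for x
        using that KY \<open>K \<inter> U n = {}\<close> g0[of x n] by (auto simp: f_def z_def)
      then show ?thesis using zW fC W by auto
    qed
    moreover have "finite {n. K \<inter> U n \<noteq> {}}"
      using cfU K unfolding compact_finite_seq_def by blast
    then have "eventually (\<lambda>n. K \<inter> U n = {}) sequentially"
      by (simp add: eventually_cofinite flip: cofinite_eq_sequentially)
    ultimately show "eventually (\<lambda>n. f n \<in> W) sequentially"
      by (auto elim: eventually_mono)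
  qed
  let ?K = "insert z (range f)"
  have K: "compactin (Ck Y) ?K"
    using compactin_sequence_with_limit[OF lim subset_refl] fC by auto
  then have cont: "continuous_map (prod_topology (subtopology (Ck Y) ?K) Y) euclideanreal (\<lambda>(f, x). f x)"
    using assms unfolding ascoli_space_def by blast
  have "\<exists>V. openin Y V \<and> y \<in> V \<and> finite {n. V \<inter> F n \<noteq> {}}" if y: "y \<in> topspace Y" for y
  proof -
    \<comment> \<open>Near \<open>(z, y)\<close> evaluation stays below 1, whereas
      \<open>f n\<close> is at least 1 on \<open>F n\<close>. Hence \<open>V\<close> misses
      \<open>F n\<close> as soon as \<open>f n\<close> lies in \<open>A\<close>.\<close>
    let ?P = "{p \<in> topspace (prod_topology (subtopology (Ck Y) ?K) Y). (\<lambda>(f, x). f x) p \<in> {..<1}}"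
    have "openin (prod_topology (subtopology (Ck Y) ?K) Y) ?P"
      using openin_continuous_map_preimage[OF cont, of "{..<1}"] by simp
    moreover have "(z, y) \<in> ?P" using y zC by (auto simp: z_def)
    ultimately obtain A V where A: "openin (subtopology (Ck Y) ?K) A" "openin Y V" "z \<in> A" "y \<in> V" "A \<times> V \<subseteq> ?P"
      unfolding openin_prod_topology_alt by meson
    obtain B where B: "openin (Ck Y) B" "A = B \<inter> ?K"
      using A(1) by (auto simp: openin_subtopology)
    have "eventually (\<lambda>n. f n \<in> B) sequentially"
      using lim B A(3) unfolding limitin_def by blast
    then have "eventually (\<lambda>n. f n \<in> A) sequentially"
      using B by (auto elim: eventually_mono)
    then obtain N where N: "\<And>n. n \<ge> N \<Longrightarrow> f n \<in> A" by (auto simp: eventually_sequentially)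
    have "V \<inter> F n = {}" if "n \<ge> N" for n
    proof (rule ccontr)
      assume "V \<inter> F n \<noteq> {}"
      then obtain x where x: "x \<in> V" "x \<in> F n" by blast
      then have "(f n, x) \<in> ?P" using A(5) N[OF that] by blast
      then have "f n x < 1" by auto
      then show False using g1[OF x(2)] FY x by (auto simp: f_def subset_iff split: if_splits)
    qed
    then have "{n. V \<inter> F n \<noteq> {}} \<subseteq> {..<N}" by (auto simp: not_less[symmetric])
    then show ?thesis using A finite_subset by blast
  qed
  then show False using nlf unfolding locally_finite_seq_def by blast
qed


section \<open>Clopen sets and cluster points of sequences\<close>

definition clopenin :: "'a topology \<Rightarrow> 'a set \<Rightarrow> bool" where
  "clopenin X A \<longleftrightarrow> openin X A \<and> closedin X A"

lemma clopenin_subset: "clopenin X A \<Longrightarrow> A \<subseteq> topspace X"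
  by (simp add: clopenin_def openin_subset)

lemma clopenin_empty [simp]: "clopenin X {}"
  by (simp add: clopenin_def)

lemma clopenin_topspace [simp]: "clopenin X (topspace X)"
  by (simp add: clopenin_def)

lemma clopenin_Un: "clopenin X A \<Longrightarrow> clopenin X B \<Longrightarrow> clopenin X (A \<union> B)"
  by (simp add: clopenin_def openin_Un closedin_Un)

lemma clopenin_Int: "clopenin X A \<Longrightarrow> clopenin X B \<Longrightarrow> clopenin X (A \<inter> B)"
  by (simp add: clopenin_def openin_Int closedin_Int)

lemma clopenin_Diff: "clopenin X A \<Longrightarrow> clopenin X B \<Longrightarrow> clopenin X (A - B)"
  by (simp add: clopenin_def openin_diff closedin_diff)

lemma clopenin_Union: "finite \<F> \<Longrightarrow> (\<And>A. A \<in> \<F> \<Longrightarrow> clopenin X A) \<Longrightarrow> clopenin X (\<Union>\<F>)"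
  by (simp add: clopenin_def openin_Union closedin_Union)

lemma openin_discrete_product_agree:
  assumes "finite E" "E \<subseteq> I"
  shows "openin (product_topology (\<lambda>i. discrete_topology (D i)) I) {g \<in> Pi\<^sub>E I D. \<forall>i\<in>E. g i = h i}"
  using assms
proof induction
  case empty
  have "openin (product_topology (\<lambda>i. discrete_topology (D i)) I)
     (topspace (product_topology (\<lambda>i. discrete_topology (D i)) I))" by (rule openin_topspace)
  then show ?case by simp
next
  case (insert i E)
  let ?P = "product_topology (\<lambda>i. discrete_topology (D i)) I"
  have "openin ?P {g \<in> topspace ?P. g i \<in> D i \<inter> {h i}}"
    using insert.prems
    by (intro openin_continuous_map_preimage[OF continuous_map_product_projection]) auto
  then have "openin ?P ({g \<in> topspace ?P. g i \<in> D i \<inter> {h i}} \<inter> {g \<in> Pi\<^sub>E I D. \<forall>i\<in>E. g i = h i})"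
    using insert by (intro openin_Int) auto
  moreover have "{g \<in> topspace ?P. g i \<in> D i \<inter> {h i}} \<inter> {g \<in> Pi\<^sub>E I D. \<forall>i\<in>E. g i = h i}
      = {g \<in> Pi\<^sub>E I D. \<forall>i\<in>insert i E. g i = h i}"
    using insert.prems by (auto simp: PiE_iff)
  ultimately show ?case by simp
qed

lemma compactin_cluster_point:
  assumes C: "compactin Y C" and s: "\<And>n::nat. s n \<in> C"
  shows "\<exists>h\<in>C. \<forall>U. openin Y U \<and> h \<in> U \<longrightarrow> infinite {n. s n \<in> U}"
proof (rule ccontr)
  assume "\<not> ?thesis"
  then have "\<forall>h\<in>C. \<exists>U. openin Y U \<and> h \<in> U \<and> finite {n. s n \<in> U}" by blast
  then obtain U where U: "\<And>h. h \<in> C \<Longrightarrow> openin Y (U h) \<and> h \<in> U h \<and> finite {n. s n \<in> U h}"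
    by metis
  have "\<exists>\<F>. finite \<F> \<and> \<F> \<subseteq> U ` C \<and> C \<subseteq> \<Union>\<F>"
    using U by (intro compactinD[OF C]) auto
  then obtain F where F: "finite F" "F \<subseteq> C" "C \<subseteq> (\<Union>h\<in>F. U h)"
    by (metis finite_subset_image)
  have "finite (\<Union>h\<in>F. {n. s n \<in> U h})"
    using F U by blast
  moreover have "(\<Union>h\<in>F. {n. s n \<in> U h}) = UNIV"
    using F(3) s by blast
  ultimately show False by simp
qed

subsection \<open>The space of two-valued functions\<close>

lemma topspace_Ck2: "topspace (Ck2 X) = continuous_maps X (discrete_topology {0, 1})"
  by (simp add: Ck2_def)

lemma mem_Ck2_iff:
  "f \<in> topspace (Ck2 X) \<longleftrightarrow> f \<in> extensional (topspace X) \<and> (\<forall>x\<in>topspace X. f x = 0 \<or> f x = 1) \<and>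
     clopenin X {x \<in> topspace X. f x = 1}" (is "?L \<longleftrightarrow> ?R")
proof
  assume ?L
  then have c: "continuous_map X (discrete_topology {0, 1}) f" and e: "f \<in> extensional (topspace X)"
    by (auto simp: topspace_Ck2 continuous_maps_def)
  have "openin X {x \<in> topspace X. f x \<in> {1}}"
    by (rule openin_continuous_map_preimage[OF c]) auto
  moreover have "closedin X {x \<in> topspace X. f x \<in> {1}}"
    by (rule closedin_continuous_map_preimage[OF c]) auto
  moreover have "\<forall>x\<in>topspace X. f x = 0 \<or> f x = 1"
    using continuous_map_funspace[OF c] by auto
  ultimately show ?R using e by (auto simp: clopenin_def)
next
  assume R: ?R
  let ?A = "{x \<in> topspace X. f x = 1}"
  have "openin X {x \<in> topspace X. f x \<in> U}" if "U \<subseteq> {0, 1}" for U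
  proof -
    have "{x \<in> topspace X. f x \<in> U} =
       (if 1 \<in> U then ?A else {}) \<union> (if 0 \<in> U then topspace X - ?A else {})"
      using R that by auto
    then show ?thesis
      using R by (auto simp: clopenin_def intro!: openin_Un openin_diff)
  qed
  then show ?L
    using R by (auto simp: topspace_Ck2 continuous_maps_def continuous_map_def)
qed

lemma Ck2_values: "f \<in> topspace (Ck2 X) \<Longrightarrow> x \<in> topspace X \<Longrightarrow> f x = 0 \<or> f x = 1"
  by (simp add: mem_Ck2_iff)

lemma Ck2_ext:
  assumes "f \<in> topspace (Ck2 X)" "g \<in> topspace (Ck2 X)" "\<And>x. x \<in> topspace X \<Longrightarrow> f x = g x"
  shows "f = g"
  using assms by (auto simp: mem_Ck2_iff intro: extensionalityI)

lemma clopenin_Ck2_level: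
  assumes "f \<in> topspace (Ck2 X)"
  shows "clopenin X {x \<in> topspace X. f x = i}"
proof -
  have 1: "clopenin X {x \<in> topspace X. f x = 1}" using assms mem_Ck2_iff by blast
  have "{x \<in> topspace X. f x = i} = (if i = 1 then {x \<in> topspace X. f x = 1} else
      if i = 0 then topspace X - {x \<in> topspace X. f x = 1} else {})"
    using assms by (auto simp: mem_Ck2_iff)
  then show ?thesis using 1 by (auto simp: clopenin_Diff)
qed

definition chi :: "'a topology \<Rightarrow> 'a set \<Rightarrow> 'a \<Rightarrow> nat" where
  "chi X A = restrict (\<lambda>x. of_bool (x \<in> A)) (topspace X)"

lemma chi_apply [simp]: "x \<in> topspace X \<Longrightarrow> chi X A x = of_bool (x \<in> A)"
  by (simp add: chi_def)

lemma chi_mem: "clopenin X A \<Longrightarrow> chi X A \<in> topspace (Ck2 X)"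
proof -
  assume A: "clopenin X A"
  have "{x \<in> topspace X. chi X A x = 1} = A"
    using clopenin_subset[OF A] by (auto split: if_splits simp: of_bool_def)
  then show ?thesis using A by (auto simp: mem_Ck2_iff chi_def)
qed

lemma glue_mem:
  assumes "f \<in> topspace (Ck2 X)" "g \<in> topspace (Ck2 X)" "clopenin X S"
  shows "(\<lambda>x. if x \<in> S then f x else g x) \<in> topspace (Ck2 X)"
proof -
  have "{x \<in> topspace X. (if x \<in> S then f x else g x) = 1} =
    (S \<inter> {x \<in> topspace X. f x = 1}) \<union> ({x \<in> topspace X. g x = 1} - S)"
    using clopenin_subset[OF assms(3)] by auto
  then show ?thesis
    using assms unfolding mem_Ck2_iff
    by (auto simp: clopenin_Un clopenin_Int clopenin_Diff extensional_def)
qed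

text \<open>For compact \<open>K\<close> this is a basic neighbourhood of \<open>f\<close>, because
  the target is discrete. It is also used with open \<open>K\<close>, where it is a closed set and,
  in the presence of isolated points, often a compact one.\<close>

definition agree :: "'a topology \<Rightarrow> ('a \<Rightarrow> nat) \<Rightarrow> 'a set \<Rightarrow> ('a \<Rightarrow> nat) set" where
  "agree X f K = {g \<in> topspace (Ck2 X). \<forall>x\<in>K. g x = f x}"

lemma agree_subset: "agree X f K \<subseteq> topspace (Ck2 X)"
  by (auto simp: agree_def)

lemma agree_self: "f \<in> topspace (Ck2 X) \<Longrightarrow> f \<in> agree X f K"
  by (simp add: agree_def)

text \<open>The level sets of \<open>f\<close> are clopen and cut \<open>K\<close> into two compact
  pieces, so agreement with \<open>f\<close> on \<open>K\<close> is an intersection of two subbasic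
  conditions.\<close>

lemma openin_agree:
  assumes f: "f \<in> topspace (Ck2 X)" and K: "compactin X K"
  shows "openin (Ck2 X) (agree X f K)"
proof -
  let ?C = "continuous_maps X (discrete_topology {0, 1::nat})"
  have *: "openin (Ck2 X) {g \<in> ?C. g ` (K \<inter> {x \<in> topspace X. f x = i}) \<subseteq> {i}}" if "i = 0 \<or> i = 1" for i
  proof -
    have "compactin X (K \<inter> {x \<in> topspace X. f x = i})"
      using clopenin_Ck2_level[OF f, of i] K compact_Int_closedin unfolding clopenin_def by blast
    then show ?thesis
      unfolding Ck2_def compact_open_topology_def openin_topology_generated_by_iff
      using that by (intro generate_topology_on.Basis) auto
  qed
  have "agree X f K = {g \<in> ?C. g ` (K \<inter> {x \<in> topspace X. f x = 0}) \<subseteq> {0}} \<inter>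
      {g \<in> ?C. g ` (K \<inter> {x \<in> topspace X. f x = 1}) \<subseteq> {1}}"
  proof (intro set_eqI iffI)
    fix g assume g: "g \<in> {g \<in> ?C. g ` (K \<inter> {x \<in> topspace X. f x = 0}) \<subseteq> {0}} \<inter>
      {g \<in> ?C. g ` (K \<inter> {x \<in> topspace X. f x = 1}) \<subseteq> {1}}"
    have "g x = f x" if "x \<in> K" for x
    proof -
      have x: "x \<in> topspace X" using that compactin_subset_topspace[OF K] by blast
      with f have "f x = 0 \<or> f x = 1" by (rule Ck2_values)
      then show ?thesis using g that x by auto
    qed
    then show "g \<in> agree X f K" using g by (simp add: agree_def topspace_Ck2)
  qed (auto simp: agree_def topspace_Ck2)
  then show ?thesis
    using *[of 0] *[of 1] by (simp add: openin_Int)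
qed

lemma openin_Ck2_iff:
  "openin (Ck2 X) W \<longleftrightarrow> W \<subseteq> topspace (Ck2 X) \<and> (\<forall>f\<in>W. \<exists>K. compactin X K \<and> agree X f K \<subseteq> W)"
proof
  assume W: "openin (Ck2 X) W"
  have gen: "\<forall>f\<in>W. \<exists>K. compactin X K \<and> agree X f K \<subseteq> W"
    if "generate_topology_on {{f \<in> continuous_maps X (discrete_topology {0, 1::nat}). f ` K \<subseteq> U} | K U.
           compactin X K \<and> openin (discrete_topology {0, 1}) U} W" for W
    using that
  proof induction
    case (Int a b)
    show ?case
    proof
      fix f assume "f \<in> a \<inter> b"
      then obtain K L where "compactin X K" "agree X f K \<subseteq> a" "compactin X L" "agree X f L \<subseteq> b"
        using Int.IH by blast
      then show "\<exists>K. compactin X K \<and> agree X f K \<subseteq> a \<inter> b"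
        by (intro exI[of _ "K \<union> L"]) (auto simp: compactin_Un agree_def subset_iff)
    qed
  next
    case (UN K)
    then show ?case by (meson UnionE Union_upper subset_trans)
  next
    case (Basis s)
    then obtain K U where s: "s = {f \<in> continuous_maps X (discrete_topology {0, 1::nat}). f ` K \<subseteq> U}"
      "compactin X K" by blast
    then have "agree X f K \<subseteq> s" if "f \<in> s" for f
      using that by (fastforce simp: agree_def topspace_Ck2)
    then show ?case using s by blast
  qed auto
  then show "W \<subseteq> topspace (Ck2 X) \<and> (\<forall>f\<in>W. \<exists>K. compactin X K \<and> agree X f K \<subseteq> W)"
    using openin_subset[OF W] gen
      W[unfolded Ck2_def compact_open_topology_def openin_topology_generated_by_iff] by simp
next
  assume R: "W \<subseteq> topspace (Ck2 X) \<and> (\<forall>f\<in>W. \<exists>K. compactin X K \<and> agree X f K \<subseteq> W)"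
  show "openin (Ck2 X) W"
  proof (subst openin_subopen, clarify)
    fix f assume f: "f \<in> W"
    then obtain K where "compactin X K" "agree X f K \<subseteq> W" using R by blast
    moreover have "f \<in> topspace (Ck2 X)" using f R by blast
    ultimately show "\<exists>T. openin (Ck2 X) T \<and> f \<in> T \<and> T \<subseteq> W"
      using openin_agree[of f X K] agree_self[of f X K] by (intro exI[of _ "agree X f K"]) simp
  qed
qed

lemma closedin_Ck2_iff:
  "closedin (Ck2 X) A \<longleftrightarrow> A \<subseteq> topspace (Ck2 X) \<and>
     (\<forall>f\<in>topspace (Ck2 X) - A. \<exists>K. compactin X K \<and> agree X f K \<inter> A = {})"
proof -
  have "agree X f K \<subseteq> topspace (Ck2 X) - A \<longleftrightarrow> agree X f K \<inter> A = {}" for f K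
    using agree_subset[of X f K] by blast
  then show ?thesis
    unfolding closedin_def openin_Ck2_iff by simp
qed

text \<open>A disagreement is witnessed at one point, and singletons are compact; this covers the
  sets \<open>agree X f S\<close> with \<open>S\<close> open that occur later.\<close>

lemma closedin_agree:
  assumes K: "K \<subseteq> topspace X"
  shows "closedin (Ck2 X) (agree X f K)"
  unfolding closedin_Ck2_iff
proof (intro conjI ballI)
  fix g assume g: "g \<in> topspace (Ck2 X) - agree X f K"
  then obtain x where x: "x \<in> K" "g x \<noteq> f x" by (auto simp: agree_def)
  then have "compactin X {x}" "agree X g {x} \<inter> agree X f K = {}"
    using K by (auto simp: agree_def)
  then show "\<exists>K'. compactin X K' \<and> agree X g K' \<inter> agree X f K = {}" by blast
qed (rule agree_subset)

lemma in_closure_of_Ck2: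
  "f \<in> Ck2 X closure_of A \<longleftrightarrow> f \<in> topspace (Ck2 X) \<and> (\<forall>K. compactin X K \<longrightarrow> (\<exists>g\<in>A. g \<in> agree X f K))"
proof (cases "f \<in> topspace (Ck2 X)")
  case True
  have "\<exists>g\<in>A. g \<in> T" if "\<forall>K. compactin X K \<longrightarrow> (\<exists>g\<in>A. g \<in> agree X f K)" "f \<in> T" "openin (Ck2 X) T" for T
    using that unfolding openin_Ck2_iff by blast
  moreover have "\<exists>g\<in>A. g \<in> agree X f K"
    if T: "\<forall>T. f \<in> T \<and> openin (Ck2 X) T \<longrightarrow> (\<exists>g\<in>A. g \<in> T)" and K: "compactin X K" for K
    using T[rule_format, of "agree X f K"] openin_agree[OF True K] agree_self[OF True] by simp
  ultimately have "(\<forall>T. f \<in> T \<and> openin (Ck2 X) T \<longrightarrow> (\<exists>g\<in>A. g \<in> T)) \<longleftrightarrow>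
      (\<forall>K. compactin X K \<longrightarrow> (\<exists>g\<in>A. g \<in> agree X f K))"
    by (intro iffI allI impI) simp_all
  then show ?thesis
    using True unfolding in_closure_of Bex_def by simp
qed (simp add: in_closure_of)

lemma limitin_Ck2_iff:
  "limitin (Ck2 X) s f F \<longleftrightarrow> f \<in> topspace (Ck2 X) \<and>
     (\<forall>K. compactin X K \<longrightarrow> eventually (\<lambda>n. s n \<in> agree X f K) F)"
proof (cases "f \<in> topspace (Ck2 X)")
  case True
  have "eventually (\<lambda>n. s n \<in> T) F"
    if s: "\<forall>K. compactin X K \<longrightarrow> eventually (\<lambda>n. s n \<in> agree X f K) F" and T: "f \<in> T" "openin (Ck2 X) T" for T
  proof -
    obtain K where "compactin X K" "agree X f K \<subseteq> T"
      using T unfolding openin_Ck2_iff by blast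
    then show ?thesis using s by (metis (mono_tags, lifting) eventually_mono subsetD)
  qed
  moreover have "eventually (\<lambda>n. s n \<in> agree X f K) F"
    if T: "\<forall>T. openin (Ck2 X) T \<and> f \<in> T \<longrightarrow> eventually (\<lambda>n. s n \<in> T) F" and K: "compactin X K" for K
    using T[rule_format, of "agree X f K"] openin_agree[OF True K] agree_self[OF True] by simp
  ultimately have "(\<forall>T. openin (Ck2 X) T \<and> f \<in> T \<longrightarrow> eventually (\<lambda>n. s n \<in> T) F) \<longleftrightarrow>
      (\<forall>K. compactin X K \<longrightarrow> eventually (\<lambda>n. s n \<in> agree X f K) F)"
    by (intro iffI allI impI) simp_all
  then show ?thesis
    using True unfolding limitin_def by simp
qed (simp add: limitin_def)

lemma Hausdorff_space_Ck2: "Hausdorff_space (Ck2 X)"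
  unfolding Hausdorff_space_def
proof (intro allI impI)
  fix f g assume fg: "f \<in> topspace (Ck2 X) \<and> g \<in> topspace (Ck2 X) \<and> f \<noteq> g"
  then obtain x where x: "x \<in> topspace X" "f x \<noteq> g x" using Ck2_ext by metis
  have "openin (Ck2 X) (agree X f {x})" "openin (Ck2 X) (agree X g {x})"
    using fg x by (auto intro!: openin_agree)
  moreover have "f \<in> agree X f {x}" "g \<in> agree X g {x}" "disjnt (agree X f {x}) (agree X g {x})"
    using fg x by (auto simp: agree_def disjnt_def)
  ultimately show "\<exists>U V. openin (Ck2 X) U \<and> openin (Ck2 X) V \<and> f \<in> U \<and> g \<in> V \<and> disjnt U V"
    by blast
qed

section \<open>Clopen sets of functions, compact sets of functions and the k-space criterion\<close>

lemma clopenin_indicator_continuous: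
  assumes "clopenin Y A"
  shows "continuous_map Y (top_of_set {0..1}) (\<lambda>y. of_bool (y \<in> A) :: real)"
proof -
  have A: "A \<subseteq> topspace Y" using assms clopenin_subset by blast
  have "continuous_map Y euclideanreal (\<lambda>y. of_bool (y \<in> A))"
  proof (rule continuous_map_realI)
    fix x and e :: real assume x: "x \<in> topspace Y" "0 < e"
    let ?U = "if x \<in> A then A else topspace Y - A"
    have "openin Y ?U" "x \<in> ?U" "\<forall>y\<in>?U. \<bar>of_bool (y \<in> A) - of_bool (x \<in> A) :: real\<bar> < e"
      using x assms by (auto simp: clopenin_def)
    then show "\<exists>U. openin Y U \<and> x \<in> U \<and> (\<forall>y\<in>U. \<bar>of_bool (y \<in> A) - of_bool (x \<in> A) :: real\<bar> < e)"
      by blast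
  qed
  then show ?thesis
    by (auto simp: continuous_map_in_subtopology)
qed

lemma clopenin_imp_R_open:
  assumes "clopenin Y A" shows "R_open Y A"
  unfolding R_open_def
proof (intro conjI ballI)
  fix x assume "x \<in> A"
  then show "\<exists>f :: 'a \<Rightarrow> real. continuous_map Y (top_of_set {0..1}) f \<and> f x = 1 \<and> f ` (topspace Y - A) \<subseteq> {0}"
    using clopenin_indicator_continuous[OF assms] by (intro exI[of _ "\<lambda>y. of_bool (y \<in> A)"]) auto
qed (use assms clopenin_subset in blast)

lemma clopenin_agree: "f \<in> topspace (Ck2 X) \<Longrightarrow> compactin X K \<Longrightarrow> clopenin (Ck2 X) (agree X f K)"
  unfolding clopenin_def by (intro conjI openin_agree closedin_agree compactin_subset_topspace)

lemma tychonoff_space_Ck2: "tychonoff_space (Ck2 X)"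
  unfolding tychonoff_space_def
proof
  show "t1_space (Ck2 X)" using Hausdorff_space_Ck2 Hausdorff_imp_t1_space by blast
  show "completely_regular_space (Ck2 X)"
    unfolding completely_regular_space_def
  proof (intro allI impI)
    fix A f assume Af: "closedin (Ck2 X) A \<and> f \<in> topspace (Ck2 X) - A"
    then obtain K where K: "compactin X K" "agree X f K \<inter> A = {}"
      using closedin_Ck2_iff by blast
    have f: "f \<in> topspace (Ck2 X)" and ff: "f \<in> agree X f K"
      using Af by (auto simp: agree_def)
    let ?B = "topspace (Ck2 X) - agree X f K"
    have "clopenin (Ck2 X) ?B"
      using clopenin_agree[OF f K(1)] by (simp add: clopenin_Diff)
    then have "continuous_map (Ck2 X) (top_of_set {0..1}) (\<lambda>y. of_bool (y \<in> ?B) :: real)"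
      by (rule clopenin_indicator_continuous)
    moreover have "A \<subseteq> ?B" using Af K(2) closedin_subset by blast
    ultimately show "\<exists>h :: _ \<Rightarrow> real. continuous_map (Ck2 X) (top_of_set {0..1}) h \<and> h f = 0 \<and> h ` A \<subseteq> {1}"
      using ff by (intro exI[of _ "\<lambda>y. of_bool (y \<in> ?B)"]) auto
  qed
qed

text \<open>The open sets \<open>agree X f K\<close> sort functions by their trace on
  \<open>K\<close>, so finitely many traces suffice for a compact family.\<close>

lemma compactin_Ck2_traces:
  assumes L: "compactin (Ck2 X) L" and K: "compactin X K"
  obtains F where "finite F" "F \<subseteq> L" "\<And>g. g \<in> L \<Longrightarrow> \<exists>f\<in>F. \<forall>x\<in>K. g x = f x"
proof -
  have sub: "L \<subseteq> topspace (Ck2 X)" using L compactin_subset_topspace by blast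
  have "\<exists>\<F>. finite \<F> \<and> \<F> \<subseteq> (\<lambda>f. agree X f K) ` L \<and> L \<subseteq> \<Union>\<F>"
  proof (rule compactinD[OF L])
    show "openin (Ck2 X) U" if "U \<in> (\<lambda>f. agree X f K) ` L" for U
      using that sub openin_agree[OF _ K] by auto
    show "L \<subseteq> \<Union>((\<lambda>f. agree X f K) ` L)"
      using sub agree_self by fastforce
  qed
  then obtain F where F: "finite F" "F \<subseteq> L" "L \<subseteq> (\<Union>f\<in>F. agree X f K)"
    by (metis finite_subset_image)
  then have "\<exists>f\<in>F. \<forall>x\<in>K. g x = f x" if "g \<in> L" for g
    using that unfolding agree_def by blast
  then show thesis using that F by blast
qed

text \<open>In the Hausdorff space of functions a closed trace on a compact set is itself compact
  and closed, which allows the k-space property to be tested with basic neighbourhoods.\<close>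

lemma k_space_Ck2I:
  assumes "\<And>A f. \<lbrakk>A \<subseteq> topspace (Ck2 X); \<And>L. compactin (Ck2 X) L \<Longrightarrow> compactin (Ck2 X) (L \<inter> A);
      f \<in> topspace (Ck2 X); f \<notin> A\<rbrakk> \<Longrightarrow> \<exists>K. compactin X K \<and> agree X f K \<inter> A = {}"
  shows "k_space (Ck2 X)"
  unfolding k_space_def
proof (intro allI impI iffI)
  fix S K assume "closedin (Ck2 X) S" "compactin (Ck2 X) K"
  then show "closedin (subtopology (Ck2 X) K) (K \<inter> S)"
    by (metis closedin_subtopology_Int_closed)
next
  fix A assume A: "A \<subseteq> topspace (Ck2 X)"
    and *: "\<forall>K. compactin (Ck2 X) K \<longrightarrow> closedin (subtopology (Ck2 X) K) (K \<inter> A)"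
  have "compactin (Ck2 X) (L \<inter> A)" if L: "compactin (Ck2 X) L" for L
  proof -
    have "closedin (Ck2 X) L"
      using L Hausdorff_space_Ck2 compactin_imp_closedin by blast
    then have "closedin (Ck2 X) (L \<inter> A)"
      using * L closedin_trans_full by blast
    then show ?thesis
      using L closed_compactin by blast
  qed
  then show "closedin (Ck2 X) A"
    unfolding closedin_Ck2_iff using A assms by blast
qed


subsection \<open>Hemicompact clopen sets\<close>

text \<open>The sequence is cofinal among the compact subsets of \<open>S\<close>. It is required to
  be increasing so that a compact set caught at one stage stays caught later.\<close>

definition hemicompact_in :: "'a topology \<Rightarrow> 'a set \<Rightarrow> bool" where
  "hemicompact_in X S \<longleftrightarrow> (\<exists>K :: nat \<Rightarrow> 'a set. mono K \<and> (\<forall>n. compactin X (K n) \<and> K n \<subseteq> S) \<and>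
     (\<forall>L. compactin X L \<and> L \<subseteq> S \<longrightarrow> (\<exists>n. L \<subseteq> K n)))"

lemma hemicompact_inE:
  assumes "hemicompact_in X S"
  obtains K :: "nat \<Rightarrow> 'a set" where "mono K" "\<And>n. compactin X (K n)" "\<And>n. K n \<subseteq> S"
    "\<And>L. compactin X L \<Longrightarrow> L \<subseteq> S \<Longrightarrow> \<exists>n. L \<subseteq> K n"
proof -
  obtain K :: "nat \<Rightarrow> 'a set" where "mono K \<and> (\<forall>n. compactin X (K n) \<and> K n \<subseteq> S) \<and>
     (\<forall>L. compactin X L \<and> L \<subseteq> S \<longrightarrow> (\<exists>n. L \<subseteq> K n))"
    using assms unfolding hemicompact_in_def by (rule exE)
  then show thesis by (intro that[of K]) auto
qed

lemma hemicompact_inI: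
  assumes "countable \<K>" and cK: "\<And>K. K \<in> \<K> \<Longrightarrow> compactin X K \<and> K \<subseteq> S"
    and cov: "\<And>L. compactin X L \<Longrightarrow> L \<subseteq> S \<Longrightarrow> \<exists>\<F>. finite \<F> \<and> \<F> \<subseteq> \<K> \<and> L \<subseteq> \<Union>\<F>"
  shows "hemicompact_in X S"
proof -
  \<comment> \<open>The empty set makes the family nonempty, so that it is the range of a
    sequence.\<close>
  let ?\<K> = "insert {} \<K>"
  define e where "e = from_nat_into ?\<K>"
  have e: "range e = ?\<K>"
    unfolding e_def using assms(1) by (intro range_from_nat_into) auto
  define K where "K n = (\<Union>i\<le>n. e i)" for n
  have "mono K" unfolding K_def by (intro monoI UN_mono) auto
  moreover have "compactin X (K n) \<and> K n \<subseteq> S" for n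
  proof -
    have "compactin X (e i) \<and> e i \<subseteq> S" for i
      using cK e by (metis (full_types) compactin_empty empty_subsetI insertE rangeI)
    then show ?thesis unfolding K_def by (auto intro!: compactin_Union)
  qed
  moreover have "\<exists>n. L \<subseteq> K n" if L: "compactin X L" "L \<subseteq> S" for L
  proof -
    obtain \<F> where F: "finite \<F>" "\<F> \<subseteq> \<K>" "L \<subseteq> \<Union>\<F>" using cov[OF L] by blast
    then have "\<F> \<subseteq> range e" using e by auto
    then obtain N where N: "finite N" "\<F> = e ` N" using F(1) finite_subset_image by metis
    then obtain n where "\<forall>i\<in>N. i \<le> n" using finite_nat_set_iff_bounded_le by blast
    then have "\<Union>\<F> \<subseteq> K n" unfolding K_def N by auto
    then show ?thesis using F by blast
  qed
  ultimately show ?thesis unfolding hemicompact_in_def by blast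
qed

lemma hemicompact_in_embedding:
  assumes e: "embedding_map Y X e" and h: "hemicompact_in Y (topspace Y)"
  shows "hemicompact_in X (e ` topspace Y)"
proof -
  obtain K :: "nat \<Rightarrow> _" where K: "mono K" "\<And>n. compactin Y (K n)" "\<And>n. K n \<subseteq> topspace Y"
    and K_cof: "\<And>L. compactin Y L \<Longrightarrow> L \<subseteq> topspace Y \<Longrightarrow> \<exists>n. L \<subseteq> K n"
    by (fact hemicompact_inE[OF h])
  have hom: "homeomorphic_map Y (subtopology X (e ` topspace Y)) e"
    using e by (simp add: embedding_map_def)
  then obtain g where g: "homeomorphic_maps Y (subtopology X (e ` topspace Y)) e g"
    using homeomorphic_map_maps by blast
  have sub: "e ` topspace Y \<subseteq> topspace X"
    using hom by (metis homeomorphic_imp_surjective_map inf_le1 topspace_subtopology)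
  have "compactin X (e ` K n) \<and> e ` K n \<subseteq> e ` topspace Y" for n
    using K(2)[of n] g compactin_subset_topspace[OF K(2)[of n]]
    unfolding homeomorphic_maps_def by (metis compactin_subtopology image_compactin)
  moreover have "mono (\<lambda>n. e ` K n)" using K(1) by (auto simp: mono_def)
  moreover have "\<exists>n. L \<subseteq> e ` K n" if L: "compactin X L" "L \<subseteq> e ` topspace Y" for L
  proof -
    have "compactin (subtopology X (e ` topspace Y)) L"
      using L by (simp add: compactin_subtopology)
    then have "compactin Y (g ` L)"
      using g image_compactin unfolding homeomorphic_maps_def by blast
    then obtain n where "g ` L \<subseteq> K n" using K_cof compactin_subset_topspace by blast
    moreover have "e (g y) = y" if "y \<in> L" for y
      using g that L(2) sub unfolding homeomorphic_maps_def by auto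
    ultimately have "L \<subseteq> e ` K n" by (metis image_eqI image_subset_iff subsetI)
    then show ?thesis by blast
  qed
  ultimately show ?thesis unfolding hemicompact_in_def by blast
qed

text \<open>A compact set not covered by finitely many members contains a sequence meeting each
  member only finitely often. Its range then has finite traces on the members, so it is closed, even
  with a point removed; this contradicts the existence of a cluster point.\<close>

lemma k_omega_imp_hemicompact:
  assumes T1: "t1_space Y" and "k_omega_space Y"
  shows "hemicompact_in Y (topspace Y)"
proof -
  obtain \<K> where k: "countable \<K> \<and> (\<forall>K\<in>\<K>. compactin Y K) \<and> \<Union>\<K> = topspace Y \<and>
      (\<forall>F. F \<subseteq> topspace Y \<longrightarrow> (closedin Y F \<longleftrightarrow> (\<forall>K\<in>\<K>. closedin (subtopology Y K) (F \<inter> K))))"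
    using assms(2) unfolding k_omega_space_def by (rule exE)
  have \<K>: "countable \<K>" "\<And>K. K \<in> \<K> \<Longrightarrow> compactin Y K" "\<Union>\<K> = topspace Y"
    using k[THEN conjunct1] k[THEN conjunct2, THEN conjunct1] k[THEN conjunct2, THEN conjunct2, THEN conjunct1]
    by simp_all
  have cl: "closedin Y F"
    if "F \<subseteq> topspace Y" "\<And>K. K \<in> \<K> \<Longrightarrow> closedin (subtopology Y K) (F \<inter> K)" for F
    using k[THEN conjunct2, THEN conjunct2, THEN conjunct2, rule_format, OF that(1)] that(2) by simp
  show ?thesis
  proof (rule hemicompact_inI[OF \<K>(1)])
    fix L assume L: "compactin Y L" "L \<subseteq> topspace Y"
    show "\<exists>\<F>. finite \<F> \<and> \<F> \<subseteq> \<K> \<and> L \<subseteq> \<Union>\<F>"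
    proof (cases "\<K> = {}")
      case True
      then show ?thesis using L \<K>(3) by auto
    next
      case False
      define e where "e = from_nat_into \<K>"
      have e: "range e = \<K>"
        unfolding e_def using \<K>(1) False by (intro range_from_nat_into) auto
      show ?thesis
      proof (rule ccontr)
        assume no: "\<not> ?thesis"
        have "\<exists>x. x \<in> L - (\<Union>i\<le>n. e i)" for n
        proof -
          have "finite (e ` {..n})" "e ` {..n} \<subseteq> \<K>" using e by auto
          then have "\<not> L \<subseteq> \<Union>(e ` {..n})" using no by blast
          then show ?thesis by blast
        qed
        then obtain x where x: "\<And>n. x n \<in> L" "\<And>n i. i \<le> n \<Longrightarrow> x n \<notin> e i"
          by (metis DiffE UN_I atMost_iff)
        have fin: "finite {n. x n \<in> e i}" for i
        proof (rule finite_subset[of _ "{..<i}"])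
          show "{n. x n \<in> e i} \<subseteq> {..<i}"
          proof
            fix n assume "n \<in> {n. x n \<in> e i}"
            then have "\<not> i \<le> n" using x(2) by blast
            then show "n \<in> {..<i}" by simp
          qed
        qed simp
        obtain h where h: "h \<in> L" "\<And>U. openin Y U \<Longrightarrow> h \<in> U \<Longrightarrow> infinite {n. x n \<in> U}"
          using compactin_cluster_point[OF L(1), of x] x(1) by blast
        \<comment> \<open>The cluster point may itself be a term of the sequence and is therefore
          removed. It is a term only finitely often, since it lies in some
          \<open>e i\<close>.\<close>
        let ?F = "range x - {h}"
        have "closedin Y ?F"
        proof (rule cl)
          fix K assume K: "K \<in> \<K>"
          then obtain i where i: "K = e i" using e by blast
          have "finite (x ` {n. x n \<in> e i})" using fin by blast
          then have "finite (?F \<inter> K)" by (rule rev_finite_subset) (auto simp: i)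
          then have "closedin Y (?F \<inter> K)"
            using T1 x(1) L(2) by (intro t1_space_closedin_finite[THEN iffD1, rule_format]) auto
          then show "closedin (subtopology Y K) (?F \<inter> K)"
            by (intro closedin_subset_topspace) auto
        qed (use x(1) L(2) in auto)
        then have "openin Y (topspace Y - ?F)" by blast
        moreover have "h \<in> topspace Y - ?F" using h(1) L(2) by auto
        ultimately have "infinite {n. x n \<in> topspace Y - ?F}" using h(2) by blast
        moreover obtain i where "h \<in> e i" using h(1) L(2) \<K>(3) e by blast
        then have "{n. x n \<in> topspace Y - ?F} \<subseteq> {n. x n \<in> e i}" by auto
        ultimately show False using fin finite_subset by blast
      qed
    qed
  qed (use \<K> compactin_subset_topspace in blast)
qed

section \<open>Clopen sets and compact families of functions over a zero-dimensional
  \<open>k_R_space\<close>\<close>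

locale k_R_zero_dim =
  fixes X :: "'a topology"
  assumes zero_dim: "zero_dimensional X" and Haus: "Hausdorff_space X" and k_R: "k_R_space X"
begin

lemma compact_closedin: "compactin X K \<Longrightarrow> closedin X K"
  using Haus compactin_imp_closedin by blast

lemma finite_compactin: "finite F \<Longrightarrow> F \<subseteq> topspace X \<Longrightarrow> compactin X F"
  by (rule finite_imp_compactin)

lemma clopen_nhd:
  assumes "openin X U" "x \<in> U"
  obtains A where "clopenin X A" "x \<in> A" "A \<subseteq> U"
  using assms zero_dim unfolding zero_dimensional_def clopenin_def by blast

lemma compact_clopen_nhd:
  assumes K: "compactin X K" and U: "openin X U" "K \<subseteq> U"
  obtains A where "clopenin X A" "K \<subseteq> A" "A \<subseteq> U"
proof -
  have "\<forall>x\<in>K. \<exists>A. clopenin X A \<and> x \<in> A \<and> A \<subseteq> U"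
    using U clopen_nhd by (metis subsetD)
  then obtain A where A: "\<And>x. x \<in> K \<Longrightarrow> clopenin X (A x) \<and> x \<in> A x \<and> A x \<subseteq> U" by metis
  have "\<exists>\<F>. finite \<F> \<and> \<F> \<subseteq> A ` K \<and> K \<subseteq> \<Union>\<F>"
    using A by (intro compactinD[OF K]) (auto simp: clopenin_def)
  then obtain \<F> where F: "finite \<F>" "\<F> \<subseteq> A ` K" "K \<subseteq> \<Union>\<F>" by blast
  have "clopenin X (\<Union>\<F>)" using F A by (intro clopenin_Union) auto
  moreover have "\<Union>\<F> \<subseteq> U" using F A by blast
  ultimately show thesis using F(3) by (intro that[of "\<Union>\<F>"])
qed

text \<open>The indicator of \<open>A\<close> is continuous on every compact set, hence continuous.
  All later uses of the real-valued property of \<open>X\<close> pass through this statement about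
  clopen sets.\<close>

lemma clopenin_k_R:
  assumes AX: "A \<subseteq> topspace X"
    and A: "\<And>K. compactin X K \<Longrightarrow> closedin X (K \<inter> A) \<and> closedin X (K - A)"
  shows "clopenin X A"
proof -
  let ?f = "\<lambda>x. of_bool (x \<in> A) :: real"
  have "continuous_map (subtopology X K) euclideanreal ?f" if K: "compactin X K" for K
  proof -
    have KX: "K \<subseteq> topspace X" using K compactin_subset_topspace by blast
    have cl: "closedin (subtopology X K) (K \<inter> A)" "closedin (subtopology X K) (K - A)"
      using A[OF K] closedin_subset_topspace by (metis Int_lower1) (metis A K Diff_subset closedin_subset_topspace)
    have "K - (K - A) = K \<inter> A" by blast
    then have "openin (subtopology X K) (K \<inter> A)"
      using cl(2) KX unfolding closedin_def by (simp add: Int_absorb1)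
    then have "clopenin (subtopology X K) (K \<inter> A)"
      using cl by (simp add: clopenin_def)
    then have "continuous_map (subtopology X K) euclideanreal (\<lambda>x. of_bool (x \<in> K \<inter> A))"
      using clopenin_indicator_continuous continuous_map_into_fulltopology by blast
    then show ?thesis
      by (rule continuous_map_eq) auto
  qed
  then have f: "continuous_map X euclideanreal ?f"
    using k_R unfolding k_R_space_def by blast
  have "openin X {x \<in> topspace X. ?f x \<in> {1/2<..}}" "closedin X {x \<in> topspace X. ?f x \<in> {1/2..}}"
    using f by (intro openin_continuous_map_preimage[OF f] closedin_continuous_map_preimage[OF f]; simp)+
  moreover have "{x \<in> topspace X. ?f x \<in> {1/2<..}} = A" "{x \<in> topspace X. ?f x \<in> {1/2..}} = A"
    using AX by (auto simp: of_bool_def split: if_splits)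
  ultimately show ?thesis by (simp add: clopenin_def)
qed

lemma clopenin_k_R_traces:
  assumes "A \<subseteq> topspace X"
    and A: "\<And>K. compactin X K \<Longrightarrow> \<exists>B. clopenin X B \<and> K \<inter> A = K \<inter> B"
  shows "clopenin X A"
proof (rule clopenin_k_R)
  fix K assume K: "compactin X K"
  then obtain B where B: "clopenin X B" "K \<inter> A = K \<inter> B" using A by blast
  have "K - A = K - B" using B by blast
  then show "closedin X (K \<inter> A) \<and> closedin X (K - A)"
    using B compact_closedin[OF K] unfolding clopenin_def
    by (simp add: closedin_Int closedin_diff)
qed fact

text \<open>A completeness statement: it certifies that limit functions, known only through their
  traces on compact sets, are continuous.\<close>

lemma Ck2_of_traces:
  assumes e: "f \<in> extensional (topspace X)"
    and t: "\<And>K. compactin X K \<Longrightarrow> \<exists>g\<in>topspace (Ck2 X). \<forall>x\<in>K. f x = g x"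
  shows "f \<in> topspace (Ck2 X)"
  unfolding mem_Ck2_iff
proof (intro conjI ballI)
  fix x assume x: "x \<in> topspace X"
  then obtain g where "g \<in> topspace (Ck2 X)" "f x = g x" using t[of "{x}"] by auto
  then show "f x = 0 \<or> f x = 1" using Ck2_values x by metis
next
  show "clopenin X {x \<in> topspace X. f x = 1}"
  proof (rule clopenin_k_R_traces)
    fix K assume K: "compactin X K"
    then obtain g where g: "g \<in> topspace (Ck2 X)" "\<forall>x\<in>K. f x = g x" using t by blast
    then show "\<exists>B. clopenin X B \<and> K \<inter> {x \<in> topspace X. f x = 1} = K \<inter> B"
      by (intro exI[of _ "{x \<in> topspace X. g x = 1}"] conjI clopenin_Ck2_level) auto
  qed auto
qed (rule e)

text \<open>On a set with finite traces the compact-open topology coincides with the pointwise one, since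
  finitely many points of a compact set separate its finitely many traces.\<close>

lemma compactin_Ck2I:
  assumes cl: "closedin (Ck2 X) L"
    and tr: "\<And>K. compactin X K \<Longrightarrow> \<exists>F. finite F \<and> (\<forall>g\<in>L. \<exists>f\<in>F. \<forall>x\<in>K. g x = f x)"
  shows "compactin (Ck2 X) L"
proof -
  let ?P = "product_topology (\<lambda>_. discrete_topology {0, 1::nat}) (topspace X)"
  have LC: "L \<subseteq> topspace (Ck2 X)" using cl closedin_subset by blast
  have C_sub: "topspace (Ck2 X) \<subseteq> topspace ?P"
  proof
    fix g assume g: "g \<in> topspace (Ck2 X)"
    have "g x \<in> {0, 1}" if "x \<in> topspace X" for x using Ck2_values[OF g that] by simp
    moreover have "g \<in> extensional (topspace X)" using g mem_Ck2_iff by blast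
    ultimately show "g \<in> topspace ?P" by (simp add: PiE_iff)
  qed
  define Q where "Q E g g' \<longleftrightarrow> (\<forall>x\<in>E. g x = g' x)" for E and g g' :: "'a \<Rightarrow> nat"
  have Q_sym: "Q E g g' \<Longrightarrow> Q E g' g" and Q_trans: "Q E g g' \<Longrightarrow> Q E g' g'' \<Longrightarrow> Q E g g''" for E g g' g''
    by (auto simp: Q_def)
  have sep: "\<exists>E. finite E \<and> E \<subseteq> K \<and> (\<forall>g\<in>L. \<forall>g'\<in>L. Q E g g' \<longrightarrow> Q K g g')"
    if K: "compactin X K" for K
  proof -
    obtain F where F: "finite F" "\<forall>g\<in>L. \<exists>f\<in>F. Q K g f"
      using tr[OF K] unfolding Q_def by (elim exE conjE)
    define c where "c p = (SOME x. x \<in> K \<and> fst p x \<noteq> snd p x)" for p :: "('a \<Rightarrow> nat) \<times> ('a \<Rightarrow> nat)"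
    define D where "D = {p \<in> F \<times> F. \<not> Q K (fst p) (snd p)}"
    have c: "c p \<in> K \<and> fst p (c p) \<noteq> snd p (c p)" if "p \<in> D" for p
      using someI_ex[of "\<lambda>x. x \<in> K \<and> fst p x \<noteq> snd p x"] that unfolding c_def D_def Q_def by auto
    show ?thesis
    proof (intro exI[of _ "c ` D"] conjI ballI impI)
      show "finite (c ` D)" using F(1) by (simp add: D_def)
      show "c ` D \<subseteq> K" using c by blast
      fix g g' assume g: "g \<in> L" "g' \<in> L" "Q (c ` D) g g'"
      obtain f where f: "f \<in> F" "Q K g f" using F(2) g(1) by blast
      obtain f' where f': "f' \<in> F" "Q K g' f'" using F(2) g(2) by blast
      have "Q K f f'"
      proof (rule ccontr)
        assume "\<not> Q K f f'"
        then have "(f, f') \<in> D" using f f' by (simp add: D_def)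
        then have "c (f, f') \<in> K" "f (c (f, f')) \<noteq> f' (c (f, f'))" "g (c (f, f')) = g' (c (f, f'))"
          using c[of "(f, f')"] g(3) by (auto simp: Q_def)
        then show False using f(2) f'(2) by (simp add: Q_def)
      qed
      then show "Q K g g'" using f(2) f'(2) Q_trans Q_sym by blast
    qed
  qed
  have P_agree: "openin ?P {g \<in> topspace ?P. Q E g h}" if "finite E" "E \<subseteq> topspace X" for E h
    using openin_discrete_product_agree[OF that, of "\<lambda>_. {0, 1}" h] by (simp add: Q_def)
  have "closedin ?P L"
    unfolding closedin_def
  proof
    show "L \<subseteq> topspace ?P" using LC C_sub by blast
    show "openin ?P (topspace ?P - L)"
    proof (subst openin_subopen, intro ballI)
      fix h assume h: "h \<in> topspace ?P - L"
      have "\<exists>E. finite E \<and> E \<subseteq> topspace X \<and> (\<forall>g\<in>L. \<not> Q E g h)"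
      proof (rule ccontr)
        assume no: "\<not> ?thesis"
        then have ap: "\<exists>g\<in>L. Q E g h" if "finite E" "E \<subseteq> topspace X" for E
          using that by blast
        \<comment> \<open>All members of \<open>L\<close> that agree with \<open>h\<close> on the
          separating set \<open>E\<close> have one and the same trace on \<open>K\<close>. Adding an
          arbitrary point \<open>x\<close> of \<open>K\<close> to \<open>E\<close> shows that this
          trace takes the value \<open>h x\<close>.\<close>
        have tr_h: "\<exists>g\<in>L. Q K h g" if K: "compactin X K" for K
        proof -
          have KX: "K \<subseteq> topspace X" using K compactin_subset_topspace by blast
          obtain E where E: "finite E" "E \<subseteq> K" and E': "\<forall>g\<in>L. \<forall>g'\<in>L. Q E g g' \<longrightarrow> Q K g g'"
            using sep[OF K] by blast
          obtain g where g: "g \<in> L" "Q E g h" using ap[of E] E KX by blast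
          have "h x = g x" if x: "x \<in> K" for x
          proof -
            obtain g' where g': "g' \<in> L" "Q (insert x E) g' h"
              using ap[of "insert x E"] E KX x by blast
            have "Q E g g'" using g(2) g'(2) by (simp add: Q_def)
            then have "Q K g g'" using E' g(1) g'(1) by blast
            then show ?thesis using g' x by (simp add: Q_def)
          qed
          then have "Q K h g" by (simp add: Q_def)
          then show ?thesis using g(1) by blast
        qed
        have hC: "h \<in> topspace (Ck2 X)"
        proof (rule Ck2_of_traces)
          show "h \<in> extensional (topspace X)" using h by (auto simp: PiE_iff)
          fix K assume "compactin X K"
          then obtain g where "g \<in> L" "Q K h g" using tr_h by blast
          then show "\<exists>g\<in>topspace (Ck2 X). \<forall>x\<in>K. h x = g x"
            using LC unfolding Q_def by (intro bexI[of _ g]) auto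
        qed
        then obtain K where K: "compactin X K" "agree X h K \<inter> L = {}"
          using cl h unfolding closedin_Ck2_iff by blast
        obtain g where g: "g \<in> L" "Q K h g" using tr_h[OF K(1)] by blast
        then have "g \<in> agree X h K" using LC by (auto simp: agree_def Q_def)
        then show False using K(2) g(1) by blast
      qed
      then obtain E where E: "finite E" "E \<subseteq> topspace X" "\<forall>g\<in>L. \<not> Q E g h" by blast
      have "{g \<in> topspace ?P. Q E g h} \<subseteq> topspace ?P - L" using E(3) by blast
      moreover have "h \<in> {g \<in> topspace ?P. Q E g h}" using h by (simp add: Q_def)
      ultimately show "\<exists>T. openin ?P T \<and> h \<in> T \<and> T \<subseteq> topspace ?P - L"
        using P_agree[OF E(1,2), of h] by (intro exI[of _ "{g \<in> topspace ?P. Q E g h}"] conjI)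
    qed
  qed
  moreover have "compact_space ?P"
    by (simp add: compact_space_product_topology compact_space_discrete_topology)
  ultimately have "compactin ?P L" using closedin_compact_space by blast
  then have cL: "compactin (subtopology ?P L) L" by (simp add: compactin_subtopology)
  have "continuous_map (subtopology ?P L) (Ck2 X) (\<lambda>g. g)"
    unfolding continuous_map_def
  proof (intro conjI allI impI)
    show "(\<lambda>g. g) \<in> topspace (subtopology ?P L) \<rightarrow> topspace (Ck2 X)" using LC by auto
    fix W assume W: "openin (Ck2 X) W"
    show "openin (subtopology ?P L) {g \<in> topspace (subtopology ?P L). g \<in> W}"
    proof (subst openin_subopen, clarify)
      fix f assume f: "f \<in> topspace (subtopology ?P L)" "f \<in> W"
      then have fL: "f \<in> L" by simp
      obtain K where K: "compactin X K" "agree X f K \<subseteq> W"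
        using W f(2) unfolding openin_Ck2_iff by blast
      obtain E where E: "finite E" "E \<subseteq> K" and E': "\<forall>g\<in>L. \<forall>g'\<in>L. Q E g g' \<longrightarrow> Q K g g'"
        using sep[OF K(1)] by blast
      let ?T = "L \<inter> {g \<in> topspace ?P. Q E g f}"
      have "E \<subseteq> topspace X" using E(2) compactin_subset_topspace[OF K(1)] by blast
      then have "openin (subtopology ?P L) ?T"
        using P_agree[OF E(1)] by (intro openin_subtopology_Int2)
      moreover have "f \<in> ?T" using f by (simp add: Q_def)
      moreover have "?T \<subseteq> {g \<in> topspace (subtopology ?P L). g \<in> W}"
      proof
        fix g assume g: "g \<in> ?T"
        then have "Q K g f" using E' fL by blast
        then have "g \<in> agree X f K" using g LC by (auto simp: agree_def Q_def)
        then show "g \<in> {g \<in> topspace (subtopology ?P L). g \<in> W}" using K(2) g by auto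
      qed
      ultimately show "\<exists>T. openin (subtopology ?P L) T \<and> f \<in> T \<and>
           T \<subseteq> {g \<in> topspace (subtopology ?P L). g \<in> W}" by (intro exI[of _ ?T] conjI)
    qed
  qed
  then have "compactin (Ck2 X) ((\<lambda>g. g) ` L)"
    using cL image_compactin by blast
  then show ?thesis by simp
qed

text \<open>On a compact set every function in the closure has the trace of some member of
  \<open>L\<close>, so the finite list of traces does not grow.\<close>

lemma compactin_Ck2_closure_of:
  assumes LC: "L \<subseteq> topspace (Ck2 X)"
    and tr: "\<And>K. compactin X K \<Longrightarrow> \<exists>F. finite F \<and> (\<forall>g\<in>L. \<exists>f\<in>F. \<forall>x\<in>K. g x = f x)"
  shows "compactin (Ck2 X) (Ck2 X closure_of L)"
proof (rule compactin_Ck2I)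
  fix K assume K: "compactin X K"
  then obtain F where F: "finite F" "\<forall>g\<in>L. \<exists>f\<in>F. \<forall>x\<in>K. g x = f x"
    using tr[OF K] by (elim exE conjE)
  have "\<exists>f\<in>F. \<forall>x\<in>K. h x = f x" if h: "h \<in> Ck2 X closure_of L" for h
  proof -
    obtain g where "g \<in> L" "g \<in> agree X h K" using h K unfolding in_closure_of_Ck2 by blast
    then show ?thesis using F(2)[rule_format, of g] by (auto simp: agree_def)
  qed
  then show "\<exists>F. finite F \<and> (\<forall>g\<in>Ck2 X closure_of L. \<exists>f\<in>F. \<forall>x\<in>K. g x = f x)"
    using F(1) by blast
qed (rule closedin_closure_of)

text \<open>A point outside \<open>F\<close> is separated from \<open>F\<close> by a set that is built along the compact exhaustion;
  its traces are clopen, so it is clopen in the \<open>k\<^sub>\<real>\<close>-space \<open>X\<close>.\<close>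

lemma hemicompact_imp_k_omega:
  assumes S: "clopenin X S" and h: "hemicompact_in X S"
  shows "k_omega_space (subtopology X S)"
proof -
  obtain K where K: "mono K" "\<And>n. compactin X (K n)" "\<And>n. K n \<subseteq> S"
    and cof: "\<And>L. compactin X L \<Longrightarrow> L \<subseteq> S \<Longrightarrow> \<exists>n::nat. L \<subseteq> K n"
    by (fact hemicompact_inE[OF h])
  have SX: "S \<subseteq> topspace X" using S clopenin_subset by blast
  have covS: "\<exists>n. x \<in> K n" if "x \<in> S" for x
    using cof[of "{x}"] that SX by auto
  have clF: "closedin (subtopology X S) F"
    if FS: "F \<subseteq> topspace (subtopology X S)"
      and tr: "\<And>n. closedin (subtopology (subtopology X S) (K n)) (F \<inter> K n)" for F
  proof -
    have FK: "closedin X (F \<inter> K n)" for n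
    proof -
      have "closedin (subtopology X (K n)) (F \<inter> K n)"
        using tr[of n] K(3)[of n] by (simp add: subtopology_subtopology Int_absorb1)
      then show ?thesis using compact_closedin[OF K(2)] closedin_trans_full by blast
    qed
    have "openin X (topspace X - F)"
    proof (subst openin_subopen, intro ballI)
      fix p assume p: "p \<in> topspace X - F"
      show "\<exists>T. openin X T \<and> p \<in> T \<and> T \<subseteq> topspace X - F"
      proof (cases "p \<in> S")
        case False
        then show ?thesis
          using p S FS by (intro exI[of _ "topspace X - S"]) (auto simp: clopenin_def)
      next
        case True
        define P where "P n A \<longleftrightarrow> clopenin X A \<and> p \<in> A \<and> A \<inter> (F \<inter> K n) = {}" for n A
        have "\<exists>A. \<forall>n. P n (A n) \<and> A (Suc n) \<inter> K n = A n \<inter> K n"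
        proof (rule dependent_nat_choice)
          have "openin X (topspace X - F \<inter> K 0)" using FK[of 0] by blast
          then obtain A where "clopenin X A" "p \<in> A" "A \<subseteq> topspace X - F \<inter> K 0"
            using clopen_nhd p by (metis Diff_iff IntD1)
          then show "\<exists>A. P 0 A" unfolding P_def by blast
        next
          fix A n assume A: "P n A"
          \<comment> \<open>Avoiding \<open>K n - A\<close> and containing
            \<open>A \<inter> K n\<close> freezes the trace on \<open>K n\<close>, while
            \<open>F\<close> is avoided on the next compact set.\<close>
          let ?U = "topspace X - ((K n - A) \<union> F \<inter> K (Suc n))"
          let ?C = "insert p (A \<inter> K n)"
          have "closedin X (K n - A)"
            using A compact_closedin[OF K(2)] by (simp add: P_def clopenin_def closedin_diff)
          then have U: "openin X ?U" using FK by blast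
          have "compactin X (K n \<inter> A)"
            using A K(2) compact_Int_closedin by (auto simp: P_def clopenin_def)
          then have C: "compactin X ?C"
            using compactin_Un[of X "{p}" "A \<inter> K n"] p by (simp add: Int_commute)
          have "?C \<subseteq> ?U"
            using p A compactin_subset_topspace[OF K(2)[of n]] by (auto simp: P_def)
          then obtain B where B: "clopenin X B" "?C \<subseteq> B" "B \<subseteq> ?U"
            using compact_clopen_nhd[OF C U] by metis
          then have "P (Suc n) B \<and> B \<inter> K n = A \<inter> K n"
            by (auto simp: P_def)
          then show "\<exists>B. P (Suc n) B \<and> B \<inter> K n = A \<inter> K n" by blast
        qed
        then obtain A where A: "\<And>n. P n (A n)" and step: "\<And>n. A (Suc n) \<inter> K n = A n \<inter> K n"
          by blast
        have stab: "A m \<inter> K n = A n \<inter> K n" if "n \<le> m" for m n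
          using that
        proof (induction m rule: dec_induct)
          case (step m)
          have "K n \<subseteq> K m" using K(1) step.hyps by (simp add: monoD)
          then show ?case using step.IH \<open>\<And>n. A (Suc n) \<inter> K n = A n \<inter> K n\<close>[of m] by blast
        qed simp
        \<comment> \<open>On \<open>K n\<close> this set has the trace of the clopen set
          \<open>A n\<close>. Cofinality of the \<open>K n\<close> passes this on to all compact
          sets, as \<open>clopenin_k_R_traces\<close> demands.\<close>
        define B where "B = (\<Union>n. A n \<inter> K n)"
        have BK: "B \<inter> K n = A n \<inter> K n" for n
        proof
          show "B \<inter> K n \<subseteq> A n \<inter> K n"
          proof
            fix x assume "x \<in> B \<inter> K n"
            then obtain m where m: "x \<in> A m" "x \<in> K m" "x \<in> K n" by (auto simp: B_def)
            show "x \<in> A n \<inter> K n"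
              using stab[of m n] stab[of n m] m by (cases "m \<le> n") auto
          qed
        qed (auto simp: B_def)
        have BS: "B \<subseteq> S" using K(3) by (auto simp: B_def)
        have "clopenin X B"
        proof (rule clopenin_k_R_traces)
          fix L assume L: "compactin X L"
          then have "compactin X (L \<inter> S)"
            using S compact_Int_closedin by (auto simp: clopenin_def)
          then obtain n where n: "L \<inter> S \<subseteq> K n" using cof by blast
          have "L \<inter> B = L \<inter> (A n \<inter> S)" using n BK[of n] BS by blast
          then show "\<exists>C. clopenin X C \<and> L \<inter> B = L \<inter> C"
            using clopenin_Int[OF _ S, of "A n"] A[of n] unfolding P_def by (intro exI[of _ "A n \<inter> S"]) simp
        qed (use BS SX in blast)
        moreover have "p \<in> B" using covS[OF True] A by (auto simp: B_def P_def)
        moreover have "B \<inter> F = {}" using A by (auto simp: B_def P_def)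
        ultimately show ?thesis
          using clopenin_subset by (intro exI[of _ B]) (auto simp: clopenin_def)
      qed
    qed
    then have "closedin X F" using FS by (auto simp: closedin_def)
    then show ?thesis using FS by (intro closedin_subset_topspace) auto
  qed
  show ?thesis
    unfolding k_omega_space_def
  proof (intro exI[of _ "range K"] conjI ballI allI impI)
    show "\<Union>(range K) = topspace (subtopology X S)" using covS K(3) SX by auto
    fix L assume "L \<in> range K"
    then show "compactin (subtopology X S) L" using K by (auto simp: compactin_subtopology)
  next
    fix F assume F: "F \<subseteq> topspace (subtopology X S)"
    show "closedin (subtopology X S) F \<longleftrightarrow>
        (\<forall>L\<in>range K. closedin (subtopology (subtopology X S) L) (F \<inter> L))"
    proof
      assume cl: "closedin (subtopology X S) F"
      show "\<forall>L\<in>range K. closedin (subtopology (subtopology X S) L) (F \<inter> L)"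
      proof
        fix L
        show "closedin (subtopology (subtopology X S) L) (F \<inter> L)"
          using closedin_subtopology_Int_closed[OF cl, of L] by (simp only: Int_commute)
      qed
    qed (use clF[OF F] in auto)
  qed simp
qed

end


subsection \<open>Isolated points\<close>

lemma openin_isolated:
  assumes "A \<subseteq> topspace X" "A \<inter> non_isolated_points X = {}"
  shows "openin X A"
proof -
  have "openin X {x}" if "x \<in> A" for x
    using assms that by (auto simp: non_isolated_points_def)
  then have "openin X (\<Union>x\<in>A. {x})" by blast
  then show ?thesis by simp
qed

lemma closedin_non_isolated_superset:
  assumes "A \<subseteq> topspace X" "non_isolated_points X \<subseteq> A"
  shows "closedin X A"
  unfolding closedin_def using assms openin_isolated[of "topspace X - A" X] by blast

lemma compactin_isolated_finite:
  assumes K: "compactin X K" and "K \<inter> non_isolated_points X = {}"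
  shows "finite K"
proof -
  have KX: "K \<subseteq> topspace X" using K compactin_subset_topspace by blast
  have "\<exists>\<F>. finite \<F> \<and> \<F> \<subseteq> (\<lambda>x. {x}) ` K \<and> K \<subseteq> \<Union>\<F>"
  proof (rule compactinD[OF K])
    show "openin X U" if "U \<in> (\<lambda>x. {x}) ` K" for U
      using that assms(2) KX by (intro openin_isolated) auto
  qed auto
  then obtain F where F: "finite F" "F \<subseteq> K" "K \<subseteq> (\<Union>x\<in>F. {x})"
    by (metis finite_subset_image)
  then show ?thesis using finite_subset by auto
qed

lemma compactin_locally_finite_in:
  assumes lf: "locally_finite_in X \<U>" and K: "compactin X K"
  shows "finite {U \<in> \<U>. U \<inter> K \<noteq> {}}"
proof -
  have "\<forall>x\<in>K. \<exists>V. openin X V \<and> x \<in> V \<and> finite {U \<in> \<U>. U \<inter> V \<noteq> {}}"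
    using lf compactin_subset_topspace[OF K] unfolding locally_finite_in_def by blast
  then obtain V where V: "\<And>x. x \<in> K \<Longrightarrow> openin X (V x) \<and> x \<in> V x \<and> finite {U \<in> \<U>. U \<inter> V x \<noteq> {}}"
    by metis
  have "\<exists>\<F>. finite \<F> \<and> \<F> \<subseteq> V ` K \<and> K \<subseteq> \<Union>\<F>"
    using V by (intro compactinD[OF K]) auto
  then obtain F where F: "finite F" "F \<subseteq> K" "K \<subseteq> (\<Union>x\<in>F. V x)"
    by (metis finite_subset_image)
  have "finite (\<Union>x\<in>F. {U \<in> \<U>. U \<inter> V x \<noteq> {}})"
    using F(1,2) V by (intro finite_UN_I) auto
  then show ?thesis
    by (rule rev_finite_subset) (use F(3) in blast)
qed

text \<open>Finitely many members of an open cover take care of \<open>P\<close>, and their union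
  leaves only finitely many points of \<open>A\<close>.\<close>

lemma compactin_Un_cofinite:
  assumes P: "compactin X P" and A: "A \<subseteq> topspace X"
    and fin: "\<And>V. openin X V \<Longrightarrow> P \<subseteq> V \<Longrightarrow> finite (A - V)"
  shows "compactin X (P \<union> A)"
  unfolding compactin_def
proof (intro conjI allI impI)
  show "P \<union> A \<subseteq> topspace X" using A compactin_subset_topspace[OF P] by blast
  fix \<U> assume U: "Ball \<U> (openin X) \<and> P \<union> A \<subseteq> \<Union>\<U>"
  have "\<exists>\<F>. finite \<F> \<and> \<F> \<subseteq> \<U> \<and> P \<subseteq> \<Union>\<F>"
    using U by (intro compactinD[OF P]) auto
  then obtain \<F> where F: "finite \<F>" "\<F> \<subseteq> \<U>" "P \<subseteq> \<Union>\<F>" by blast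
  have "openin X (\<Union>\<F>)" using F(2) U by (intro openin_Union) auto
  then have "finite (A - \<Union>\<F>)" using fin F(3) by blast
  then have "compactin X (A - \<Union>\<F>)" using A by (intro finite_imp_compactin) auto
  moreover have "A - \<Union>\<F> \<subseteq> \<Union>\<U>" using U by blast
  ultimately have "\<exists>\<G>. finite \<G> \<and> \<G> \<subseteq> \<U> \<and> A - \<Union>\<F> \<subseteq> \<Union>\<G>"
    using U by (intro compactinD) auto
  then obtain \<G> where G: "finite \<G>" "\<G> \<subseteq> \<U>" "A - \<Union>\<F> \<subseteq> \<Union>\<G>" by blast
  show "\<exists>\<F>. finite \<F> \<and> \<F> \<subseteq> \<U> \<and> P \<union> A \<subseteq> \<Union>\<F>"
    using F G by (intro exI[of _ "\<F> \<union> \<G>"]) auto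
qed

lemma compactin_Un_range:
  assumes P: "compactin X P" and q: "range q \<subseteq> topspace X"
    and conv: "\<And>V. openin X V \<Longrightarrow> P \<subseteq> V \<Longrightarrow> \<exists>m::nat. \<forall>i\<ge>m. q i \<in> V"
  shows "compactin X (P \<union> range q)"
proof (rule compactin_Un_cofinite[OF P q])
  fix V assume "openin X V" "P \<subseteq> V"
  then obtain m where m: "\<forall>i\<ge>m. q i \<in> V" using conv by blast
  have "range q - V \<subseteq> q ` {..<m}"
  proof
    fix x assume "x \<in> range q - V"
    then obtain i where "x = q i" "q i \<notin> V" by blast
    moreover then have "i < m" using m leI by blast
    ultimately show "x \<in> q ` {..<m}" by blast
  qed
  then show "finite (range q - V)" using finite_subset by blast
qed

context k_R_zero_dim begin

text \<open>If all compact subsets of \<open>U\<close> were finite, \<open>{x}\<close> and its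
  complement would have closed traces on every compact set, and \<open>x\<close> would be
  isolated.\<close>

lemma infinite_compact_near_non_isolated:
  assumes x: "x \<in> non_isolated_points X" and U: "openin X U" "x \<in> U"
  obtains T where "compactin X T" "T \<subseteq> U" "infinite T"
proof (rule ccontr)
  assume no: "\<not> thesis"
  obtain V where V: "clopenin X V" "x \<in> V" "V \<subseteq> U" using clopen_nhd U by metis
  have xX: "x \<in> topspace X" using x by (simp add: non_isolated_points_def)
  have "clopenin X {x}"
  proof (rule clopenin_k_R)
    fix K assume K: "compactin X K"
    then have KV: "compactin X (K \<inter> V)" using V compact_Int_closedin by (auto simp: clopenin_def)
    then have "finite (K \<inter> V)" using no that[of "K \<inter> V"] V(3) by blast
    then have "closedin X (K \<inter> V - {x})"
      using compactin_subset_topspace[OF KV] by (intro compact_closedin finite_compactin) auto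
    moreover have "closedin X (K - V)"
      using compact_closedin[OF K] V by (simp add: clopenin_def closedin_diff)
    ultimately have "closedin X ((K - V) \<union> (K \<inter> V - {x}))" by (rule closedin_Un[rotated])
    moreover have "(K - V) \<union> (K \<inter> V - {x}) = K - {x}" using V(2) by blast
    moreover have "closedin X (K \<inter> {x})"
      using xX by (intro compact_closedin finite_compactin) auto
    ultimately show "closedin X (K \<inter> {x}) \<and> closedin X (K - {x})" by simp
  qed (use xX in simp)
  then show False using x by (simp add: clopenin_def non_isolated_points_def)
qed

text \<open>Clopen subsets of \<open>S\<close> separate the points of \<open>T\<close>, so a point
  is determined by the set \<open>\<phi> x\<close> of traces containing it. Finitely many traces
  could separate only finitely many points.\<close>

lemma infinite_compact_traces:
  assumes T: "compactin X T" "infinite T" and S: "openin X S" "T \<subseteq> S"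
  obtains A :: "nat \<Rightarrow> 'a set"
  where "\<And>k. clopenin X (A k)" "\<And>k. A k \<subseteq> S" "\<And>k. A k \<inter> T \<noteq> {}" "inj (\<lambda>k. A k \<inter> T)"
proof -
  define \<T> where "\<T> = {A \<inter> T | A. clopenin X A \<and> A \<subseteq> S}"
  define \<phi> where "\<phi> x = {t \<in> \<T>. x \<in> t}" for x
  have "inj_on \<phi> T"
  proof (rule inj_onI, rule ccontr)
    fix x y assume xy: "x \<in> T" "y \<in> T" "\<phi> x = \<phi> y" "x \<noteq> y"
    have "closedin X {y}"
      using xy(2) compactin_subset_topspace[OF T(1)] by (intro compact_closedin finite_compactin) auto
    then have "openin X (S - {y})" using S(1) by (simp add: openin_diff)
    then obtain A where A: "clopenin X A" "x \<in> A" "A \<subseteq> S - {y}"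
      using clopen_nhd[of "S - {y}" x] xy S(2) by blast
    then have "A \<inter> T \<in> \<T>" unfolding \<T>_def by blast
    then have "A \<inter> T \<in> \<phi> x" "A \<inter> T \<notin> \<phi> y" using A xy by (auto simp: \<phi>_def)
    then show False using xy(3) by simp
  qed
  moreover have "\<phi> ` T \<subseteq> Pow \<T>" by (auto simp: \<phi>_def)
  ultimately have "infinite \<T>"
    using T(2) by (meson finite_Pow_iff finite_imageD finite_subset)
  \<comment> \<open>The empty trace is discarded so that a function vanishing on \<open>T\<close>
    realizes none of the chosen traces.\<close>
  then have "infinite (\<T> - {{}})" by simp
  then obtain f :: "nat \<Rightarrow> 'a set" where f: "inj f" "range f \<subseteq> \<T> - {{}}"
    using infinite_countable_subset by metis
  have "\<exists>A. clopenin X A \<and> A \<subseteq> S \<and> f k = A \<inter> T \<and> f k \<noteq> {}" for k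
  proof -
    have "f k \<in> \<T>" "f k \<noteq> {}" using f(2) by auto
    then show ?thesis unfolding \<T>_def by auto
  qed
  then obtain A where A: "\<And>k. clopenin X (A k) \<and> A k \<subseteq> S \<and> f k = A k \<inter> T \<and> f k \<noteq> {}"
    by metis
  then have "(\<lambda>k. A k \<inter> T) = f" by auto
  then have "inj (\<lambda>k. A k \<inter> T)" using f(1) by simp
  with A show thesis by (intro that[of A]) auto
qed

end

locale bar_aleph_k_R = k_R_zero_dim +
  assumes mu: "mu_complete_space X" and bar: "bar_aleph_k_space X"
begin

text \<open>By mu-completeness \<open>B\<close> is unbounded, so infinitely many open sets of a
  locally finite family meet it. Only finitely many of them meet \<open>P\<close>; the rest are
  shrunk to clopen sets, and local finiteness becomes finiteness on compact sets.\<close>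

lemma noncompact_discrete_sequence:
  assumes B: "closedin X B" "\<not> compactin X B" and P: "compactin X P"
  shows "\<exists>(d :: nat \<Rightarrow> 'a) V. (\<forall>k. d k \<in> B \<and> d k \<in> V k \<and> clopenin X (V k) \<and> V k \<inter> P = {}) \<and>
     (\<forall>K. compactin X K \<longrightarrow> finite {k. V k \<inter> K \<noteq> {}})"
proof -
  have "\<not> bounded_subset X B" using mu B unfolding mu_complete_space_def by blast
  then obtain \<U> where lf: "locally_finite_in X \<U>" and U: "\<forall>U\<in>\<U>. openin X U \<and> U \<inter> B \<noteq> {}"
    and inf: "infinite \<U>"
    using closedin_subset[OF B(1)] unfolding bounded_subset_def by blast
  have "infinite (\<U> - {U \<in> \<U>. U \<inter> P \<noteq> {}})"
    using compactin_locally_finite_in[OF lf P] inf by simp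
  then obtain e :: "nat \<Rightarrow> 'a set" where e: "inj e" "range e \<subseteq> \<U> - {U \<in> \<U>. U \<inter> P \<noteq> {}}"
    using infinite_countable_subset by metis
  have eU: "e k \<in> \<U>" "e k \<inter> P = {}" for k using e(2) by auto
  have "\<exists>d V. d \<in> B \<and> d \<in> V \<and> clopenin X V \<and> V \<subseteq> e k" for k
  proof -
    have "openin X (e k)" "e k \<inter> B \<noteq> {}" using eU U by auto
    then obtain d where "d \<in> e k" "d \<in> B" by blast
    then show ?thesis using clopen_nhd[OF \<open>openin X (e k)\<close>] by metis
  qed
  then obtain d V where dV: "\<And>k. d k \<in> B \<and> d k \<in> V k \<and> clopenin X (V k) \<and> V k \<subseteq> e k" by metis
  have "finite {k. V k \<inter> K \<noteq> {}}" if K: "compactin X K" for K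
  proof (rule finite_subset)
    show "{k. V k \<inter> K \<noteq> {}} \<subseteq> e -` {U \<in> \<U>. U \<inter> K \<noteq> {}}" using dV eU(1) by blast
    show "finite (e -` {U \<in> \<U>. U \<inter> K \<noteq> {}})"
      using compactin_locally_finite_in[OF lf K] e(1) by (intro finite_vimageI)
  qed
  moreover have "V k \<inter> P = {}" for k using dV[of k] eU(2)[of k] by blast
  ultimately show ?thesis using dV by (intro exI[of _ d] exI[of _ V]) simp
qed

end

subsection \<open>Two obstructions and the fans they produce\<close>

text \<open>The model case is a metric fan with vertex \<open>P\<close> and a neighbourhood base \<open>M\<close>; by \<open>\<mu>\<close>-completeness every
  \<open>M n\<close> contains an infinite closed discrete set.\<close>

definition shrinks_noncompactly :: "'a topology \<Rightarrow> 'a set \<Rightarrow> (nat \<Rightarrow> 'a set) \<Rightarrow> bool" where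
  "shrinks_noncompactly X P M \<longleftrightarrow> compactin X P \<and> (\<forall>n. closedin X (M n) \<and> \<not> compactin X (M n)) \<and>
     (\<forall>V. openin X V \<and> P \<subseteq> V \<longrightarrow> (\<exists>m. \<forall>n\<ge>m. M n \<subseteq> V))"

text \<open>For fixed \<open>n\<close> a compact set of functions contains only finitely many of the traces
  \<open>A n k \<inter> S n\<close>, although the sets \<open>A n k\<close> leave every compact set.\<close>

definition escaping_traces :: "'a topology \<Rightarrow> (nat \<Rightarrow> 'a set) \<Rightarrow> (nat \<Rightarrow> nat \<Rightarrow> 'a set) \<Rightarrow> bool" where
  "escaping_traces X S A \<longleftrightarrow> (\<forall>n. compactin X (S n) \<and> inj (\<lambda>k. A n k \<inter> S n)) \<and>
     (\<forall>n k. clopenin X (A n k)) \<and>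
     (\<forall>K. compactin X K \<longrightarrow> (\<exists>n m. \<forall>k\<ge>m. A n k \<inter> K = {}))"

context bar_aleph_k_R begin

lemma shrinks_noncompactly_points:
  assumes "shrinks_noncompactly X P M"
  obtains d V where "\<And>n k::nat. d n k \<in> M n" "\<And>n k. d n k \<in> V n k" "\<And>n k. clopenin X (V n k)"
    "\<And>n k. V n k \<inter> P = {}" "\<And>n K. compactin X K \<Longrightarrow> finite {k. V n k \<inter> K \<noteq> {}}"
proof -
  have "\<exists>(d :: nat \<Rightarrow> 'a) V. (\<forall>k. d k \<in> M n \<and> d k \<in> V k \<and> clopenin X (V k) \<and> V k \<inter> P = {}) \<and>
     (\<forall>K. compactin X K \<longrightarrow> finite {k. V k \<inter> K \<noteq> {}})" for n
    using assms noncompact_discrete_sequence[of "M n" P] unfolding shrinks_noncompactly_def by simp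
  then obtain d V where dV: "\<And>n. (\<forall>k::nat. d n k \<in> M n \<and> d n k \<in> V n k \<and> clopenin X (V n k) \<and> V n k \<inter> P = {}) \<and>
     (\<forall>K. compactin X K \<longrightarrow> finite {k. V n k \<inter> K \<noteq> {}})" by metis
  show thesis by (rule that[of d V]) (use dV in auto)
qed

text \<open>The third assumption says that the levels \<open>r i\<close> tend to infinity, so the
  chosen points converge to the compact set \<open>P\<close>.\<close>

lemma shrinks_noncompactly_compactin:
  assumes sh: "shrinks_noncompactly X P M" and q: "\<And>i. q i \<in> M (r i)"
    and r: "\<And>n::nat. finite {i::nat. r i < n}"
  shows "compactin X (P \<union> range q)"
    and "\<And>V. openin X V \<Longrightarrow> P \<subseteq> V \<Longrightarrow> \<exists>m. \<forall>i\<ge>m. q i \<in> V"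
proof -
  have P: "compactin X P" and M: "\<And>n. closedin X (M n)"
    and base: "\<And>V. openin X V \<Longrightarrow> P \<subseteq> V \<Longrightarrow> \<exists>m. \<forall>n\<ge>m. M n \<subseteq> V"
    using sh unfolding shrinks_noncompactly_def by simp_all
  show conv: "\<exists>m. \<forall>i\<ge>m. q i \<in> V" if V: "openin X V" "P \<subseteq> V" for V
  proof -
    obtain n where n: "\<forall>k\<ge>n. M k \<subseteq> V" using base[OF V] by blast
    obtain m where m: "\<forall>i\<in>{i. r i < n}. i < m"
      using r[of n] finite_nat_set_iff_bounded by blast
    have "q i \<in> V" if "i \<ge> m" for i
    proof -
      have "\<not> r i < n" using m that by auto
      then have "r i \<ge> n" by simp
      then show ?thesis using n q[of i] by blast
    qed
    then show ?thesis by blast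
  qed
  have "range q \<subseteq> topspace X" using q M closedin_subset by fastforce
  then show "compactin X (P \<union> range q)" using conv by (intro compactin_Un_range[OF P])
qed

text \<open>The functions \<open>f n k\<close> accumulate at zero because, for suitable
  \<open>n\<close>, both \<open>V n k\<close> and \<open>A n k\<close> leave a given compact set as
  \<open>k\<close> grows. A compact family catches finitely many \<open>k\<close> for each
  \<open>n\<close>, since it has finitely many traces on \<open>S n\<close>, and finitely many
  \<open>n\<close>, since otherwise points \<open>d n k\<close> where the functions are 1 would
  converge to \<open>P\<close>, where they are 0.\<close>

lemma strong_Fin_fan_Ck2:
  assumes sh: "shrinks_noncompactly X P M" and esc: "escaping_traces X S A"
  shows "\<exists>F. strong_Fin_fan (Ck2 X) F"
proof -
  obtain d V where dM: "\<And>n k::nat. d n k \<in> M n" and dV: "\<And>n k. d n k \<in> V n k"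
    and V: "\<And>n k. clopenin X (V n k)" and VP: "\<And>n k. V n k \<inter> P = {}"
    and Vfin: "\<And>n K. compactin X K \<Longrightarrow> finite {k. V n k \<inter> K \<noteq> {}}"
    by (fact shrinks_noncompactly_points[OF sh])
  have P: "compactin X P" using sh by (simp add: shrinks_noncompactly_def)
  have S: "\<And>n. compactin X (S n)" and inj: "\<And>n. inj (\<lambda>k. A n k \<inter> S n)"
    and A: "\<And>n k. clopenin X (A n k)"
    and escA: "\<And>K. compactin X K \<Longrightarrow> \<exists>n m. \<forall>k\<ge>m. A n k \<inter> K = {}"
    using esc unfolding escaping_traces_def by simp_all
  have PX: "P \<subseteq> topspace X" and SX: "\<And>n. S n \<subseteq> topspace X"
    using P S compactin_subset_topspace by blast+
  have dX: "d n k \<in> topspace X" for n k using dV V clopenin_subset by blast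
  define f where "f n k = chi X (V n k \<union> A n k)" for n k
  \<comment> \<open>The three parts record the data used against compact families: the trace on
    \<open>S n\<close> identifies \<open>k\<close>, the values on \<open>P\<close> are zero, and the
    value at \<open>d n k\<close> is one.\<close>
  define T where "T n k = S n \<union> (P \<union> {d n k})" for n k
  \<comment> \<open>Only when \<open>A n k\<close> misses \<open>P\<close> does \<open>f n k\<close>
    vanish on \<open>P\<close>. The remaining indices receive empty sets, which no finiteness count
    sees.\<close>
  define G where "G = {(n, k). A n k \<inter> P = {}}"
  define W where "W p = (if p \<in> G then agree X (f (fst p) (snd p)) (T (fst p) (snd p)) else {})" for p
  define E where "E p = (if p \<in> G then {f (fst p) (snd p)} else {})" for p
  have f: "f n k \<in> topspace (Ck2 X)" for n k
    unfolding f_def using V A by (intro chi_mem clopenin_Un)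
  have T: "compactin X (T n k)" for n k
    unfolding T_def by (intro compactin_Un S P finite_compactin) (use dX in auto)
  have EW: "E p \<subseteq> W p" for p
    using agree_self[OF f] by (simp add: E_def W_def)
  have Wclopen: "clopenin (Ck2 X) (W p)" for p
    using clopenin_agree[OF f T] by (simp add: W_def)
  have finW: "finite {p. L \<inter> W p \<noteq> {}}" (is "finite ?J") if L: "compactin (Ck2 X) L" for L
  proof -
    have one: "finite {k. (n, k) \<in> ?J}" for n
    proof -
      obtain F where F: "finite F" "F \<subseteq> L" "\<And>g. g \<in> L \<Longrightarrow> \<exists>h\<in>F. \<forall>x\<in>S n. g x = h x"
        using compactin_Ck2_traces[OF L S[of n]] by metis
      \<comment> \<open>For the finitely many \<open>k\<close> in \<open>?B\<close> the set
        \<open>V n k\<close> disturbs the trace on \<open>S n\<close>; for all other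
        \<open>k\<close> that trace is \<open>A n k \<inter> S n\<close>.\<close>
      let ?B = "{k. V n k \<inter> S n \<noteq> {}}"
      let ?C = "{k. (n, k) \<in> ?J} - ?B"
      have "A n k \<inter> S n \<in> (\<lambda>h. {x \<in> S n. h x = 1}) ` F" if k: "k \<in> ?C" for k
      proof -
        have "L \<inter> W (n, k) \<noteq> {}" using k by simp
        then obtain g where g: "g \<in> L" "g \<in> W (n, k)" by blast
        then have gf: "g x = f n k x" if "x \<in> S n" for x
          using that by (auto simp: W_def agree_def T_def split: if_splits)
        obtain h where h: "h \<in> F" "\<forall>x\<in>S n. g x = h x" using F(3)[OF g(1)] by (elim bexE)
        have "f n k x = of_bool (x \<in> A n k)" if "x \<in> S n" for x
        proof -
          have "x \<in> topspace X" "x \<notin> V n k" using k that SX by auto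
          then show ?thesis by (simp add: f_def)
        qed
        then have "A n k \<inter> S n = {x \<in> S n. h x = 1}"
          using h(2) gf by (auto simp: of_bool_def split: if_splits)
        then show ?thesis using h(1) by (rule image_eqI)
      qed
      then have "(\<lambda>k. A n k \<inter> S n) ` ?C \<subseteq> (\<lambda>h. {x \<in> S n. h x = 1}) ` F" by (rule image_subsetI)
      then have "finite ((\<lambda>k. A n k \<inter> S n) ` ?C)"
        using F(1) by (meson finite_imageI finite_subset)
      then have "finite ?C"
        using inj[of n] by (meson finite_imageD inj_on_subset subset_UNIV)
      then show ?thesis using Vfin[OF S] by simp
    qed
    have two: "finite (fst ` ?J)"
    proof (rule ccontr)
      assume inf: "infinite (fst ` ?J)"
      define r where "r = enumerate (fst ` ?J)"
      have rJ: "r i \<in> fst ` ?J" for i unfolding r_def using inf by (rule enumerate_in_set)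
      have mono: "strict_mono r" unfolding r_def using inf by (rule strict_mono_enumerate)
      have "\<exists>k g. (r i, k) \<in> G \<and> g \<in> L \<and> g \<in> agree X (f (r i) k) (T (r i) k)" for i
      proof -
        obtain p where p: "r i = fst p" "L \<inter> W p \<noteq> {}" using rJ[of i] by auto
        then show ?thesis by (cases p) (auto simp: W_def split: if_splits)
      qed
      then obtain \<kappa> g where kG: "\<And>i. (r i, \<kappa> i) \<in> G" and gL: "\<And>i. g i \<in> L"
        and ga: "\<And>i. g i \<in> agree X (f (r i) (\<kappa> i)) (T (r i) (\<kappa> i))" by metis
      define q where "q i = d (r i) (\<kappa> i)" for i
      have "finite {i. r i < n}" for n
        by (rule finite_subset[of _ "{..<n}"])
          (use mono strict_mono_imp_increasing[of r] in \<open>auto intro: le_less_trans\<close>)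
      then have K: "compactin X (P \<union> range q)"
        and conv: "\<And>V. openin X V \<Longrightarrow> P \<subseteq> V \<Longrightarrow> \<exists>m. \<forall>i\<ge>m. q i \<in> V"
        using shrinks_noncompactly_compactin[OF sh, of q r] dM by (simp_all add: q_def)
      obtain F where F: "finite F" "F \<subseteq> L" "\<And>g. g \<in> L \<Longrightarrow> \<exists>h\<in>F. \<forall>x\<in>P \<union> range q. g x = h x"
        using compactin_Ck2_traces[OF L K] by metis
      have "\<exists>h. h \<in> F \<and> (\<forall>x\<in>P \<union> range q. g i x = h x)" for i using F(3)[OF gL[of i]] by blast
      then obtain H where H: "\<And>i. H i \<in> F" "\<And>i x. x \<in> P \<union> range q \<Longrightarrow> g i x = H i x" by metis
      \<comment> \<open>Infinitely many of the functions share one trace \<open>h\<close>. It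
        vanishes on \<open>P\<close>, hence at almost all \<open>q i\<close>, although it equals 1
        at \<open>q i\<close> whenever \<open>H i = h\<close>.\<close>
      have "\<exists>h\<in>F. infinite {i\<in>UNIV. H i = h}"
        by (rule pigeonhole_infinite_rel[of UNIV F "\<lambda>i h. H i = h"]) (use F(1) H(1) in auto)
      then obtain h where h: "h \<in> F" "infinite {i. H i = h}" by auto
      have hC: "h \<in> topspace (Ck2 X)"
        using h(1) F(2) compactin_subset_topspace[OF L] by blast
      let ?O = "{x \<in> topspace X. h x = 0}"
      have "h x = 0" if x: "x \<in> P" for x
      proof -
        obtain i where i: "H i = h" using h(2) by (metis (mono_tags) finite.emptyI empty_Collect_eq)
        have "h x = g i x" using H(2)[of x i] i x by simp
        also have "\<dots> = f (r i) (\<kappa> i) x" using ga[of i] x by (auto simp: agree_def T_def)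
        also have "\<dots> = 0"
        proof -
          have "x \<in> topspace X" "x \<notin> V (r i) (\<kappa> i)" "x \<notin> A (r i) (\<kappa> i)"
            using x PX VP[of "r i" "\<kappa> i"] kG[of i] by (auto simp: G_def)
          then show ?thesis by (simp add: f_def)
        qed
        finally show ?thesis .
      qed
      then have "P \<subseteq> ?O" using PX by auto
      moreover have "openin X ?O" using clopenin_Ck2_level[OF hC] by (simp add: clopenin_def)
      ultimately obtain m where m: "\<forall>i\<ge>m. q i \<in> ?O" using conv by blast
      obtain i where i: "i \<ge> m" "H i = h"
        using h(2) by (metis (mono_tags, lifting) infinite_nat_iff_unbounded_le mem_Collect_eq)
      have "h (q i) = g i (q i)" using H(2)[of "q i" i] i(2) by simp
      also have "\<dots> = f (r i) (\<kappa> i) (q i)" using ga[of i] by (auto simp: agree_def T_def q_def)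
      also have "\<dots> = 1" using dV dX by (simp add: f_def q_def)
      finally show False using m i(1) by simp
    qed
    have "?J \<subseteq> Sigma (fst ` ?J) (\<lambda>n. {k. (n, k) \<in> ?J})" by force
    then show ?thesis using one two by (meson finite_SigmaI finite_subset)
  qed
  \<comment> \<open>Fans are indexed by natural numbers, so the double sequence is recoded along a
    bijection, which preserves finiteness.\<close>
  have dec: "finite {j. Q (prod_decode j)} \<longleftrightarrow> finite {p. Q p}" for Q
  proof -
    have "{j. Q (prod_decode j)} = prod_decode -` {p. Q p}" by auto
    then show ?thesis
      by (simp only: finite_vimage_iff[OF bij_prod_decode])
  qed
  have "strong_Fin_fan (Ck2 X) (\<lambda>j. E (prod_decode j))"
    unfolding strong_Fin_fan_def
  proof
    show "\<exists>U. (\<forall>n. R_open (Ck2 X) (U n) \<and> E (prod_decode n) \<subseteq> U n) \<and> compact_finite_seq (Ck2 X) U"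
    proof (intro exI[of _ "\<lambda>j. W (prod_decode j)"] conjI allI)
      show "R_open (Ck2 X) (W (prod_decode n))" for n by (rule clopenin_imp_R_open[OF Wclopen])
      show "E (prod_decode n) \<subseteq> W (prod_decode n)" for n by (rule EW)
      show "compact_finite_seq (Ck2 X) (\<lambda>j. W (prod_decode j))"
        unfolding compact_finite_seq_def
      proof (intro allI impI)
        fix L assume "compactin (Ck2 X) L"
        then show "finite {n. L \<inter> W (prod_decode n) \<noteq> {}}"
          using finW dec[of "\<lambda>p. L \<inter> W p \<noteq> {}"] by simp
      qed
    qed
    show "Fin_fan (Ck2 X) (\<lambda>j. E (prod_decode j))"
      unfolding Fin_fan_def
    proof (intro conjI allI)
      show "finite (E (prod_decode n))" for n by (simp add: E_def)
      show "E (prod_decode n) \<subseteq> topspace (Ck2 X)" for n using f by (simp add: E_def)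
      show "compact_finite_seq (Ck2 X) (\<lambda>j. E (prod_decode j))"
        unfolding compact_finite_seq_def
      proof (intro allI impI)
        fix L assume L: "compactin (Ck2 X) L"
        have "{p. L \<inter> E p \<noteq> {}} \<subseteq> {p. L \<inter> W p \<noteq> {}}" using EW by fastforce
        then have "finite {p. L \<inter> E p \<noteq> {}}" using finW[OF L] finite_subset by blast
        then show "finite {n. L \<inter> E (prod_decode n) \<noteq> {}}"
          using dec[of "\<lambda>p. L \<inter> E p \<noteq> {}"] by simp
      qed
      show "\<not> locally_finite_seq (Ck2 X) (\<lambda>j. E (prod_decode j))"
      proof
        assume lf: "locally_finite_seq (Ck2 X) (\<lambda>j. E (prod_decode j))"
        have "chi X {} \<in> topspace (Ck2 X)" by (intro chi_mem) simp
        then obtain O' where O': "openin (Ck2 X) O'" "chi X {} \<in> O'" "finite {j. O' \<inter> E (prod_decode j) \<noteq> {}}"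
          using lf unfolding locally_finite_seq_def by blast
        then have fin: "finite {p. O' \<inter> E p \<noteq> {}}" using dec[of "\<lambda>p. O' \<inter> E p \<noteq> {}"] by simp
        obtain K where K: "compactin X K" "agree X (chi X {}) K \<subseteq> O'"
          using O' unfolding openin_Ck2_iff by blast
        \<comment> \<open>Escaping from \<open>K \<union> P\<close> instead of \<open>K\<close>
          guarantees that the indices found below belong to \<open>G\<close>.\<close>
        have KP: "compactin X (K \<union> P)" using K(1) P by (rule compactin_Un)
        obtain n m where nm: "\<forall>k\<ge>m. A n k \<inter> (K \<union> P) = {}" using escA[OF KP] by blast
        have "{k. k \<ge> m} - {k. V n k \<inter> (K \<union> P) \<noteq> {}} \<subseteq> {k. (n, k) \<in> {p. O' \<inter> E p \<noteq> {}}}"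
        proof
          fix k assume k: "k \<in> {k. k \<ge> m} - {k. V n k \<inter> (K \<union> P) \<noteq> {}}"
          have "f n k x = chi X {} x" if "x \<in> K" for x
          proof -
            have "x \<in> topspace X" "x \<notin> V n k" "x \<notin> A n k"
              using k nm that compactin_subset_topspace[OF K(1)] by blast+
            then show ?thesis by (simp add: f_def)
          qed
          then have "f n k \<in> O'" using K(2) f by (auto simp: agree_def)
          moreover have "(n, k) \<in> G" using k nm by (auto simp: G_def)
          ultimately show "k \<in> {k. (n, k) \<in> {p. O' \<inter> E p \<noteq> {}}}" by (simp add: E_def)
        qed
        moreover have "infinite ({k. k \<ge> m} - {k. V n k \<inter> (K \<union> P) \<noteq> {}})"
          using Vfin[OF KP] infinite_Ici[of m] by (simp add: atLeast_def)
        moreover have "finite {k. (n, k) \<in> {p. O' \<inter> E p \<noteq> {}}}"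
          using finite_vimageI[OF fin, of "Pair n"] by (simp add: inj_def vimage_def)
        ultimately show False using finite_subset by blast
      qed
    qed
  qed
  then show ?thesis by blast
qed

text \<open>Row 0 of the points labels the first index: \<open>f n k\<close> is 1 at
  \<open>d 0 n\<close>, so a sequence converging to zero must have first indices tending to
  infinity. Then the points \<open>d (Suc n) k\<close> converge to \<open>P\<close>, and on the
  resulting compact set no term of the sequence is zero.\<close>

lemma not_frechet_urysohn_Ck2:
  assumes sh: "shrinks_noncompactly X P M"
  shows "\<not> frechet_urysohn_space (Ck2 X)"
proof
  assume FU: "frechet_urysohn_space (Ck2 X)"
  obtain d V where dM: "\<And>n k::nat. d n k \<in> M n" and dV: "\<And>n k. d n k \<in> V n k"
    and V: "\<And>n k. clopenin X (V n k)" and VP: "\<And>n k. V n k \<inter> P = {}"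
    and Vfin: "\<And>n K. compactin X K \<Longrightarrow> finite {k. V n k \<inter> K \<noteq> {}}"
    by (fact shrinks_noncompactly_points[OF sh])
  have dX: "d n k \<in> topspace X" for n k using dV V clopenin_subset by blast
  define f where "f n k = chi X (V (Suc n) k \<union> V 0 n)" for n k
  have f: "f n k \<in> topspace (Ck2 X)" for n k
    unfolding f_def using V by (intro chi_mem clopenin_Un)
  define B where "B = {f n k | n k. True}"
  have nonempty: "\<exists>k. V n k \<inter> K = {}" if "compactin X K" for n K
  proof (rule ccontr)
    assume "\<not> ?thesis"
    then have "{k. V n k \<inter> K \<noteq> {}} = UNIV" by simp
    then show False using Vfin[OF that, of n] by simp
  qed
  have "chi X {} \<in> Ck2 X closure_of B"
    unfolding in_closure_of_Ck2
  proof (intro conjI allI impI)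
    show "chi X {} \<in> topspace (Ck2 X)" by (intro chi_mem) simp
    fix K assume K: "compactin X K"
    obtain n where n: "V 0 n \<inter> K = {}" using nonempty[OF K] by blast
    obtain k where k: "V (Suc n) k \<inter> K = {}" using nonempty[OF K] by blast
    have "f n k x = chi X {} x" if "x \<in> K" for x
    proof -
      have "x \<in> topspace X" "x \<notin> V (Suc n) k" "x \<notin> V 0 n"
        using n k that compactin_subset_topspace[OF K] by blast+
      then show ?thesis by (simp add: f_def)
    qed
    then have "f n k \<in> agree X (chi X {}) K" using f by (simp add: agree_def)
    moreover have "f n k \<in> B" by (auto simp: B_def)
    ultimately show "\<exists>g\<in>B. g \<in> agree X (chi X {}) K" by blast
  qed
  moreover have "B \<subseteq> topspace (Ck2 X)" using f by (auto simp: B_def)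
  ultimately obtain s where s: "range s \<subseteq> B" and lim: "limitin (Ck2 X) s (chi X {}) sequentially"
    using FU unfolding frechet_urysohn_space_def by blast
  have "\<exists>n k. s i = f n k" for i
  proof -
    have "s i \<in> B" using s by blast
    then show ?thesis by (simp add: B_def)
  qed
  then obtain \<nu> \<kappa> where sf: "\<And>i. s i = f (\<nu> i) (\<kappa> i)" by metis
  have ev: "eventually (\<lambda>i. \<forall>x\<in>K. s i x = chi X {} x) sequentially" if "compactin X K" for K
  proof -
    have "eventually (\<lambda>i. s i \<in> agree X (chi X {}) K) sequentially"
      using lim that unfolding limitin_Ck2_iff by blast
    then show ?thesis by (rule eventually_mono) (simp add: agree_def)
  qed
  have fin: "finite {i. \<nu> i = n}" for n
  proof -
    have "eventually (\<lambda>i. \<forall>x\<in>{d 0 n}. s i x = chi X {} x) sequentially"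
      using dX by (intro ev finite_compactin) auto
    then have "eventually (\<lambda>i. \<nu> i \<noteq> n) sequentially"
    proof (rule eventually_mono)
      fix i assume "\<forall>x\<in>{d 0 n}. s i x = chi X {} x"
      then show "\<nu> i \<noteq> n" using dV[of 0 n] dX[of 0 n] by (auto simp: sf f_def)
    qed
    then show ?thesis by (simp add: eventually_cofinite flip: cofinite_eq_sequentially)
  qed
  define q where "q i = d (Suc (\<nu> i)) (\<kappa> i)" for i
  have "finite {i. Suc (\<nu> i) < n}" for n
  proof (rule finite_subset)
    show "{i. Suc (\<nu> i) < n} \<subseteq> (\<Union>j<n. {i. \<nu> i = j})" by auto
  qed (use fin in auto)
  then have "compactin X (P \<union> range q)"
    using shrinks_noncompactly_compactin[OF sh, of q "\<lambda>i. Suc (\<nu> i)"] dM by (simp add: q_def)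
  from ev[OF this] obtain i where "\<forall>x\<in>P \<union> range q. s i x = chi X {} x"
    by (auto simp: eventually_sequentially)
  then have "s i (q i) = chi X {} (q i)" by blast
  then show False using dV dX by (simp add: sf f_def q_def)
qed

end


subsection \<open>Spaces without the first obstruction\<close>

lemma k_networkE:
  assumes "k_network X \<N>" "openin X U" "compactin X K" "K \<subseteq> U"
  obtains \<F> where "finite \<F>" "\<F> \<subseteq> \<N>" "K \<subseteq> \<Union>\<F>" "\<Union>\<F> \<subseteq> U"
proof -
  have "\<exists>\<F>. finite \<F> \<and> \<F> \<subseteq> \<N> \<and> K \<subseteq> \<Union>\<F> \<and> \<Union>\<F> \<subseteq> U"
    using assms unfolding k_network_def by simp
  then show thesis using that by (elim exE conjE)
qed

lemma k_network_meetingE: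
  assumes "k_network X \<N>" "openin X U" "compactin X K" "K \<subseteq> U"
  obtains \<F> where "finite \<F>" "\<F> \<subseteq> {N \<in> \<N>. N \<inter> K \<noteq> {}}" "K \<subseteq> \<Union>\<F>" "\<Union>\<F> \<subseteq> U"
proof -
  obtain \<F> where F: "finite \<F>" "\<F> \<subseteq> \<N>" "K \<subseteq> \<Union>\<F>" "\<Union>\<F> \<subseteq> U"
    by (rule k_networkE[OF assms])
  show thesis
  proof (rule that[of "{N \<in> \<F>. N \<inter> K \<noteq> {}}"])
    show "K \<subseteq> \<Union>{N \<in> \<F>. N \<inter> K \<noteq> {}}"
    proof
      fix x assume x: "x \<in> K"
      then obtain N where "N \<in> \<F>" "x \<in> N" using F(3) by blast
      then show "x \<in> \<Union>{N \<in> \<F>. N \<inter> K \<noteq> {}}" using x by blast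
    qed
  qed (use F in auto)
qed

text \<open>Nonemptiness lets a piece be indexed by one of its points when the partition is turned
  into a topological sum.\<close>

definition hemicompact_partition :: "'a topology \<Rightarrow> 'a set set \<Rightarrow> bool" where
  "hemicompact_partition X \<S> \<longleftrightarrow> pairwise disjnt \<S> \<and> \<Union>\<S> = topspace X \<and>
     (\<forall>S\<in>\<S>. S \<noteq> {} \<and> clopenin X S \<and> hemicompact_in X S)"

text \<open>The pieces are the classes of the equivalence relation generated by lying in a common member
  of \<open>\<C>\<close>; by compact-countability each class is the union of countably many members.\<close>

lemma (in k_R_zero_dim) hemicompact_partition_exists:
  assumes comp: "\<And>c. c \<in> \<C> \<Longrightarrow> compactin X c"
    and cc: "\<And>K. compactin X K \<Longrightarrow> countable {c \<in> \<C>. c \<inter> K \<noteq> {}}"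
    and cov: "\<And>K. compactin X K \<Longrightarrow> \<exists>\<F>. finite \<F> \<and> \<F> \<subseteq> \<C> \<and> K \<subseteq> \<Union>\<F>"
  shows "\<exists>\<S>. hemicompact_partition X \<S>"
proof -
  define R where "R = {(x, y). \<exists>c\<in>\<C>. x \<in> c \<and> y \<in> c}"
  define T where "T x = R\<^sup>* `` {x}" for x
  have sym: "sym (R\<^sup>*)" by (intro sym_rtrancl) (auto simp: R_def sym_def)
  have T_eq: "T x = T y" if "y \<in> T x" for x y
  proof -
    have xy: "(x, y) \<in> R\<^sup>*" using that by (simp add: T_def)
    then have yx: "(y, x) \<in> R\<^sup>*" using sym by (meson symD)
    show ?thesis unfolding T_def using xy yx by (auto intro: rtrancl_trans)
  qed
  have T_self: "x \<in> T x" for x by (simp add: T_def)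
  have cT: "c \<subseteq> T x" if c: "c \<in> \<C>" "c \<inter> T x \<noteq> {}" for c x
  proof -
    obtain y where y: "y \<in> c" "y \<in> T x" using c(2) by blast
    have "c \<subseteq> T y"
    proof
      fix z assume "z \<in> c"
      then have "(y, z) \<in> R" using y(1) c(1) by (auto simp: R_def)
      then show "z \<in> T y" by (simp add: T_def r_into_rtrancl)
    qed
    then show ?thesis using T_eq[OF y(2)] by simp
  qed
  have TX: "T x \<subseteq> topspace X" if "x \<in> topspace X" for x
  proof
    fix y assume "y \<in> T x"
    then have "(x, y) \<in> R\<^sup>*" by (simp add: T_def)
    then show "y \<in> topspace X"
    proof induction
      case (step y z)
      then obtain c where "c \<in> \<C>" "z \<in> c" by (auto simp: R_def)
      then show ?case using comp compactin_subset_topspace by blast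
    qed (rule that)
  qed
  have cD: "countable {c \<in> \<C>. c \<inter> T x \<noteq> {}}" if x: "x \<in> topspace X" for x
  proof -
    \<comment> \<open>Induction on the length of a chain: every further step passes through a
      compact member, which meets only countably many members.\<close>
    have *: "countable {c \<in> \<C>. c \<inter> (R ^^ n) `` {x} \<noteq> {}}" for n
    proof (induction n)
      case 0
      then show ?case using cc[of "{x}"] x by simp
    next
      case (Suc n)
      let ?D = "{c \<in> \<C>. c \<inter> (R ^^ n) `` {x} \<noteq> {}}"
      have "{c \<in> \<C>. c \<inter> (R ^^ Suc n) `` {x} \<noteq> {}} \<subseteq> (\<Union>c\<in>?D. {c' \<in> \<C>. c' \<inter> c \<noteq> {}})"
      proof
        fix c' assume "c' \<in> {c \<in> \<C>. c \<inter> (R ^^ Suc n) `` {x} \<noteq> {}}"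
        then obtain z where z: "c' \<in> \<C>" "z \<in> c'" "(x, z) \<in> R ^^ Suc n" by auto
        then obtain y where y: "(x, y) \<in> R ^^ n" "(y, z) \<in> R" by auto
        then obtain c where "c \<in> \<C>" "y \<in> c" "z \<in> c" by (auto simp: R_def)
        then show "c' \<in> (\<Union>c\<in>?D. {c' \<in> \<C>. c' \<inter> c \<noteq> {}})" using y z by blast
      qed
      moreover have "countable (\<Union>c\<in>?D. {c' \<in> \<C>. c' \<inter> c \<noteq> {}})"
        using Suc.IH cc comp by (intro countable_UN) auto
      ultimately show ?case by (rule countable_subset)
    qed
    have "{c \<in> \<C>. c \<inter> T x \<noteq> {}} \<subseteq> (\<Union>n. {c \<in> \<C>. c \<inter> (R ^^ n) `` {x} \<noteq> {}})"
      unfolding T_def rtrancl_is_UN_relpow by blast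
    then show ?thesis using * by (meson countable_UN countable_subset countableI_type)
  qed
  have clopen: "clopenin X (T x)" if x: "x \<in> topspace X" for x
  proof (rule clopenin_k_R[OF TX[OF x]])
    fix K assume K: "compactin X K"
    obtain \<F> where F: "finite \<F>" "\<F> \<subseteq> \<C>" "K \<subseteq> \<Union>\<F>"
      using cov[OF K] by (elim exE conjE)
    have cl: "closedin X (K \<inter> \<Union>{c \<in> \<F>. Q c})" for Q
      using F comp compact_closedin K by (intro closedin_Int closedin_Union) auto
    \<comment> \<open>Each member of the finite cover lies in \<open>T x\<close> or misses it, so
      the traces of \<open>T x\<close> and of its complement on \<open>K\<close> are finite unions
      of closed sets.\<close>
    have sub: "c \<subseteq> T x" if "c \<in> \<F>" "c \<inter> T x \<noteq> {}" for c using cT that F(2) by blast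
    have "K \<inter> T x = K \<inter> \<Union>{c \<in> \<F>. c \<inter> T x \<noteq> {}}"
    proof
      show "K \<inter> T x \<subseteq> K \<inter> \<Union>{c \<in> \<F>. c \<inter> T x \<noteq> {}}"
      proof
        fix y assume y: "y \<in> K \<inter> T x"
        then obtain c where "c \<in> \<F>" "y \<in> c" using F(3) by blast
        then show "y \<in> K \<inter> \<Union>{c \<in> \<F>. c \<inter> T x \<noteq> {}}" using y by blast
      qed
    qed (use sub in auto)
    moreover have "K - T x = K \<inter> \<Union>{c \<in> \<F>. c \<inter> T x = {}}"
    proof
      show "K - T x \<subseteq> K \<inter> \<Union>{c \<in> \<F>. c \<inter> T x = {}}"
      proof
        fix y assume y: "y \<in> K - T x"
        then obtain c where c: "c \<in> \<F>" "y \<in> c" using F(3) by blast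
        then have "c \<inter> T x = {}" using sub y by blast
        then show "y \<in> K \<inter> \<Union>{c \<in> \<F>. c \<inter> T x = {}}" using c y by blast
      qed
    qed auto
    ultimately show "closedin X (K \<inter> T x) \<and> closedin X (K - T x)" using cl by simp
  qed
  have hemi: "hemicompact_in X (T x)" if x: "x \<in> topspace X" for x
  proof (rule hemicompact_inI[OF cD[OF x]])
    show "compactin X c \<and> c \<subseteq> T x" if "c \<in> {c \<in> \<C>. c \<inter> T x \<noteq> {}}" for c
      using that comp cT by blast
    fix L assume L: "compactin X L" "L \<subseteq> T x"
    obtain \<F> where F: "finite \<F>" "\<F> \<subseteq> \<C>" "L \<subseteq> \<Union>\<F>"
      using cov[OF L(1)] by (elim exE conjE)
    have "L \<subseteq> \<Union>{c \<in> \<F>. c \<inter> T x \<noteq> {}}"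
    proof
      fix y assume y: "y \<in> L"
      then obtain c where "c \<in> \<F>" "y \<in> c" using F(3) by blast
      then show "y \<in> \<Union>{c \<in> \<F>. c \<inter> T x \<noteq> {}}" using y L(2) by blast
    qed
    then show "\<exists>\<F>. finite \<F> \<and> \<F> \<subseteq> {c \<in> \<C>. c \<inter> T x \<noteq> {}} \<and> L \<subseteq> \<Union>\<F>"
      using F(1,2) by (intro exI[of _ "{c \<in> \<F>. c \<inter> T x \<noteq> {}}"]) auto
  qed
  have "hemicompact_partition X (T ` topspace X)"
    unfolding hemicompact_partition_def
  proof (intro conjI ballI)
    show "pairwise disjnt (T ` topspace X)"
    proof (rule pairwiseI)
      fix A B assume AB: "A \<in> T ` topspace X" "B \<in> T ` topspace X" "A \<noteq> B"
      then obtain x y where xy: "A = T x" "B = T y" by blast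
      show "disjnt A B"
        unfolding disjnt_iff using T_eq AB(3) xy by metis
    qed
    show "\<Union>(T ` topspace X) = topspace X" using TX T_self by blast
  qed (use T_self clopen hemi in blast)+
  then show ?thesis by blast
qed

context bar_aleph_k_R begin

lemma closed_k_network:
  obtains \<N> where "k_network X \<N>" "compact_countable X \<N>" "\<And>N. N \<in> \<N> \<Longrightarrow> closedin X N"
  using bar unfolding bar_aleph_k_space_def by blast

text \<open>The finite subfamilies of the network that cover a compact set \<open>P\<close> and meet \<open>P\<close> memberwise are
  countably many; their unions form a base at \<open>P\<close>, so some finite intersection of such unions is
  compact unless there is an obstruction.\<close>

lemma hemicompact_partition_if_no_shrinking:
  assumes no: "\<And>P M. \<not> shrinks_noncompactly X P M"
  shows "\<exists>\<S>. hemicompact_partition X \<S>"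
proof -
  obtain \<N> where kn: "k_network X \<N>" and cc: "compact_countable X \<N>"
    and cl: "\<And>N. N \<in> \<N> \<Longrightarrow> closedin X N" by (fact closed_k_network)
  \<comment> \<open>An intersection that meets \<open>K\<close> consists of network members that
    meet \<open>K\<close>, so compact-countability survives the passage to finite
    intersections.\<close>
  define \<C> where "\<C> = {c. compactin X c \<and> (\<exists>G. finite G \<and> G \<noteq> {} \<and> G \<subseteq> \<N> \<and> c = \<Inter>G)}"
  show ?thesis
  proof (rule hemicompact_partition_exists)
    show "compactin X c" if "c \<in> \<C>" for c using that by (simp add: \<C>_def)
    show "countable {c \<in> \<C>. c \<inter> K \<noteq> {}}" if K: "compactin X K" for K
    proof (rule countable_subset)
      show "{c \<in> \<C>. c \<inter> K \<noteq> {}} \<subseteq> Inter ` {G. finite G \<and> G \<subseteq> {N \<in> \<N>. N \<inter> K \<noteq> {}}}"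
      proof
        fix c assume "c \<in> {c \<in> \<C>. c \<inter> K \<noteq> {}}"
        then obtain G where G: "finite G" "G \<subseteq> \<N>" "c = \<Inter>G" "\<Inter>G \<inter> K \<noteq> {}"
          by (auto simp: \<C>_def)
        then have "G \<subseteq> {N \<in> \<N>. N \<inter> K \<noteq> {}}" by blast
        then show "c \<in> Inter ` {G. finite G \<and> G \<subseteq> {N \<in> \<N>. N \<inter> K \<noteq> {}}}" using G by blast
      qed
      have "countable {N \<in> \<N>. N \<inter> K \<noteq> {}}" using cc K unfolding compact_countable_def by blast
      then show "countable (Inter ` {G. finite G \<and> G \<subseteq> {N \<in> \<N>. N \<inter> K \<noteq> {}}})"
        by (intro countable_image countable_Collect_finite_subset)
    qed
    fix P assume P: "compactin X P"
    define \<F> where "\<F> = {F. finite F \<and> F \<subseteq> {N \<in> \<N>. N \<inter> P \<noteq> {}} \<and> P \<subseteq> \<Union>F}"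
    have F_ex: "\<exists>F\<in>\<F>. \<Union>F \<subseteq> V" if V: "openin X V" "P \<subseteq> V" for V
    proof -
      obtain F where F: "finite F" "F \<subseteq> {N \<in> \<N>. N \<inter> P \<noteq> {}}" "P \<subseteq> \<Union>F" "\<Union>F \<subseteq> V"
        by (rule k_network_meetingE[OF kn V(1) P V(2)])
      then have "F \<in> \<F>" unfolding \<F>_def by simp
      then show ?thesis using F(4) by blast
    qed
    have "countable {N \<in> \<N>. N \<inter> P \<noteq> {}}" using cc P unfolding compact_countable_def by blast
    then have "countable {F. finite F \<and> F \<subseteq> {N \<in> \<N>. N \<inter> P \<noteq> {}}}"
      by (rule countable_Collect_finite_subset)
    then have cF: "countable \<F>" by (rule countable_subset[rotated]) (auto simp: \<F>_def)
    have neF: "\<F> \<noteq> {}" using F_ex[of "topspace X"] compactin_subset_topspace[OF P] by auto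
    define e where "e = from_nat_into \<F>"
    have range_e: "range e = \<F>" unfolding e_def using neF cF by (rule range_from_nat_into)
    then have e: "finite (e j)" "e j \<subseteq> \<N>" "P \<subseteq> \<Union>(e j)" for j
      unfolding \<F>_def by auto
    define M where "M n = (\<Inter>j\<le>n. \<Union>(e j))" for n
    have clM: "closedin X (M n)" for n
    proof -
      have "closedin X (\<Union>(e j))" for j using e[of j] cl by (intro closedin_Union) auto
      then show ?thesis unfolding M_def by (intro closedin_Inter) auto
    qed
    have base: "\<exists>m. \<forall>n\<ge>m. M n \<subseteq> V" if V: "openin X V" "P \<subseteq> V" for V
    proof -
      obtain j where j: "\<Union>(e j) \<subseteq> V" using F_ex[OF V] range_e by (metis imageE)
      have "M n \<subseteq> V" if "n \<ge> j" for n using j that unfolding M_def by blast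
      then show ?thesis by blast
    qed
    obtain n where n: "compactin X (M n)"
      using no[of P M] P clM base unfolding shrinks_noncompactly_def by blast
    define E where "E = (\<Union>j\<le>n. e j)"
    \<comment> \<open>For each \<open>j \<le> n\<close> some member of \<open>e j\<close> contains
      \<open>x\<close>. Hence the intersection of \<open>G x\<close> lies in the compact set
      \<open>M n\<close>, and since \<open>E\<close> is finite only finitely many such intersections
      arise.\<close>
    define G where "G x = {N \<in> E. x \<in> N}" for x
    have E: "finite E" "E \<subseteq> \<N>" unfolding E_def using e by auto
    have G: "\<Inter>(G x) \<in> \<C>" if x: "x \<in> P" for x
    proof -
      have sub: "\<Inter>(G x) \<subseteq> M n"
      proof
        fix y assume y: "y \<in> \<Inter>(G x)"
        show "y \<in> M n"
          unfolding M_def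
        proof
          fix j assume j: "j \<in> {..n}"
          obtain N where "N \<in> e j" "x \<in> N" using e(3)[of j] x by blast
          moreover then have "N \<in> G x" using j by (auto simp: G_def E_def)
          ultimately show "y \<in> \<Union>(e j)" using y by blast
        qed
      qed
      obtain N where "N \<in> e 0" "x \<in> N" using e(3)[of 0] x by blast
      then have ne: "G x \<noteq> {}" by (auto simp: G_def E_def)
      have "G x \<subseteq> \<N>" "finite (G x)" using E by (auto simp: G_def)
      moreover have "closedin X (\<Inter>(G x))"
        using ne cl \<open>G x \<subseteq> \<N>\<close> by (intro closedin_Inter) auto
      then have "compactin X (\<Inter>(G x))" using n sub closed_compactin by blast
      ultimately show ?thesis using ne unfolding \<C>_def by blast
    qed
    have "(\<lambda>x. \<Inter>(G x)) ` P \<subseteq> Inter ` Pow E" by (auto simp: G_def)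
    then have "finite ((\<lambda>x. \<Inter>(G x)) ` P)" using E(1) by (meson finite_Pow_iff finite_imageI finite_subset)
    moreover have "P \<subseteq> \<Union>((\<lambda>x. \<Inter>(G x)) ` P)" by (auto simp: G_def)
    ultimately show "\<exists>\<F>. finite \<F> \<and> \<F> \<subseteq> \<C> \<and> P \<subseteq> \<Union>\<F>"
      using G by (intro exI[of _ "(\<lambda>x. \<Inter>(G x)) ` P"]) auto
  qed
qed

end

subsection \<open>Spaces without the second obstruction\<close>

text \<open>A countable clopen base at the set of non-isolated points. The complement of each
  \<open>U n\<close> is a closed discrete set of isolated points.\<close>

definition isolated_tails :: "'a topology \<Rightarrow> (nat \<Rightarrow> 'a set) \<Rightarrow> bool" where
  "isolated_tails X U \<longleftrightarrow> (\<forall>n. clopenin X (U n) \<and> non_isolated_points X \<subseteq> U n) \<and> decseq U \<and>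
     (\<forall>V. openin X V \<and> non_isolated_points X \<subseteq> V \<longrightarrow> (\<exists>n. U n \<subseteq> V))"

lemma isolated_tailsI:
  assumes c: "countable \<V>" and cl: "\<And>V. V \<in> \<V> \<Longrightarrow> clopenin X V \<and> non_isolated_points X \<subseteq> V"
    and base: "\<And>W. openin X W \<Longrightarrow> non_isolated_points X \<subseteq> W \<Longrightarrow> \<exists>V\<in>\<V>. V \<subseteq> W"
  shows "\<exists>U. isolated_tails X U"
proof -
  have "non_isolated_points X \<subseteq> topspace X" by (auto simp: non_isolated_points_def)
  then have ne: "\<V> \<noteq> {}" using base[of "topspace X"] by auto
  define e where "e = from_nat_into \<V>"
  have e: "range e = \<V>" unfolding e_def using ne c by (rule range_from_nat_into)
  define U where "U n = (\<Inter>i\<le>n. e i)" for n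
  have "clopenin X (U n)" for n
  proof (induction n)
    case 0
    then show ?case using cl[of "e 0"] e by (auto simp: U_def)
  next
    case (Suc n)
    have "U (Suc n) = U n \<inter> e (Suc n)" by (auto simp: U_def atMost_Suc)
    then show ?case using Suc cl[of "e (Suc n)"] e by (auto intro: clopenin_Int)
  qed
  moreover have "non_isolated_points X \<subseteq> U n" for n
  proof -
    have "e i \<in> \<V>" for i using e by blast
    then show ?thesis using cl unfolding U_def by blast
  qed
  moreover have "decseq U" unfolding U_def decseq_def by fastforce
  moreover have "\<exists>n. U n \<subseteq> W" if W: "openin X W" "non_isolated_points X \<subseteq> W" for W
  proof -
    obtain n where "e n \<subseteq> W" using base[OF W] e by (metis imageE)
    moreover have "U n \<subseteq> e n" by (auto simp: U_def)
    ultimately show ?thesis by blast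
  qed
  ultimately show ?thesis unfolding isolated_tails_def by blast
qed

context bar_aleph_k_R begin

text \<open>Otherwise there are non-isolated points with clopen neighbourhoods \<open>V n\<close>
  that are compact-finite. Infinitely many traces inside each \<open>V n\<close> escape at once,
  because any compact set misses some \<open>V n\<close> entirely.\<close>

lemma compactin_non_isolated_if_no_escape:
  assumes no: "\<And>S A. \<not> escaping_traces X S A"
  shows "compactin X (non_isolated_points X)"
proof (rule ccontr)
  assume nc: "\<not> compactin X (non_isolated_points X)"
  have "closedin X (non_isolated_points X)"
    by (rule closedin_non_isolated_superset) (auto simp: non_isolated_points_def)
  from noncompact_discrete_sequence[OF this nc compactin_empty]
  obtain d V where dV0: "(\<forall>k::nat. d k \<in> non_isolated_points X \<and> d k \<in> V k \<and> clopenin X (V k) \<and> V k \<inter> {} = {}) \<and>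
     (\<forall>K. compactin X K \<longrightarrow> finite {k. V k \<inter> K \<noteq> {}})" by (elim exE)
  then have dV: "d k \<in> non_isolated_points X" "d k \<in> V k" "clopenin X (V k)" for k by auto
  have Vfin: "finite {k. V k \<inter> K \<noteq> {}}" if "compactin X K" for K using dV0 that by simp
  have "\<exists>T A. compactin X T \<and> (\<forall>k::nat. clopenin X (A k) \<and> A k \<subseteq> V n) \<and> inj (\<lambda>k. A k \<inter> T)" for n
  proof -
    have V: "openin X (V n)" using dV(3)[of n] by (simp add: clopenin_def)
    obtain T where T: "compactin X T" "T \<subseteq> V n" "infinite T"
      using infinite_compact_near_non_isolated[OF dV(1) V dV(2)] .
    obtain A :: "nat \<Rightarrow> 'a set" where A: "\<And>k. clopenin X (A k)" "\<And>k. A k \<subseteq> V n" "inj (\<lambda>k. A k \<inter> T)"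
      using infinite_compact_traces[OF T(1,3) V T(2)] by metis
    show ?thesis using T(1) A by (intro exI[of _ T] exI[of _ A]) simp
  qed
  then obtain T A where TA: "\<And>n. compactin X (T n) \<and> (\<forall>k::nat. clopenin X (A n k) \<and> A n k \<subseteq> V n) \<and> inj (\<lambda>k. A n k \<inter> T n)"
    by metis
  have "escaping_traces X T A"
    unfolding escaping_traces_def
  proof (intro conjI allI impI)
    fix K assume "compactin X K"
    then have "{k. V k \<inter> K \<noteq> {}} \<noteq> UNIV" using Vfin by (metis infinite_UNIV_nat)
    then obtain n where "V n \<inter> K = {}" by blast
    then have "\<forall>k\<ge>0. A n k \<inter> K = {}" using TA[of n] by blast
    then show "\<exists>n m. \<forall>k\<ge>m. A n k \<inter> K = {}" by blast
  qed (use TA in auto)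
  then show False using no by blast
qed

text \<open>If no finite union of network members is a neighbourhood of the compact set of non-isolated
  points inside \<open>U\<close>, the \<open>k\<^sub>\<real>\<close>-property yields infinitely many isolated points of a compact set
  outside each such union, as in the Frechet-Urysohn fan.\<close>

lemma isolated_tails_if_no_escape:
  assumes no: "\<And>S A. \<not> escaping_traces X S A"
  shows "\<exists>U. isolated_tails X U"
proof -
  let ?X' = "non_isolated_points X"
  have X': "compactin X ?X'" using compactin_non_isolated_if_no_escape[OF no] .
  have X'X: "?X' \<subseteq> topspace X" by (auto simp: non_isolated_points_def)
  obtain \<N> where kn: "k_network X \<N>" and cc: "compact_countable X \<N>"
    and cl: "\<And>N. N \<in> \<N> \<Longrightarrow> closedin X N" by (fact closed_k_network)
  define \<N>' where "\<N>' = {N \<in> \<N>. N \<inter> ?X' \<noteq> {}}"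
  have cN': "countable \<N>'" using cc X' unfolding compact_countable_def \<N>'_def by blast
  have key: "\<exists>F. finite F \<and> F \<subseteq> \<N>' \<and> clopenin X (\<Union>F) \<and> ?X' \<subseteq> \<Union>F \<and> \<Union>F \<subseteq> U"
    if U: "openin X U" "?X' \<subseteq> U" for U
  proof (rule ccontr)
    assume nex: "\<not> ?thesis"
    have Ucl: "clopenin X U"
      using U closedin_non_isolated_superset[OF openin_subset] by (simp add: clopenin_def)
    define \<A> where "\<A> = insert {} {N \<in> \<N>'. N \<subseteq> U}"
    define e where "e = from_nat_into \<A>"
    have "countable \<A>" unfolding \<A>_def using cN' by simp
    then have range_e: "range e = \<A>" unfolding e_def by (intro range_from_nat_into) (simp add: \<A>_def)
    then have e\<A>: "e i \<in> \<A>" for i by blast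
    define B where "B n = (\<Union>i\<le>n. e i)" for n
    have B_mono: "B m \<subseteq> B n" if "m \<le> n" for m n
      unfolding B_def using that by (intro UN_mono) auto
    have BU: "B n \<subseteq> U" for n using e\<A> unfolding B_def \<A>_def by blast
    have BF: "\<exists>m. \<Union>F \<subseteq> B m" if F: "finite F" "F \<subseteq> \<A>" for F
    proof -
      obtain I where I: "finite I" "F = e ` I"
        using F range_e by (metis finite_subset_image)
      then obtain m where "\<forall>i\<in>I. i \<le> m" using finite_nat_set_iff_bounded_le by blast
      then have "\<Union>F \<subseteq> B m" unfolding B_def I(2) by auto
      then show ?thesis by blast
    qed
    \<comment> \<open>Finitely many network members inside \<open>U\<close> cover
      \<open>K \<inter> U\<close>. Those that meet \<open>X'\<close> are absorbed by some
      \<open>B m\<close>; the others have only isolated points and meet \<open>K\<close> in finite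
      sets.\<close>
    have fin: "\<exists>m. finite (K \<inter> U - B m)" if K: "compactin X K" for K
    proof -
      have "compactin X (K \<inter> U)" using K Ucl compact_Int_closedin by (auto simp: clopenin_def)
      then obtain F where F: "finite F" "F \<subseteq> \<N>" "K \<inter> U \<subseteq> \<Union>F" "\<Union>F \<subseteq> U"
        using k_networkE[OF kn U(1), of "K \<inter> U"] by blast
      have "{N \<in> F. N \<inter> ?X' \<noteq> {}} \<subseteq> \<A>" using F(2,4) by (auto simp: \<A>_def \<N>'_def)
      then obtain m where m: "\<Union>{N \<in> F. N \<inter> ?X' \<noteq> {}} \<subseteq> B m"
        using BF[of "{N \<in> F. N \<inter> ?X' \<noteq> {}}"] F(1) by auto
      have "finite (K \<inter> N)" if N: "N \<in> {N \<in> F. N \<inter> ?X' = {}}" for N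
      proof (rule compactin_isolated_finite)
        show "compactin X (K \<inter> N)" using K cl N F(2) compact_Int_closedin by blast
        show "K \<inter> N \<inter> ?X' = {}" using N by blast
      qed
      then have "finite (\<Union>N\<in>{N \<in> F. N \<inter> ?X' = {}}. K \<inter> N)" using F(1) by (intro finite_UN_I) auto
      moreover have "K \<inter> U - B m \<subseteq> (\<Union>N\<in>{N \<in> F. N \<inter> ?X' = {}}. K \<inter> N)"
      proof
        fix y assume y: "y \<in> K \<inter> U - B m"
        then obtain N where N: "N \<in> F" "y \<in> N" using F(3) by blast
        then have "N \<inter> ?X' = {}" using m y by blast
        then show "y \<in> (\<Union>N\<in>{N \<in> F. N \<inter> ?X' = {}}. K \<inter> N)" using N y by blast
      qed
      ultimately show ?thesis using finite_subset by blast
    qed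
    obtain F where F: "finite F" "F \<subseteq> \<N>'" "?X' \<subseteq> \<Union>F" "\<Union>F \<subseteq> U"
      unfolding \<N>'_def by (rule k_network_meetingE[OF kn U(1) X' U(2)])
    have "F \<subseteq> \<A>" using F(2,4) by (auto simp: \<A>_def)
    from BF[OF F(1) this] obtain m0 where "\<Union>F \<subseteq> B m0" by (rule exE)
    then have m0: "?X' \<subseteq> B m0" using F(3) by blast
    have Ks_ex: "\<exists>K s. compactin X K \<and> inj s \<and> (\<forall>k::nat. s k \<in> K \<and> s k \<in> U \<and> s k \<notin> B (m0 + m))" for m
    proof -
      \<comment> \<open>If every compact set met \<open>?D\<close> in a finite set,
        \<open>?D\<close> would be clopen, and so would \<open>U - ?D = B (m0 + m)\<close>, a finite
        union of network members of the kind excluded by \<open>nex\<close>.\<close>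
      let ?D = "U - B (m0 + m)"
      have X'B: "?X' \<subseteq> B (m0 + m)" using m0 B_mono[of m0 "m0 + m"] by simp
      have Dop: "openin X ?D"
        using X'B openin_subset[OF U(1)] by (intro openin_isolated) auto
      have "\<exists>K. compactin X K \<and> infinite (K \<inter> ?D)"
      proof (rule ccontr)
        assume fin: "\<not> ?thesis"
        have "clopenin X ?D"
        proof (rule clopenin_k_R)
          show "?D \<subseteq> topspace X" using Dop openin_subset by blast
          fix K assume K: "compactin X K"
          have "finite (K \<inter> ?D)" using fin K by blast
          then have "closedin X (K \<inter> ?D)"
            using compactin_subset_topspace[OF K] by (intro compact_closedin finite_compactin) auto
          moreover have "closedin X (K - ?D)" using compact_closedin[OF K] Dop by (simp add: closedin_diff)
          ultimately show "closedin X (K \<inter> ?D) \<and> closedin X (K - ?D)" by simp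
        qed
        then have "clopenin X (U - ?D)" using Ucl clopenin_Diff by blast
        moreover have "U - ?D = B (m0 + m)" using BU by blast
        moreover have "\<Union>(e ` {..m0 + m} - {{}}) = B (m0 + m)" unfolding B_def by auto
        moreover have "finite (e ` {..m0 + m} - {{}})" "e ` {..m0 + m} - {{}} \<subseteq> \<N>'"
          using e\<A> by (auto simp: \<A>_def)
        ultimately show False using nex X'B BU by metis
      qed
      then obtain K where K: "compactin X K" "infinite (K \<inter> ?D)" by blast
      obtain s :: "nat \<Rightarrow> 'a" where s: "inj s" "range s \<subseteq> K \<inter> ?D"
        using infinite_countable_subset[OF K(2)] by blast
      show ?thesis using K(1) s by (intro exI[of _ K] exI[of _ s]) auto
    qed
    obtain K s where Ks: "\<And>m. compactin X (K m) \<and> inj (s m) \<and>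
        (\<forall>k::nat. s m k \<in> K m \<and> s m k \<in> U \<and> s m k \<notin> B (m0 + m))"
      using Ks_ex by metis
    then have sm: "s m k \<in> K m" "s m k \<in> U" "s m k \<notin> B (m0 + m)" for m k by auto
    have "escaping_traces X K (\<lambda>m k. {s m k})"
      unfolding escaping_traces_def
    proof (intro conjI allI impI)
      show "compactin X (K n)" for n using Ks by simp
      show "inj (\<lambda>k. {s n k} \<inter> K n)" for n
        using Ks[of n] by (simp add: inj_def)
      show "clopenin X {s n k}" for n k
      proof -
        have "s n k \<in> topspace X" using sm(2) U(1) openin_subset by blast
        moreover have "s n k \<notin> ?X'" using sm(3)[of n k] m0 B_mono[of m0 "m0 + n"] by auto
        ultimately have "openin X {s n k}" by (intro openin_isolated) auto
        moreover have "closedin X {s n k}"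
          using \<open>s n k \<in> topspace X\<close> by (intro compact_closedin finite_compactin) auto
        ultimately show ?thesis by (simp add: clopenin_def)
      qed
      fix L assume "compactin X L"
      then obtain n where n: "finite (L \<inter> U - B n)" using fin by blast
      have "B n \<subseteq> B (m0 + n)" by (rule B_mono) simp
      then have "{k. s n k \<in> L} \<subseteq> s n -` (L \<inter> U - B n)" using sm[of n] by blast
      then have "finite {k. s n k \<in> L}"
        using n Ks by (meson finite_subset finite_vimageI)
      then obtain m where m: "\<forall>k\<in>{k. s n k \<in> L}. k < m" using finite_nat_set_iff_bounded by blast
      have "\<forall>k\<ge>m. {s n k} \<inter> L = {}" using m by fastforce
      then show "\<exists>n m. \<forall>k\<ge>m. {s n k} \<inter> L = {}" by blast
    qed
    then show False using no by blast
  qed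
  show ?thesis
  proof (rule isolated_tailsI)
    let ?\<V> = "{V \<in> Union ` {F. finite F \<and> F \<subseteq> \<N>'}. clopenin X V \<and> ?X' \<subseteq> V}"
    show "countable ?\<V>"
    proof (rule countable_subset)
      show "?\<V> \<subseteq> Union ` {F. finite F \<and> F \<subseteq> \<N>'}" by (rule Collect_restrict)
    qed (intro countable_image countable_Collect_finite_subset cN')
    show "clopenin X V \<and> ?X' \<subseteq> V" if "V \<in> ?\<V>" for V using that by blast
    fix W assume W: "openin X W" "?X' \<subseteq> W"
    obtain F where F: "finite F" "F \<subseteq> \<N>'" "clopenin X (\<Union>F)" "?X' \<subseteq> \<Union>F" "\<Union>F \<subseteq> W"
      using key[OF W] by (elim exE conjE)
    then have "\<Union>F \<in> ?\<V>" by simp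
    then show "\<exists>V\<in>?\<V>. V \<subseteq> W" using F(5) by (rule bexI[rotated])
  qed
qed

lemma partition_or_tails_if_no_fan:
  assumes "\<not> (\<exists>F. strong_Fin_fan (Ck2 X) F)"
  shows "(\<exists>\<S>. hemicompact_partition X \<S>) \<or>
    (compactin X (non_isolated_points X) \<and> (\<exists>U. isolated_tails X U))"
  using assms strong_Fin_fan_Ck2 hemicompact_partition_if_no_shrinking
    compactin_non_isolated_if_no_escape isolated_tails_if_no_escape by metis

end


subsection \<open>Metrizability\<close>

text \<open>The coordinates embed \<open>X\<close> into a countable product of discrete spaces. The
  third assumption makes the map closed: a point in the closure of the image of \<open>C\<close> is
  approximated by a sequence in \<open>C\<close> with stabilizing coordinates, and a cluster point
  of it is a preimage in \<open>C\<close>.\<close>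

lemma completely_metrizable_if_discrete_coordinates:
  fixes e :: "nat \<Rightarrow> 'a \<Rightarrow> 'b"
  assumes cont: "\<And>i. continuous_map X (discrete_topology UNIV) (e i)"
    and inj: "\<And>x y. \<lbrakk>x \<in> topspace X; y \<in> topspace X; \<And>i. e i x = e i y\<rbrakk> \<Longrightarrow> x = y"
    and cluster: "\<And>s y. \<lbrakk>\<And>n::nat. s n \<in> topspace X; \<And>i. \<exists>N. \<forall>n\<ge>N. e i (s n) = y i\<rbrakk>
      \<Longrightarrow> \<exists>x\<in>topspace X. \<forall>U. openin X U \<and> x \<in> U \<longrightarrow> infinite {n. s n \<in> U}"
  shows "completely_metrizable_space X"
proof -
  let ?P = "product_topology (\<lambda>_. discrete_topology (UNIV :: 'b set)) (UNIV :: nat set)"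
  define E where "E x = (\<lambda>i. e i x)" for x
  have contE: "continuous_map X ?P E"
    unfolding E_def using cont by (simp add: continuous_map_componentwise_UNIV)
  have "closedin ?P (E ` C)" if C: "closedin X C" for C
    unfolding closedin_def
  proof
    show "E ` C \<subseteq> topspace ?P" by simp
    show "openin ?P (topspace ?P - E ` C)"
    proof (subst openin_subopen, intro ballI)
      fix y assume y: "y \<in> topspace ?P - E ` C"
      have "\<exists>n. \<forall>x\<in>C. \<exists>i\<le>n. e i x \<noteq> y i"
      proof (rule ccontr)
        assume "\<not> ?thesis"
        then have "\<forall>n. \<exists>x. x \<in> C \<and> (\<forall>i\<le>n. e i x = y i)" by blast
        then obtain s where s: "\<And>n. s n \<in> C \<and> (\<forall>i\<le>n. e i (s n) = y i)" by metis
        have sX: "s n \<in> topspace X" for n using s[of n] C closedin_subset by blast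
        have sy: "\<exists>N. \<forall>n\<ge>N. e i (s n) = y i" for i using s by blast
        obtain x where x: "x \<in> topspace X" "\<forall>U. openin X U \<and> x \<in> U \<longrightarrow> infinite {n. s n \<in> U}"
          using cluster[of s y, OF sX sy] by blast
        have "x \<in> C"
        proof (rule ccontr)
          assume "x \<notin> C"
          then have "infinite {n. s n \<in> topspace X - C}" using x C by blast
          moreover have "{n. s n \<in> topspace X - C} = {}" using s by blast
          ultimately show False by (simp only: finite.emptyI not_True_eq_False)
        qed
        moreover have "e i x = y i" for i
        proof -
          have "openin X {z \<in> topspace X. e i z \<in> {e i x}}"
            by (rule openin_continuous_map_preimage[OF cont]) simp
          then have "infinite {n. s n \<in> {z \<in> topspace X. e i z \<in> {e i x}}}" using x by blast
          then obtain n where "n \<ge> i" "s n \<in> {z \<in> topspace X. e i z \<in> {e i x}}"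
            unfolding infinite_nat_iff_unbounded_le by blast
          then show ?thesis using s[of n] by auto
        qed
        then have "E x = y" by (simp add: E_def fun_eq_iff)
        ultimately have "y \<in> E ` C" by blast
        then show False using y by blast
      qed
      then obtain n where n: "\<forall>x\<in>C. \<exists>i\<le>n. e i x \<noteq> y i" by blast
      let ?N = "{g \<in> Pi\<^sub>E UNIV (\<lambda>_. UNIV). \<forall>i\<in>{..n}. g i = y i}"
      have "openin ?P ?N" by (rule openin_discrete_product_agree) auto
      moreover have "y \<in> ?N" by simp
      moreover have "?N \<subseteq> topspace ?P - E ` C" using n by (auto simp: E_def)
      ultimately show "\<exists>T. openin ?P T \<and> y \<in> T \<and> T \<subseteq> topspace ?P - E ` C" by (intro exI[of _ ?N] conjI)
    qed
  qed
  then have cl: "closed_map X ?P E" by (simp add: closed_map_def)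
  have "inj_on E (topspace X)"
    by (rule inj_onI, rule inj) (auto simp: E_def fun_eq_iff)
  then have "embedding_map X ?P E" using contE cl injective_closed_imp_embedding_map by blast
  then have hom: "X homeomorphic_space subtopology ?P (E ` topspace X)"
    by (rule embedding_map_imp_homeomorphic_space)
  have "completely_metrizable_space ?P"
    by (simp add: completely_metrizable_space_product_topology completely_metrizable_space_discrete_topology)
  moreover have "closedin ?P (E ` topspace X)" using cl by (simp add: closed_map_def)
  ultimately have "completely_metrizable_space (subtopology ?P (E ` topspace X))"
    by (rule completely_metrizable_space_closedin)
  then show ?thesis using hom homeomorphic_completely_metrizable_space by blast
qed

text \<open>The coordinates are the restrictions to a cofinal sequence of compact sets. Stabilizing
  traces fit together to a function that is continuous by \<open>Ck2_of_traces\<close>, and the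
  sequence converges to it.\<close>

lemma (in k_R_zero_dim) metrizable_Ck2:
  assumes "hemicompact_in X (topspace X)"
  shows "metrizable_space (Ck2 X)"
proof -
  obtain K where K: "mono K" "\<And>n. compactin X (K n)" "\<And>n. K n \<subseteq> topspace X"
    and cof: "\<And>L. compactin X L \<Longrightarrow> L \<subseteq> topspace X \<Longrightarrow> \<exists>n::nat. L \<subseteq> K n"
    by (fact hemicompact_inE[OF assms])
  have cof': "\<exists>n. L \<subseteq> K n" if "compactin X L" for L using cof that compactin_subset_topspace by blast
  define e where "e i f = restrict f (K i)" for i and f :: "'a \<Rightarrow> nat"
  have e_eq: "e i f = e i g \<longleftrightarrow> (\<forall>x\<in>K i. f x = g x)" for i f g
    by (auto simp: e_def restrict_def fun_eq_iff)
  have "completely_metrizable_space (Ck2 X)"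
  proof (rule completely_metrizable_if_discrete_coordinates[where e = e])
    fix i
    show "continuous_map (Ck2 X) (discrete_topology UNIV) (e i)"
      unfolding continuous_map_def
    proof (intro conjI allI impI)
      fix S show "openin (Ck2 X) {f \<in> topspace (Ck2 X). e i f \<in> S}"
        unfolding openin_Ck2_iff
      proof (intro conjI ballI)
        fix f assume f: "f \<in> {f \<in> topspace (Ck2 X). e i f \<in> S}"
        have "agree X f (K i) \<subseteq> {f \<in> topspace (Ck2 X). e i f \<in> S}"
        proof
          fix g assume "g \<in> agree X f (K i)"
          then have "g \<in> topspace (Ck2 X)" "e i g = e i f" by (simp_all add: agree_def e_eq)
          then show "g \<in> {f \<in> topspace (Ck2 X). e i f \<in> S}" using f by simp
        qed
        then show "\<exists>K. compactin X K \<and> agree X f K \<subseteq> {f \<in> topspace (Ck2 X). e i f \<in> S}" using K(2) by blast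
      qed simp
    qed simp
  next
    fix f g assume fg: "f \<in> topspace (Ck2 X)" "g \<in> topspace (Ck2 X)" "\<And>i. e i f = e i g"
    show "f = g"
    proof (rule Ck2_ext[OF fg(1,2)])
      fix x assume "x \<in> topspace X"
      then obtain n where "{x} \<subseteq> K n" using cof'[of "{x}"] by auto
      then show "f x = g x" using fg(3)[of n] by (simp add: e_eq)
    qed
  next
    fix s :: "nat \<Rightarrow> 'a \<Rightarrow> nat" and y
    assume s: "\<And>n. s n \<in> topspace (Ck2 X)" and ev: "\<And>i. \<exists>N. \<forall>n\<ge>N. e i (s n) = y i"
    \<comment> \<open>Any \<open>i\<close> with \<open>x \<in> K i\<close> gives the same value at
      \<open>x\<close>, since two stabilized coordinates are attained by a common late
      \<open>s n\<close>; \<open>LEAST\<close> merely picks one.\<close>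
    define f where "f = restrict (\<lambda>x. y (LEAST i. x \<in> K i) x) (topspace X)"
    have f_eq: "\<exists>N. \<forall>n\<ge>N. \<forall>x\<in>K i. s n x = f x" for i
    proof -
      obtain N where N: "\<forall>n\<ge>N. e i (s n) = y i" using ev by blast
      have "s n x = f x" if n: "n \<ge> N" and x: "x \<in> K i" for n x
      proof -
        let ?j = "LEAST i. x \<in> K i"
        have j: "x \<in> K ?j" using x by (rule LeastI)
        obtain N' where N': "\<forall>n\<ge>N'. e ?j (s n) = y ?j" using ev by blast
        let ?m = "max N N'"
        have "e i (s n) = e i (s ?m)" using N n by simp
        then have "s n x = s ?m x" using x by (simp add: e_eq)
        also have "\<dots> = e ?j (s ?m) x" using j by (simp add: e_def)
        also have "\<dots> = y ?j x" using N' by simp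
        also have "\<dots> = f x" using x K(3)[of i] by (auto simp: f_def)
        finally show ?thesis .
      qed
      then show ?thesis by blast
    qed
    have f: "f \<in> topspace (Ck2 X)"
    proof (rule Ck2_of_traces)
      fix L assume "compactin X L"
      then obtain i where i: "L \<subseteq> K i" using cof' by blast
      obtain N where N: "\<forall>n\<ge>N. \<forall>x\<in>K i. s n x = f x" using f_eq by blast
      have "\<forall>x\<in>L. f x = s N x" using N i by auto
      then show "\<exists>g\<in>topspace (Ck2 X). \<forall>x\<in>L. f x = g x" using s[of N] by (rule bexI)
    qed (simp add: f_def)
    show "\<exists>f\<in>topspace (Ck2 X). \<forall>U. openin (Ck2 X) U \<and> f \<in> U \<longrightarrow> infinite {n. s n \<in> U}"
    proof (intro bexI[OF _ f] allI impI)
      fix U assume U: "openin (Ck2 X) U \<and> f \<in> U"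
      then obtain L where L: "compactin X L" "agree X f L \<subseteq> U"
        unfolding openin_Ck2_iff by blast
      obtain i where i: "L \<subseteq> K i" using cof'[OF L(1)] by blast
      obtain N where N: "\<forall>n\<ge>N. \<forall>x\<in>K i. s n x = f x" using f_eq by blast
      have "s n \<in> U" if "n \<ge> N" for n
      proof -
        have "s n \<in> agree X f L" using N that i s by (auto simp: agree_def)
        then show ?thesis using L(2) by blast
      qed
      then show "infinite {n. s n \<in> U}" unfolding infinite_nat_iff_unbounded_le
        by (metis max.cobounded1 max.cobounded2 mem_Collect_eq)
    qed
  qed
  then show ?thesis by (rule completely_metrizable_imp_metrizable_space)
qed

subsection \<open>Sequentiality\<close>

lemma clopenin_subunion:
  assumes disj: "pairwise disjnt \<S>" and un: "\<Union>\<S> = topspace X"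
    and op: "\<And>S. S \<in> \<S> \<Longrightarrow> openin X S" and sub: "\<G> \<subseteq> \<S>"
  shows "clopenin X (\<Union>\<G>)"
proof -
  have "topspace X - \<Union>\<G> = \<Union>(\<S> - \<G>)"
  proof
    show "topspace X - \<Union>\<G> \<subseteq> \<Union>(\<S> - \<G>)" unfolding un[symmetric] by blast
    show "\<Union>(\<S> - \<G>) \<subseteq> topspace X - \<Union>\<G>"
    proof
      fix x assume "x \<in> \<Union>(\<S> - \<G>)"
      then obtain S where S: "S \<in> \<S>" "S \<notin> \<G>" "x \<in> S" by blast
      have "x \<notin> T" if "T \<in> \<G>" for T
      proof -
        have "S \<noteq> T" "T \<in> \<S>" using that S(2) sub by auto
        then have "disjnt S T" using disj S(1) by (simp add: pairwise_def)
        then show ?thesis using S(3) by (auto simp: disjnt_iff)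
      qed
      then show "x \<in> topspace X - \<Union>\<G>" using S(1,3) un by blast
    qed
  qed
  moreover have "openin X (\<Union>(\<S> - \<G>))" "openin X (\<Union>\<G>)"
    using op sub by (auto intro!: openin_Union)
  ultimately show ?thesis
    using openin_subset unfolding clopenin_def closedin_def by simp
qed

text \<open>A sigma-product argument: the functions that are nonzero on at most countably many
  pieces are closed under limits of sequences, but the constant function 1 is in their closure,
  since a compact set is covered by finitely many pieces.\<close>

lemma not_sequential_Ck2:
  assumes disj: "pairwise disjnt \<S>" and un: "\<Union>\<S> = topspace X"
    and op: "\<And>S. S \<in> \<S> \<Longrightarrow> openin X S" and unc: "uncountable \<S>"
  shows "\<not> sequential_space (Ck2 X)"
proof
  assume seq: "sequential_space (Ck2 X)"
  define supp where "supp g = {S \<in> \<S>. \<exists>x\<in>S. g x = 1}" for g :: "'a \<Rightarrow> nat"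
  define A where "A = {g \<in> topspace (Ck2 X). countable (supp g)}"
  have sub: "clopenin X (\<Union>\<G>)" if "\<G> \<subseteq> \<S>" for \<G>
    using clopenin_subunion[OF disj un op that] .
  let ?one = "chi X (topspace X)"
  have one: "?one \<in> topspace (Ck2 X)" by (intro chi_mem) simp
  have "\<not> closedin (Ck2 X) A"
  proof
    assume cl: "closedin (Ck2 X) A"
    \<comment> \<open>An empty piece may belong to \<open>\<S>\<close>, and it lies in no
      support.\<close>
    have "\<S> - {{}} \<subseteq> supp ?one"
    proof
      fix S assume S: "S \<in> \<S> - {{}}"
      then obtain x where "x \<in> S" "x \<in> topspace X" using un by blast
      then show "S \<in> supp ?one" using S by (auto simp: supp_def intro!: bexI[of _ x])
    qed
    then have "uncountable (supp ?one)"
      using unc by (meson countable_Diff_eq countable_empty countable_insert countable_subset uncountable_minus_countable)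
    then have "?one \<in> topspace (Ck2 X) - A" using one by (simp add: A_def)
    then obtain K where K: "compactin X K" "agree X ?one K \<inter> A = {}"
      using cl unfolding closedin_Ck2_iff by blast
    have KX: "K \<subseteq> topspace X" using K(1) compactin_subset_topspace by blast
    have "\<exists>\<G>. finite \<G> \<and> \<G> \<subseteq> \<S> \<and> K \<subseteq> \<Union>\<G>"
      using op un KX by (intro compactinD[OF K(1)]) auto
    then obtain \<G> where G: "finite \<G>" "\<G> \<subseteq> \<S>" "K \<subseteq> \<Union>\<G>" by blast
    let ?g = "chi X (\<Union>\<G>)"
    have g: "?g \<in> topspace (Ck2 X)" using sub[OF G(2)] by (rule chi_mem)
    have "supp ?g \<subseteq> \<G>"
    proof
      fix S assume "S \<in> supp ?g"
      then obtain x where x: "S \<in> \<S>" "x \<in> S" "?g x = 1" by (auto simp: supp_def)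
      then have "x \<in> topspace X" using un by blast
      then have "x \<in> \<Union>\<G>" using x(3) by (auto split: if_splits simp: of_bool_def)
      then obtain T where "T \<in> \<G>" "x \<in> T" by blast
      then show "S \<in> \<G>" using disj x G(2) by (metis disjnt_iff pairwiseD subsetD)
    qed
    then have "?g \<in> A" using g G(1) by (auto simp: A_def intro: countable_subset countable_finite)
    moreover have "?g \<in> agree X ?one K"
    proof -
      have "?g x = ?one x" if "x \<in> K" for x
      proof -
        have "x \<in> topspace X" "x \<in> \<Union>\<G>" using that KX G(3) by blast+
        then show ?thesis by (simp del: Union_iff)
      qed
      then show ?thesis using g by (simp add: agree_def)
    qed
    ultimately show False using K(2) by blast
  qed
  moreover have "A \<subseteq> topspace (Ck2 X)" by (auto simp: A_def)
  ultimately have "\<exists>s l. range s \<subseteq> A \<and> l \<in> topspace (Ck2 X) - A \<and> limitin (Ck2 X) s l sequentially"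
    using seq unfolding sequential_space_def by simp
  then obtain s l where s: "range s \<subseteq> A" and l: "l \<in> topspace (Ck2 X) - A"
    and lim: "limitin (Ck2 X) s l sequentially" by (elim exE conjE)
  have "supp l \<subseteq> (\<Union>n. supp (s n))"
  proof
    fix S assume "S \<in> supp l"
    then obtain x where x: "S \<in> \<S>" "x \<in> S" "l x = 1" by (auto simp: supp_def)
    then have "compactin X {x}" using un by auto
    then have "eventually (\<lambda>n. s n \<in> agree X l {x}) sequentially"
      using lim unfolding limitin_Ck2_iff by blast
    then obtain n where "s n \<in> agree X l {x}" by (auto simp: eventually_sequentially)
    then have "S \<in> supp (s n)" using x by (auto simp: agree_def supp_def intro!: bexI[of _ x])
    then show "S \<in> (\<Union>n. supp (s n))" by blast
  qed
  moreover have "countable (supp (s n))" for n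
  proof -
    have "s n \<in> A" using s by blast
    then show ?thesis by (simp add: A_def)
  qed
  ultimately have "countable (supp l)" by (meson countable_UN countable_subset countableI_type)
  then show False using l by (simp add: A_def)
qed

text \<open>A countable dense set metrizes the compact subsets of \<open>C\<^sub>k(X,2)\<close>.\<close>

lemma sequential_Ck2_if_k_space:
  assumes k: "k_space (Ck2 X)" and sep: "separable_space X"
  shows "sequential_space (Ck2 X)"
  unfolding sequential_space_def
proof (intro allI impI)
  fix A assume A: "A \<subseteq> topspace (Ck2 X) \<and> \<not> closedin (Ck2 X) A"
  then obtain L where L: "compactin (Ck2 X) L" "\<not> closedin (subtopology (Ck2 X) L) (L \<inter> A)"
    using k unfolding k_space_def by blast
  have LC: "L \<subseteq> topspace (Ck2 X)" using L(1) compactin_subset_topspace by blast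
  have "\<not> closedin (Ck2 X) (L \<inter> A)" using L(2) closedin_subset_topspace by blast
  then obtain l where l: "l \<in> Ck2 X closure_of (L \<inter> A)" "l \<notin> L \<inter> A"
    using LC by (metis closure_of_subset_eq le_infI1 subsetI)
  have clL: "closedin (Ck2 X) L" using L(1) Hausdorff_space_Ck2 compactin_imp_closedin by blast
  then have lL: "l \<in> L" using l(1) closure_of_minimal[of "L \<inter> A" L] by blast
  have lC: "l \<in> topspace (Ck2 X)" using lL LC by blast
  obtain Q where Q: "countable Q" "Q \<subseteq> topspace X" "X closure_of Q = topspace X"
    using sep unfolding separable_space_def by blast
  define q where "q = from_nat_into Q"
  define E where "E n = q ` {..n} \<inter> Q" for n
  have E: "compactin X (E n)" for n
    using Q(2) by (intro finite_imp_compactin) (auto simp: E_def)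
  have Q_E: "\<exists>n. x \<in> E n" if x: "x \<in> Q" for x
  proof -
    have "x \<in> range q" unfolding q_def using Q(1) x by (metis from_nat_into_surj rangeI)
    then show ?thesis using x by (auto simp: E_def)
  qed
  \<comment> \<open>The functions in \<open>L\<close> that differ from \<open>l\<close> on
    \<open>K\<close> form a compact set. By local constancy each of them differs from
    \<open>l\<close> at a point of the dense set \<open>Q\<close>, so by compactness one finite
    \<open>E n\<close> detects all of them.\<close>
  have sub: "\<exists>n. L \<inter> agree X l (E n) \<subseteq> agree X l K" if K: "compactin X K" for K
  proof -
    let ?C = "L \<inter> (topspace (Ck2 X) - agree X l K)"
    have "closedin (Ck2 X) (topspace (Ck2 X) - agree X l K)"
      using clopenin_agree[OF lC K] by (simp add: clopenin_def closedin_diff)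
    then have C: "compactin (Ck2 X) ?C" using L(1) compact_Int_closedin by blast
    let ?\<U> = "(\<lambda>n. topspace (Ck2 X) - agree X l (E n)) ` UNIV"
    have "\<exists>\<F>. finite \<F> \<and> \<F> \<subseteq> ?\<U> \<and> ?C \<subseteq> \<Union>\<F>"
    proof (rule compactinD[OF C])
      show "openin (Ck2 X) U" if U: "U \<in> ?\<U>" for U
        using U clopenin_agree[OF lC E] by (auto simp: clopenin_def)
      show "?C \<subseteq> \<Union>?\<U>"
      proof
        fix h assume h: "h \<in> ?C"
        have "\<exists>x\<in>Q. h x \<noteq> l x"
        proof (rule ccontr)
          assume eq: "\<not> ?thesis"
          have "h x = l x" if x: "x \<in> topspace X" for x
          proof -
            let ?V = "{z \<in> topspace X. h z = h x} \<inter> {z \<in> topspace X. l z = l x}"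
            have "openin X ?V"
              using h clopenin_Ck2_level[of h X] clopenin_Ck2_level[OF lC]
              by (intro openin_Int) (auto simp: clopenin_def)
            moreover have "x \<in> X closure_of Q" "x \<in> ?V" using x Q(3) by auto
            ultimately have "\<exists>z\<in>Q. z \<in> ?V" unfolding in_closure_of by meson
            then show ?thesis using eq by auto
          qed
          then have "h \<in> agree X l K" using h compactin_subset_topspace[OF K] by (auto simp: agree_def)
          then show False using h by blast
        qed
        then obtain x where x: "x \<in> Q" "h x \<noteq> l x" by blast
        obtain n where "x \<in> E n" using Q_E[OF x(1)] by blast
        then have "h \<notin> agree X l (E n)" using x by (auto simp: agree_def)
        then show "h \<in> \<Union>?\<U>" using h by blast
      qed
    qed
    then obtain N where N: "finite N" "?C \<subseteq> (\<Union>n\<in>N. topspace (Ck2 X) - agree X l (E n))"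
      by (metis finite_subset_image)
    obtain m where m: "\<forall>n\<in>N. n \<le> m" using N(1) finite_nat_set_iff_bounded_le by blast
    have "L \<inter> agree X l (E m) \<subseteq> agree X l K"
    proof
      fix h assume h: "h \<in> L \<inter> agree X l (E m)"
      show "h \<in> agree X l K"
      proof (rule ccontr)
        assume "h \<notin> agree X l K"
        then have "h \<in> ?C" using h LC by blast
        then obtain n where n: "n \<in> N" "h \<notin> agree X l (E n)" using N(2) by blast
        have "E n \<subseteq> E m" using m n(1) by (auto simp: E_def)
        then show False using h n(2) by (auto simp: agree_def)
      qed
    qed
    then show ?thesis by blast
  qed
  have "\<exists>g. g \<in> L \<inter> A \<and> g \<in> agree X l (E n)" for n
    using l(1) E[of n] unfolding in_closure_of_Ck2 by blast
  then obtain s where s: "\<And>n. s n \<in> L \<inter> A" "\<And>n. s n \<in> agree X l (E n)" by metis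
  have "limitin (Ck2 X) s l sequentially"
    unfolding limitin_Ck2_iff
  proof (intro conjI allI impI)
    fix K assume "compactin X K"
    then obtain n where n: "L \<inter> agree X l (E n) \<subseteq> agree X l K" using sub by blast
    have "s m \<in> agree X l K" if "m \<ge> n" for m
    proof -
      have "E n \<subseteq> E m" using that by (auto simp: E_def)
      then have "s m \<in> agree X l (E n)" using s(2)[of m] by (auto simp: agree_def)
      then show ?thesis using n s(1) by blast
    qed
    then show "eventually (\<lambda>m. s m \<in> agree X l K) sequentially" by (auto simp: eventually_sequentially)
  qed (rule lC)
  moreover have "l \<in> topspace (Ck2 X) - A" "range s \<subseteq> A" using l(2) lL lC s(1) by auto
  ultimately show "\<exists>s l. range s \<subseteq> A \<and> l \<in> topspace (Ck2 X) - A \<and> limitin (Ck2 X) s l sequentially"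
    by blast
qed

subsection \<open>The \<open>k\<close>-space property\<close>

context k_R_zero_dim begin

text \<open>On the compact set \<open>K\<close> such a function is determined by its values at the finitely many points
  of \<open>K\<close> outside \<open>S\<close>.\<close>

lemma finite_traces_off_isolated:
  assumes S: "openin X S" and iso: "non_isolated_points X \<subseteq> S" and K: "compactin X K"
  shows "\<exists>F. finite F \<and> (\<forall>g\<in>topspace (Ck2 X). (\<forall>x\<in>K \<inter> S. g x = f x) \<longrightarrow> (\<exists>h\<in>F. \<forall>x\<in>K. g x = h x))"
proof -
  have "closedin X (topspace X - S)" using S by blast
  then have "compactin X (K \<inter> (topspace X - S))" using K compact_Int_closedin by blast
  then have "finite (K \<inter> (topspace X - S))"
    by (rule compactin_isolated_finite) (use iso in blast)
  moreover have "K \<inter> (topspace X - S) = K - S" using compactin_subset_topspace[OF K] by blast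
  ultimately have fin: "finite (K - S)" by simp
  define H where "H B x = (if x \<in> K - S then of_bool (x \<in> B) else f x)" for B x
  show ?thesis
  proof (intro exI[of _ "H ` Pow (K - S)"] conjI ballI impI)
    show "finite (H ` Pow (K - S))" using fin by simp
    fix g assume g: "g \<in> topspace (Ck2 X)" "\<forall>x\<in>K \<inter> S. g x = f x"
    let ?B = "{x \<in> K - S. g x = 1}"
    have "g x = H ?B x" if x: "x \<in> K" for x
    proof -
      have "g x = 0 \<or> g x = 1" using Ck2_values[OF g(1)] x compactin_subset_topspace[OF K] by blast
      then show ?thesis using g(2) x by (auto simp: H_def)
    qed
    then show "\<exists>h\<in>H ` Pow (K - S). \<forall>x\<in>K. g x = h x" by blast
  qed
qed

text \<open>These functions are free only at isolated points outside \<open>S\<close>; for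
  continuous \<open>f\<close> they form a Cantor cube.\<close>

lemma compactin_agree_off_isolated:
  assumes S: "openin X S" and iso: "non_isolated_points X \<subseteq> S"
  shows "compactin (Ck2 X) (agree X f S)"
proof (rule compactin_Ck2I)
  show "closedin (Ck2 X) (agree X f S)" using S openin_subset by (intro closedin_agree) blast
  fix K assume K: "compactin X K"
  obtain F where F: "finite F"
    "\<forall>g\<in>topspace (Ck2 X). (\<forall>x\<in>K \<inter> S. g x = f x) \<longrightarrow> (\<exists>h\<in>F. \<forall>x\<in>K. g x = h x)"
    using finite_traces_off_isolated[OF S iso K, of f] by (elim exE conjE)
  have "\<exists>h\<in>F. \<forall>x\<in>K. g x = h x" if "g \<in> agree X f S" for g
    using F(2)[rule_format, of g] that by (simp add: agree_def)
  then show "\<exists>F. finite F \<and> (\<forall>g\<in>agree X f S. \<exists>h\<in>F. \<forall>x\<in>K. g x = h x)"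
    using F(1) by (intro exI[of _ F]) simp
qed

text \<open>The function space is the product of the metrizable factor over \<open>S\<close> and the
  compact cube over the isolated points outside. First \<open>K0\<close> separates \<open>f\<close>
  from \<open>A\<close> within the cube through \<open>f\<close>. If no
  \<open>K n \<union> K0\<close> sufficed, functions in \<open>A\<close> agreeing with
  \<open>f\<close> there would have a cluster point in \<open>A\<close> that lies in this cube and
  agrees with \<open>f\<close> on \<open>K0\<close>.\<close>

lemma k_space_Ck2_hemicompact:
  assumes S: "clopenin X S" and h: "hemicompact_in X S" and iso: "non_isolated_points X \<subseteq> S"
  shows "k_space (Ck2 X)"
proof (rule k_space_Ck2I)
  have Sop: "openin X S" and SX: "S \<subseteq> topspace X" using S clopenin_subset by (auto simp: clopenin_def)
  fix A f assume AC: "A \<subseteq> topspace (Ck2 X)"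
    and A: "\<And>L. compactin (Ck2 X) L \<Longrightarrow> compactin (Ck2 X) (L \<inter> A)"
    and f: "f \<in> topspace (Ck2 X)" "f \<notin> A"
  obtain K where K: "mono K" "\<And>n. compactin X (K n)" "\<And>n. K n \<subseteq> S"
    and cof: "\<And>L. compactin X L \<Longrightarrow> L \<subseteq> S \<Longrightarrow> \<exists>n::nat. L \<subseteq> K n"
    by (fact hemicompact_inE[OF h])
  have "compactin (Ck2 X) (agree X f S \<inter> A)"
    using compactin_agree_off_isolated[OF Sop iso] A by blast
  then have "closedin (Ck2 X) (agree X f S \<inter> A)"
    using Hausdorff_space_Ck2 compactin_imp_closedin by blast
  then obtain K0 where K0: "compactin X K0" "agree X f K0 \<inter> (agree X f S \<inter> A) = {}"
    using f unfolding closedin_Ck2_iff by blast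
  have "\<exists>n. agree X f (K n \<union> K0) \<inter> A = {}"
  proof (rule ccontr)
    assume "\<not> ?thesis"
    then have "\<forall>n. \<exists>g. g \<in> agree X f (K n \<union> K0) \<and> g \<in> A" by blast
    then obtain g where g: "\<And>n. g n \<in> agree X f (K n \<union> K0)" "\<And>n. g n \<in> A" by metis
    let ?L = "Ck2 X closure_of (range g)"
    have gC: "g n \<in> topspace (Ck2 X)" for n using g(2) AC by blast
    have "compactin (Ck2 X) ?L"
    proof (rule compactin_Ck2_closure_of)
      show "range g \<subseteq> topspace (Ck2 X)" using gC by blast
      fix L assume L: "compactin X L"
      have "compactin X (L \<inter> S)" using L S compact_Int_closedin by (auto simp: clopenin_def)
      then obtain m where m: "L \<inter> S \<subseteq> K m" using cof by blast
      obtain F where F: "finite F"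
        "\<forall>g\<in>topspace (Ck2 X). (\<forall>x\<in>L \<inter> S. g x = f x) \<longrightarrow> (\<exists>h\<in>F. \<forall>x\<in>L. g x = h x)"
        using finite_traces_off_isolated[OF Sop iso L, of f] by (elim exE conjE)
      have "\<exists>h\<in>F \<union> g ` {..<m}. \<forall>x\<in>L. g n x = h x" for n
      proof (cases "n < m")
        case False
        then have "K m \<subseteq> K n" using K(1) by (simp add: monoD)
        then have "\<forall>x\<in>L \<inter> S. g n x = f x" using m g(1)[of n] by (auto simp: agree_def)
        then show ?thesis using F(2) gC by blast
      qed (auto intro!: bexI[of _ "g n"])
      then show "\<exists>F. finite F \<and> (\<forall>g\<in>range g. \<exists>f\<in>F. \<forall>x\<in>L. g x = f x)"
        using F(1) by (intro exI[of _ "F \<union> g ` {..<m}"]) auto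
    qed
    then have C: "compactin (Ck2 X) (?L \<inter> A)" by (rule A)
    have "range g \<subseteq> ?L" using gC by (intro closure_of_subset) blast
    then have "g n \<in> ?L \<inter> A" for n using g(2) by blast
    from compactin_cluster_point[OF C, of g, OF this]
    obtain h where h: "h \<in> ?L \<inter> A" "\<forall>U. openin (Ck2 X) U \<and> h \<in> U \<longrightarrow> infinite {n. g n \<in> U}"
      by (elim bexE)
    have hC: "h \<in> topspace (Ck2 X)" using h(1) AC by blast
    have near: "\<exists>n\<ge>m. g n x = h x" if x: "x \<in> topspace X" for x m
    proof -
      have "openin (Ck2 X) (agree X h {x})" using hC x by (intro openin_agree) auto
      then have "infinite {n. g n \<in> agree X h {x}}" using h(2) agree_self[OF hC] by blast
      then obtain n where "n \<ge> m" "g n \<in> agree X h {x}"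
        unfolding infinite_nat_iff_unbounded_le by blast
      then show ?thesis by (auto simp: agree_def)
    qed
    have "h x = f x" if x: "x \<in> K0" for x
    proof -
      obtain n where "g n x = h x" using near[of x 0] x compactin_subset_topspace[OF K0(1)] by blast
      then show ?thesis using g(1)[of n] x by (auto simp: agree_def)
    qed
    moreover have "h x = f x" if x: "x \<in> S" for x
    proof -
      have "compactin X {x}" using x SX by auto
      then obtain m where m: "x \<in> K m" using cof[of "{x}"] x by blast
      obtain n where n: "n \<ge> m" "g n x = h x" using near[of x m] x SX by blast
      have "x \<in> K n" using m K(1) n(1) by (meson monoD subsetD)
      then show ?thesis using g(1)[of n] n(2) by (auto simp: agree_def)
    qed
    ultimately have "h \<in> agree X f K0 \<inter> (agree X f S \<inter> A)" using hC h(1) by (simp add: agree_def)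
    then show False using K0(2) by blast
  qed
  then obtain n where "agree X f (K n \<union> K0) \<inter> A = {}" by blast
  moreover have "compactin X (K n \<union> K0)" using K(2) K0(1) by (rule compactin_Un)
  ultimately show "\<exists>K. compactin X K \<and> agree X f K \<inter> A = {}" by blast
qed

text \<open>The neighbourhood of \<open>f\<close> that misses \<open>A\<close> is given by \<open>X'\<close> together with finite sets, chosen
  successively in \<open>U n - U (n + 1)\<close>, so that it misses \<open>A\<close> on each of the compact sets
  \<open>agree X f (U n)\<close>, whose union is \<open>agree X f X'\<close>.\<close>

lemma k_space_Ck2_isolated_tails:
  assumes X': "compactin X (non_isolated_points X)" and t: "isolated_tails X U"
  shows "k_space (Ck2 X)"
proof (rule k_space_Ck2I)
  let ?X' = "non_isolated_points X"
  \<comment> \<open>The base is shifted by one so that \<open>W 0\<close> is the whole space: the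
    induction then starts from \<open>agree X f (W 0)\<close>, which contains only \<open>f\<close>
    and so misses \<open>A\<close>.\<close>
  define W where "W n = (case n of 0 \<Rightarrow> topspace X | Suc m \<Rightarrow> U m)" for n
  have X'X: "?X' \<subseteq> topspace X" by (auto simp: non_isolated_points_def)
  have W0: "W 0 = topspace X" by (simp add: W_def)
  have Ucl: "clopenin X (U n)" "?X' \<subseteq> U n" for n
    using t by (simp_all add: isolated_tails_def)
  have Wop: "openin X (W n)" "?X' \<subseteq> W n" for n
    using Ucl X'X by (auto simp: W_def clopenin_def split: nat.splits)
  have Wdec: "W (Suc n) \<subseteq> W n" for n
  proof (cases n)
    case (Suc m)
    then show ?thesis using t decseq_SucD[of U m] by (simp add: isolated_tails_def W_def)
  qed (simp add: W_def clopenin_subset[OF Ucl(1)])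
  have Wbase: "\<exists>n. W n \<subseteq> V" if V: "openin X V" "?X' \<subseteq> V" for V
  proof -
    obtain n where "U n \<subseteq> V" using t V unfolding isolated_tails_def by blast
    then have "W (Suc n) \<subseteq> V" by (simp add: W_def)
    then show ?thesis by blast
  qed
  fix A f assume AC: "A \<subseteq> topspace (Ck2 X)"
    and A: "\<And>L. compactin (Ck2 X) L \<Longrightarrow> compactin (Ck2 X) (L \<inter> A)"
    and f: "f \<in> topspace (Ck2 X)" "f \<notin> A"
  define P where "P n E \<longleftrightarrow> finite E \<and> E \<subseteq> topspace X \<and> agree X f (W n) \<inter> A \<inter> agree X f E = {}" for n E
  have "\<exists>E. \<forall>n. P n (E n) \<and> E n \<subseteq> E (Suc n) \<and> E (Suc n) - E n \<subseteq> W n"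
  proof (rule dependent_nat_choice)
    have "g = f" if "g \<in> agree X f (W 0)" for g
      using that f(1) by (intro Ck2_ext) (auto simp: agree_def W0)
    then have "P 0 {}" using f(2) by (auto simp: P_def)
    then show "\<exists>E. P 0 E" by blast
  next
    fix E n assume E: "P n E"
    have "\<exists>F. finite F \<and> F \<subseteq> W n - W (Suc n) \<and> agree X f (W (Suc n)) \<inter> A \<inter> agree X f (E \<union> F) = {}"
    proof (rule ccontr)
      assume no: "\<not> ?thesis"
      \<comment> \<open>If no finite \<open>F\<close> worked, the finite intersection property in
        the compact set \<open>?C\<close> would give one \<open>g\<close> equal to \<open>f\<close>
        on all of \<open>?I\<close>. It would agree with \<open>f\<close> on \<open>W n\<close> and
        on \<open>E\<close>, against \<open>P n E\<close>.\<close>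
      let ?C = "agree X f (W (Suc n)) \<inter> A"
      let ?I = "E \<union> (W n - W (Suc n))"
      have "compactin (Ck2 X) ?C" using compactin_agree_off_isolated[OF Wop] A by blast
      moreover have "\<forall>C\<in>(\<lambda>x. agree X f {x}) ` ?I. closedin (Ck2 X) C"
        using E openin_subset[OF Wop(1)[of n]] by (auto simp: P_def intro!: closedin_agree)
      moreover have "?C \<inter> \<Inter>\<F> \<noteq> {}" if F: "finite \<F>" "\<F> \<subseteq> (\<lambda>x. agree X f {x}) ` ?I" for \<F>
      proof -
        obtain G where G: "finite G" "G \<subseteq> ?I" "\<F> = (\<lambda>x. agree X f {x}) ` G"
          using F by (metis finite_subset_image)
        have "finite (G - E)" "G - E \<subseteq> W n - W (Suc n)" using G(1,2) by auto
        then have "?C \<inter> agree X f (E \<union> (G - E)) \<noteq> {}" using no by blast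
        then obtain g where "g \<in> ?C" "g \<in> agree X f (E \<union> (G - E))" by blast
        moreover then have "g \<in> \<Inter>\<F>" unfolding G(3) by (auto simp: agree_def)
        ultimately show ?thesis by blast
      qed
      ultimately have "?C \<inter> \<Inter>((\<lambda>x. agree X f {x}) ` ?I) \<noteq> {}"
        unfolding compactin_fip by blast
      then obtain g where g: "g \<in> agree X f (W (Suc n))" "g \<in> A" "\<And>x. x \<in> ?I \<Longrightarrow> g x = f x"
        by (auto simp: agree_def)
      then have "g \<in> agree X f (W n) \<inter> A \<inter> agree X f E" by (auto simp: agree_def)
      then show False using E by (auto simp: P_def)
    qed
    then obtain F where F: "finite F" "F \<subseteq> W n - W (Suc n)"
      "agree X f (W (Suc n)) \<inter> A \<inter> agree X f (E \<union> F) = {}" by blast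
    have "P (Suc n) (E \<union> F)"
      using E F openin_subset[OF Wop(1)[of n]] by (auto simp: P_def)
    then show "\<exists>E'. P (Suc n) E' \<and> E \<subseteq> E' \<and> E' - E \<subseteq> W n"
      using F(2) by (intro exI[of _ "E \<union> F"]) auto
  qed
  then obtain E where E: "\<forall>n. P n (E n) \<and> E n \<subseteq> E (Suc n) \<and> E (Suc n) - E n \<subseteq> W n" by (rule exE)
  have PE: "P n (E n)" for n using E by blast
  have decW: "W m \<subseteq> W n" if "n \<le> m" for m n
    using that Wdec by (rule lift_Suc_antimono_le[of W, rotated])
  have incE: "E n \<subseteq> E m" if "n \<le> m" for m n
  proof (rule lift_Suc_mono_le[OF _ that])
    show "E k \<subseteq> E (Suc k)" for k using E by blast
  qed
  have tail: "E m \<subseteq> E n \<union> W n" for m n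
  proof (cases "n \<le> m")
    case True
    then show ?thesis
    proof (induction m rule: dec_induct)
      case (step m)
      have "E (Suc m) \<subseteq> E m \<union> W m" using E by blast
      then show ?case using step.IH decW[OF step.hyps(1)] by blast
    qed simp
  qed (use incE[of m n] in auto)
  let ?K = "?X' \<union> (\<Union>n. E n)"
  have "compactin X ?K"
  proof (rule compactin_Un_cofinite[OF X'])
    show "(\<Union>n. E n) \<subseteq> topspace X" using PE by (auto simp: P_def)
    fix V assume "openin X V" "?X' \<subseteq> V"
    then obtain n where n: "W n \<subseteq> V" using Wbase by blast
    have "(\<Union>m. E m) - V \<subseteq> E n" using tail n by blast
    then show "finite ((\<Union>m. E m) - V)" using PE[of n] finite_subset by (auto simp: P_def)
  qed
  moreover have "agree X f ?K \<inter> A = {}"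
  proof (rule ccontr)
    assume "agree X f ?K \<inter> A \<noteq> {}"
    then obtain g where g: "g \<in> agree X f ?K" "g \<in> A" by blast
    have gC: "g \<in> topspace (Ck2 X)" using g by (simp add: agree_def)
    \<comment> \<open>The coincidence set of \<open>g\<close> and \<open>f\<close> is open and
      contains \<open>X'\<close>, hence some \<open>W n\<close>; so \<open>g\<close> falls under the
      exclusion already achieved at stage \<open>n\<close>.\<close>
    let ?V = "\<Union>i\<in>{0, 1}. {x \<in> topspace X. g x = i} \<inter> {x \<in> topspace X. f x = i}"
    have "openin X ?V"
      using clopenin_Ck2_level[OF gC] clopenin_Ck2_level[OF f(1)]
      by (intro openin_Union) (auto simp: clopenin_def intro!: openin_Int)
    moreover have "?X' \<subseteq> ?V"
    proof
      fix x assume x: "x \<in> ?X'"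
      then have "g x = f x" "x \<in> topspace X" using g(1) X'X by (auto simp: agree_def)
      then show "x \<in> ?V" using Ck2_values[OF f(1)] by auto
    qed
    ultimately obtain n where "W n \<subseteq> ?V" using Wbase by blast
    then have "g \<in> agree X f (W n)" using gC by (auto simp: agree_def)
    moreover have "g \<in> agree X f (E n)" using g(1) by (auto simp: agree_def)
    ultimately show False using PE[of n] g(2) by (auto simp: P_def)
  qed
  ultimately show "\<exists>K. compactin X K \<and> agree X f K \<inter> A = {}" by blast
qed

end


subsection \<open>The \<open>k\<^sub>\<real>\<close>-property of products\<close>

lemma compactly_continuousD:
  fixes \<phi> :: "'a \<Rightarrow> real"
  assumes "\<And>K. compactin Y K \<Longrightarrow> continuous_map (subtopology Y K) euclideanreal \<phi>"
    and L: "compactin Y L" and l: "l \<in> L" and e: "0 < e"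
  obtains V where "openin Y V" "l \<in> V" "\<And>h. h \<in> V \<inter> L \<Longrightarrow> \<bar>\<phi> h - \<phi> l\<bar> < e"
proof -
  let ?W = "{h \<in> topspace (subtopology Y L). \<phi> h \<in> ball (\<phi> l) e}"
  have "openin (subtopology Y L) ?W"
    by (rule openin_continuous_map_preimage[OF assms(1)[OF L]]) simp
  then obtain V where V: "openin Y V" "?W = V \<inter> L" unfolding openin_subtopology by blast
  have "l \<in> ?W" using l e compactin_subset_topspace[OF L] by auto
  then have "l \<in> V" using V(2) by blast
  moreover have "\<bar>\<phi> h - \<phi> l\<bar> < e" if "h \<in> V \<inter> L" for h
  proof -
    have "h \<in> ?W" using that V(2) by simp
    then show ?thesis by (simp add: dist_real_def abs_minus_commute)
  qed
  ultimately show thesis using V(1) that by blast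
qed

lemma disjoint_cover_mem:
  assumes "pairwise disjnt \<S>" "S \<in> \<S>" "\<G> \<subseteq> \<S>" "x \<in> S"
  shows "x \<in> \<Union>\<G> \<longleftrightarrow> S \<in> \<G>"
proof
  assume "x \<in> \<Union>\<G>"
  then obtain T where T: "T \<in> \<G>" "x \<in> T" by blast
  then have "\<not> disjnt S T" using assms(4) by (auto simp: disjnt_iff)
  then have "S = T" using assms T(1) by (meson pairwiseD subsetD)
  then show "S \<in> \<G>" using T(1) by simp
qed (use assms in blast)

context k_R_zero_dim begin

text \<open>Approximating \<open>g\<close> by functions that differ from \<open>f\<close> on finitely many pieces only: all these
  functions form a relatively compact set with \<open>g\<close> in its closure.\<close>

lemma finite_support_approximation:
  fixes \<phi> :: "('a \<Rightarrow> nat) \<Rightarrow> real"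
  assumes part: "hemicompact_partition X \<S>"
    and cont: "\<forall>K. compactin (Ck2 X) K \<longrightarrow> continuous_map (subtopology (Ck2 X) K) euclideanreal \<phi>"
    and f: "f \<in> topspace (Ck2 X)" and g: "g \<in> topspace (Ck2 X)" and e: "0 < e"
  shows "\<exists>\<G> h. finite \<G> \<and> \<G> \<subseteq> \<S> \<and> h = (\<lambda>x. if x \<in> \<Union>\<G> then g x else f x) \<and>
    h \<in> topspace (Ck2 X) \<and> \<bar>\<phi> h - \<phi> g\<bar> < e"
proof -
  have \<phi>: "\<And>K. compactin (Ck2 X) K \<Longrightarrow> continuous_map (subtopology (Ck2 X) K) euclideanreal \<phi>"
    using cont by simp
  have disj: "pairwise disjnt \<S>" and un: "\<Union>\<S> = topspace X" and cl: "\<And>S. S \<in> \<S> \<Longrightarrow> clopenin X S"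
    using part by (simp_all add: hemicompact_partition_def)
  have op: "openin X S" if "S \<in> \<S>" for S using cl[OF that] by (simp add: clopenin_def)
  define H where "H \<G> x = (if x \<in> \<Union>\<G> then g x else f x)" for \<G> x
  have H: "H \<G> \<in> topspace (Ck2 X)" if "\<G> \<subseteq> \<S>" for \<G>
    unfolding H_def using glue_mem[OF g f clopenin_subunion[OF disj un op that]] by simp
  define D where "D = H ` {\<G>. finite \<G> \<and> \<G> \<subseteq> \<S>}"
  have DC: "D \<subseteq> topspace (Ck2 X)" using H by (auto simp: D_def)
  have cover: "\<exists>\<F>. finite \<F> \<and> \<F> \<subseteq> \<S> \<and> K \<subseteq> \<Union>\<F>" if K: "compactin X K" for K
    using op un compactin_subset_topspace[OF K] by (intro compactinD[OF K]) auto
  have L: "compactin (Ck2 X) (Ck2 X closure_of D)"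
  proof (rule compactin_Ck2_closure_of[OF DC])
    fix K assume K: "compactin X K"
    obtain \<F> where F: "finite \<F>" "\<F> \<subseteq> \<S>" "K \<subseteq> \<Union>\<F>"
      using cover[OF K] by (elim exE conjE)
    \<comment> \<open>On \<open>K\<close> only the finitely many pieces in \<open>\<F>\<close>
      matter, so all traces come from subsets of \<open>\<F>\<close>.\<close>
    have "H \<G> x = H (\<G> \<inter> \<F>) x" if G: "\<G> \<subseteq> \<S>" and x: "x \<in> K" for \<G> x
    proof -
      obtain S where S: "S \<in> \<F>" "x \<in> S" using F(3) x by blast
      have "x \<in> \<Union>\<G> \<longleftrightarrow> S \<in> \<G>" "x \<in> \<Union>(\<G> \<inter> \<F>) \<longleftrightarrow> S \<in> \<G> \<inter> \<F>"
        using S F(2) G by (intro disjoint_cover_mem[OF disj]; blast)+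
      then show ?thesis using S(1) by (simp add: H_def)
    qed
    then have "\<forall>h\<in>D. \<exists>f\<in>H ` Pow \<F>. \<forall>x\<in>K. h x = f x" by (auto simp: D_def)
    then show "\<exists>F. finite F \<and> (\<forall>h\<in>D. \<exists>f\<in>F. \<forall>x\<in>K. h x = f x)"
      using F(1) by (intro exI[of _ "H ` Pow \<F>"] conjI) auto
  qed
  have near: "\<exists>\<F>. finite \<F> \<and> \<F> \<subseteq> \<S> \<and> H \<F> \<in> agree X g K" if K: "compactin X K" for K
  proof -
    obtain \<F> where F: "finite \<F>" "\<F> \<subseteq> \<S>" "K \<subseteq> \<Union>\<F>" using cover[OF K] by (elim exE conjE)
    then have "H \<F> \<in> agree X g K" using H[OF F(2)] by (auto simp: agree_def H_def)
    then show ?thesis using F by blast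
  qed
  have "g \<in> Ck2 X closure_of D"
    unfolding in_closure_of_Ck2
  proof (intro conjI allI impI)
    fix K assume "compactin X K"
    then obtain \<F> where "finite \<F>" "\<F> \<subseteq> \<S>" "H \<F> \<in> agree X g K" using near by blast
    then show "\<exists>h\<in>D. h \<in> agree X g K" unfolding D_def by (intro bexI[of _ "H \<F>"]) auto
  qed (rule g)
  from compactly_continuousD[OF \<phi> L this e]
  obtain V where V: "openin (Ck2 X) V" "g \<in> V"
    and Ve: "\<And>h. h \<in> V \<inter> Ck2 X closure_of D \<Longrightarrow> \<bar>\<phi> h - \<phi> g\<bar> < e" by blast
  obtain K where K: "compactin X K" "agree X g K \<subseteq> V" using V unfolding openin_Ck2_iff by blast
  obtain \<F> where F: "finite \<F>" "\<F> \<subseteq> \<S>" "H \<F> \<in> agree X g K" using near[OF K(1)] by blast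
  have "H \<F> \<in> Ck2 X closure_of D"
    using closure_of_subset[OF DC] F(1,2) by (auto simp: D_def)
  then have "\<bar>\<phi> (H \<F>) - \<phi> g\<bar> < e" using Ve F(3) K(2) by blast
  moreover have "H \<F> = (\<lambda>x. if x \<in> \<Union>\<F> then g x else f x)" by (simp add: H_def fun_eq_iff)
  ultimately show ?thesis using F(1,2) H[OF F(2)] by (intro exI[of _ \<F>] exI[of _ "H \<F>"] conjI)
qed

text \<open>If \<open>\<phi>\<close> jumped at \<open>f\<close>, functions with a jump above
  \<open>e / 2\<close> that differ from \<open>f\<close> on finitely many pieces could be chosen
  successively, each agreeing with \<open>f\<close> on larger compact parts of the pieces touched so
  far. They converge to \<open>f\<close>, and with \<open>f\<close> they form a compact set on which
  \<open>\<phi>\<close> is discontinuous.\<close>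

lemma k_R_space_Ck2:
  assumes part: "hemicompact_partition X \<S>"
  shows "k_R_space (Ck2 X)"
  unfolding k_R_space_def
proof (intro allI impI)
  fix \<phi> :: "('a \<Rightarrow> nat) \<Rightarrow> real"
  assume cont: "\<forall>K. compactin (Ck2 X) K \<longrightarrow> continuous_map (subtopology (Ck2 X) K) euclideanreal \<phi>"
  then have \<phi>: "\<And>K. compactin (Ck2 X) K \<Longrightarrow> continuous_map (subtopology (Ck2 X) K) euclideanreal \<phi>"
    by simp
  have disj: "pairwise disjnt \<S>" and un: "\<Union>\<S> = topspace X" and cl: "\<And>S. S \<in> \<S> \<Longrightarrow> clopenin X S"
    and hemi: "\<And>S. S \<in> \<S> \<Longrightarrow> hemicompact_in X S"
    using part by (simp_all add: hemicompact_partition_def)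
  have "\<forall>S\<in>\<S>. \<exists>K :: nat \<Rightarrow> 'a set. mono K \<and> (\<forall>n. compactin X (K n) \<and> K n \<subseteq> S) \<and>
     (\<forall>L. compactin X L \<and> L \<subseteq> S \<longrightarrow> (\<exists>n. L \<subseteq> K n))"
    using hemi unfolding hemicompact_in_def by simp
  then obtain K where K0: "\<forall>S\<in>\<S>. mono (K S :: nat \<Rightarrow> 'a set) \<and> (\<forall>n. compactin X (K S n) \<and> K S n \<subseteq> S) \<and>
     (\<forall>L. compactin X L \<and> L \<subseteq> S \<longrightarrow> (\<exists>n. L \<subseteq> K S n))" by (rule bchoice[THEN exE])
  then have Kmono: "K S m \<subseteq> K S n" if "S \<in> \<S>" "m \<le> n" for S m n using that by (simp add: monoD)
  have Kc: "compactin X (K S n)" if "S \<in> \<S>" for S n using K0 that by simp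
  have Kcof: "\<exists>n. L \<subseteq> K S n" if "S \<in> \<S>" "compactin X L" "L \<subseteq> S" for S L using K0 that by simp
  show "continuous_map (Ck2 X) euclideanreal \<phi>"
  proof (rule continuous_map_realI, rule ccontr)
    fix f and e :: real
    assume f: "f \<in> topspace (Ck2 X)" and e: "0 < e"
      and no: "\<not> (\<exists>U. openin (Ck2 X) U \<and> f \<in> U \<and> (\<forall>g\<in>U. \<bar>\<phi> g - \<phi> f\<bar> < e))"
    \<comment> \<open>A pair consists of a function and a finite set of pieces outside which it
      equals \<open>f\<close>. That set may exceed what is really changed, so it can be accumulated
      along the sequence; \<open>e / 2\<close> is what the approximation leaves of the gap
      \<open>e\<close>.\<close>
    define P where "P p \<longleftrightarrow> finite (snd p) \<and> snd p \<subseteq> \<S> \<and> fst p \<in> topspace (Ck2 X) \<and>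
      (\<forall>x. x \<notin> \<Union>(snd p) \<longrightarrow> fst p x = f x) \<and> e / 2 < \<bar>\<phi> (fst p) - \<phi> f\<bar>" for p :: "('a \<Rightarrow> nat) \<times> 'a set set"
    have ex: "\<exists>p. P p \<and> (\<forall>x\<in>L. fst p x = f x)" if L: "compactin X L" for L
    proof -
      have "\<not> (\<forall>g\<in>agree X f L. \<bar>\<phi> g - \<phi> f\<bar> < e)"
        using no openin_agree[OF f L] agree_self[OF f, of L] by metis
      then obtain g where g: "g \<in> agree X f L" "e \<le> \<bar>\<phi> g - \<phi> f\<bar>" by (auto simp: not_less)
      have gC: "g \<in> topspace (Ck2 X)" using g(1) by (simp add: agree_def)
      have e2: "0 < e / 2" using e by simp
      obtain \<G> h where G: "finite \<G>" "\<G> \<subseteq> \<S>" and h: "h = (\<lambda>x. if x \<in> \<Union>\<G> then g x else f x)"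
        "h \<in> topspace (Ck2 X)" "\<bar>\<phi> h - \<phi> g\<bar> < e / 2"
        using finite_support_approximation[OF part cont f gC e2] by (elim exE conjE)
      have "e / 2 < \<bar>\<phi> h - \<phi> f\<bar>" using h(3) g(2) by linarith
      then have "P (h, \<G>)" using G h(1,2) by (auto simp: P_def)
      moreover have "\<forall>x\<in>L. h x = f x" using g(1) by (simp add: agree_def h(1))
      ultimately show ?thesis by (intro exI[of _ "(h, \<G>)"]) simp
    qed
    have "\<exists>p. \<forall>n. P (p n) \<and> (snd (p n) \<subseteq> snd (p (Suc n)) \<and>
        (\<forall>S\<in>snd (p n). \<forall>x\<in>K S n. fst (p (Suc n)) x = f x))"
    proof (rule dependent_nat_choice)
      show "\<exists>p. P p" using ex[OF compactin_empty] by blast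
      fix p n assume p: "P p"
      have "compactin X (\<Union>S\<in>snd p. K S n)"
        using p Kc by (intro compactin_Union) (auto simp: P_def)
      from ex[OF this] obtain q where q: "P q" "\<forall>x\<in>(\<Union>S\<in>snd p. K S n). fst q x = f x" by blast
      have "P (fst q, snd p \<union> snd q)" using p q(1) by (auto simp: P_def)
      then show "\<exists>q. P q \<and> (snd p \<subseteq> snd q \<and> (\<forall>S\<in>snd p. \<forall>x\<in>K S n. fst q x = f x))"
        using q(2) by (intro exI[of _ "(fst q, snd p \<union> snd q)"]) auto
    qed
    then obtain p where p: "\<forall>n. P (p n) \<and> (snd (p n) \<subseteq> snd (p (Suc n)) \<and>
        (\<forall>S\<in>snd (p n). \<forall>x\<in>K S n. fst (p (Suc n)) x = f x))" by (rule exE)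
    have Pp: "P (p n)" for n using p by simp
    have inc: "snd (p m) \<subseteq> snd (p n)" if "m \<le> n" for m n
    proof (rule lift_Suc_mono_le[OF _ that])
      show "snd (p k) \<subseteq> snd (p (Suc k))" for k using p by simp
    qed
    define g where "g n = fst (p n)" for n
    have gC: "g n \<in> topspace (Ck2 X)" for n using Pp[of n] by (simp add: P_def g_def)
    \<comment> \<open>A piece is either recorded at some stage, after which agreement with
      \<open>f\<close> spreads along its exhaustion, or never recorded, and then all functions equal
      \<open>f\<close> on it.\<close>
    have piece: "eventually (\<lambda>n. \<forall>x\<in>L \<inter> S. g n x = f x) sequentially"
      if L: "compactin X L" and S: "S \<in> \<S>" for L S
    proof (cases "\<exists>m. S \<in> snd (p m)")
      case True
      then obtain m where m: "S \<in> snd (p m)" by blast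
      have "compactin X (L \<inter> S)" using L cl[OF S] compact_Int_closedin by (auto simp: clopenin_def)
      then obtain k where k: "L \<inter> S \<subseteq> K S k" using Kcof[OF S] by blast
      have "\<forall>x\<in>L \<inter> S. g n x = f x" if n: "n \<ge> Suc (max m k)" for n
      proof
        fix x assume x: "x \<in> L \<inter> S"
        obtain j where j: "n = Suc j" "m \<le> j" "k \<le> j" using n by (cases n) auto
        have "S \<in> snd (p j)" using m inc[OF j(2)] by blast
        moreover have "x \<in> K S j" using x k Kmono[OF S j(3)] by blast
        ultimately show "g n x = f x" using p j(1) by (simp add: g_def)
      qed
      then show ?thesis unfolding eventually_sequentially by blast
    next
      case False
      have "g n x = f x" if x: "x \<in> S" for n x
      proof -
        have "x \<notin> \<Union>(snd (p n))"
          using disjoint_cover_mem[OF disj S _ x, of "snd (p n)"] False Pp[of n] by (auto simp: P_def)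
        then show ?thesis using Pp[of n] by (simp add: P_def g_def)
      qed
      then show ?thesis by simp
    qed
    have lim: "limitin (Ck2 X) g f sequentially"
      unfolding limitin_Ck2_iff
    proof (intro conjI allI impI)
      fix L assume L: "compactin X L"
      have "\<exists>\<F>. finite \<F> \<and> \<F> \<subseteq> \<S> \<and> L \<subseteq> \<Union>\<F>"
        using cl un compactin_subset_topspace[OF L] by (intro compactinD[OF L]) (auto simp: clopenin_def)
      then obtain \<F> where F: "finite \<F>" "\<F> \<subseteq> \<S>" "L \<subseteq> \<Union>\<F>" by blast
      have "eventually (\<lambda>n. \<forall>S\<in>\<F>. \<forall>x\<in>L \<inter> S. g n x = f x) sequentially"
        using F(1,2) piece[OF L] by (intro eventually_ball_finite) auto
      then show "eventually (\<lambda>n. g n \<in> agree X f L) sequentially"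
      proof (rule eventually_mono)
        fix n assume n: "\<forall>S\<in>\<F>. \<forall>x\<in>L \<inter> S. g n x = f x"
        have "g n x = f x" if x: "x \<in> L" for x
        proof -
          obtain S where "S \<in> \<F>" "x \<in> S" using F(3) x by blast
          then show ?thesis using n x by simp
        qed
        then show "g n \<in> agree X f L" using gC by (simp add: agree_def)
      qed
    qed (rule f)
    have "range g \<subseteq> topspace (Ck2 X)" using gC by blast
    with lim have C: "compactin (Ck2 X) (insert f (range g))"
      by (intro compactin_sequence_with_limit) auto
    have "0 < e / 2" using e by simp
    from compactly_continuousD[OF \<phi> C insertI1 this]
    obtain V where V: "openin (Ck2 X) V" "f \<in> V"
      and Ve: "\<And>h. h \<in> V \<inter> insert f (range g) \<Longrightarrow> \<bar>\<phi> h - \<phi> f\<bar> < e / 2" by blast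
    have "eventually (\<lambda>n. g n \<in> V) sequentially" using lim V unfolding limitin_def by blast
    then obtain n where "g n \<in> V" by (auto simp: eventually_sequentially)
    then have "\<bar>\<phi> (g n) - \<phi> f\<bar> < e / 2" using Ve by blast
    then show False using Pp[of n] by (simp add: P_def g_def)
  qed
qed

end

subsection \<open>Products with uncountably many noncompact factors\<close>

lemma clopenin_UN_pieces:
  assumes disj: "pairwise disjnt \<S>" and un: "\<Union>\<S> = topspace X"
    and op: "\<And>S. S \<in> \<S> \<Longrightarrow> openin X S" and sub: "\<G> \<subseteq> \<S>"
    and C: "\<And>S. S \<in> \<G> \<Longrightarrow> clopenin X (C S) \<and> C S \<subseteq> S"
  shows "clopenin X (\<Union>S\<in>\<G>. C S)"
proof -
  define D where "D S = S - (if S \<in> \<G> then C S else {})" for S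
  have "topspace X - (\<Union>S\<in>\<G>. C S) = (\<Union>S\<in>\<S>. D S)"
  proof
    show "topspace X - (\<Union>S\<in>\<G>. C S) \<subseteq> (\<Union>S\<in>\<S>. D S)"
      unfolding un[symmetric] by (auto simp: D_def)
    show "(\<Union>S\<in>\<S>. D S) \<subseteq> topspace X - (\<Union>S\<in>\<G>. C S)"
    proof
      fix x assume "x \<in> (\<Union>S\<in>\<S>. D S)"
      then obtain S where S: "S \<in> \<S>" "x \<in> D S" by blast
      have "x \<notin> C T" if T: "T \<in> \<G>" for T
      proof
        assume "x \<in> C T"
        then have "x \<in> T" using C[OF T] by blast
        then have "\<not> disjnt S T" using S(2) by (auto simp: disjnt_iff D_def)
        then have "S = T" using disj S(1) T sub by (meson pairwiseD subsetD)
        then show False using S(2) T \<open>x \<in> C T\<close> by (simp add: D_def)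
      qed
      then show "x \<in> topspace X - (\<Union>S\<in>\<G>. C S)" using S un by (auto simp: D_def)
    qed
  qed
  moreover have "openin X (\<Union>S\<in>\<S>. D S)"
  proof (rule openin_Union, clarify)
    fix S assume "S \<in> \<S>"
    then show "openin X (D S)" using op C by (auto simp: D_def clopenin_def openin_diff)
  qed
  moreover have "openin X (\<Union>S\<in>\<G>. C S)"
    using C by (intro openin_Union) (auto simp: clopenin_def)
  ultimately show ?thesis
    using openin_subset unfolding clopenin_def closedin_def by simp
qed

text \<open>Kelley's example: in an uncountable power of \<open>\<nat>\<close> the points that have, for some \<open>n > 0\<close>, at most
  \<open>n\<close> coordinates \<open>0\<close> and all the others equal to \<open>n\<close> form a set with compactly closed traces that is
  not closed. Here the coordinate \<open>\<rho> S\<close> reads off a trace on an infinite compact subset of \<open>S\<close>.\<close>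

lemma (in k_R_zero_dim) not_k_space_Ck2:
  assumes disj: "pairwise disjnt \<S>" and un: "\<Union>\<S> = topspace X"
    and op: "\<And>S. S \<in> \<S> \<Longrightarrow> openin X S"
    and unc: "uncountable {S \<in> \<S>. S \<inter> non_isolated_points X \<noteq> {}}"
  shows "\<not> k_space (Ck2 X)"
proof
  assume ks: "k_space (Ck2 X)"
  define \<T> where "\<T> = {S \<in> \<S>. S \<inter> non_isolated_points X \<noteq> {}}"
  have \<T>\<S>: "\<T> \<subseteq> \<S>" by (auto simp: \<T>_def)
  have inf\<T>: "infinite \<T>" using unc countable_finite by (auto simp: \<T>_def)
  have "\<exists>T A. compactin X T \<and> T \<subseteq> S \<and> (\<forall>k::nat. clopenin X (A k) \<and> A k \<subseteq> S \<and> A k \<inter> T \<noteq> {}) \<and>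
      inj (\<lambda>k. A k \<inter> T)" if S: "S \<in> \<T>" for S
  proof -
    obtain x where x: "x \<in> non_isolated_points X" "x \<in> S" using S by (auto simp: \<T>_def)
    have Sop: "openin X S" using S \<T>\<S> op by blast
    obtain T where T: "compactin X T" "T \<subseteq> S" "infinite T"
      by (rule infinite_compact_near_non_isolated[OF x(1) Sop x(2)])
    obtain A :: "nat \<Rightarrow> 'a set" where A: "\<And>k. clopenin X (A k)" "\<And>k. A k \<subseteq> S" "\<And>k. A k \<inter> T \<noteq> {}"
      "inj (\<lambda>k. A k \<inter> T)" by (fact infinite_compact_traces[OF T(1,3) Sop T(2)])
    show ?thesis using T(1,2) A by (intro exI[of _ T] exI[of _ A]) simp
  qed
  then obtain T A where TA: "\<And>S. S \<in> \<T> \<Longrightarrow> compactin X (T S) \<and> T S \<subseteq> S \<and>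
      (\<forall>k::nat. clopenin X (A S k) \<and> A S k \<subseteq> S \<and> A S k \<inter> T S \<noteq> {}) \<and> inj (\<lambda>k. A S k \<inter> T S)"
    by metis
  define tr where "tr S g = {x \<in> T S. g x = 1}" for S and g :: "'a \<Rightarrow> nat"
  \<comment> \<open>The value 0 is reserved for traces outside the chosen list, in particular the
    zero trace; list entry \<open>k\<close> gets \<open>Suc k\<close>.\<close>
  define \<rho> where "\<rho> S g = (if \<exists>k. tr S g = A S k \<inter> T S then Suc (LEAST k. tr S g = A S k \<inter> T S) else 0)"
    for S g
  have \<rho>_cong: "\<rho> S g = \<rho> S h" if "\<forall>x\<in>T S. g x = h x" for S g h
  proof -
    have "tr S g = tr S h" using that by (auto simp: tr_def)
    then show ?thesis by (simp add: \<rho>_def)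
  qed
  have \<rho>_zero: "\<rho> S g = 0" if S: "S \<in> \<T>" and g: "\<forall>x\<in>T S. g x = 0" for S g
  proof -
    have "tr S g = {}" using g by (auto simp: tr_def)
    then show ?thesis using TA[OF S] by (auto simp: \<rho>_def)
  qed
  have \<rho>_Suc: "\<rho> S g = Suc k" if S: "S \<in> \<T>" and g: "\<forall>x\<in>T S. g x = of_bool (x \<in> A S k)" for S g k
  proof -
    have t: "tr S g = A S k \<inter> T S" using g by (auto simp: tr_def of_bool_def split: if_splits)
    have inj: "inj (\<lambda>k. A S k \<inter> T S)" using TA[OF S] by simp
    have "(LEAST j. tr S g = A S j \<inter> T S) = k"
    proof (rule Least_equality)
      show "tr S g = A S k \<inter> T S" by (rule t)
      fix j assume "tr S g = A S j \<inter> T S"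
      then have "j = k" using t inj by (auto simp: inj_def)
      then show "k \<le> j" by simp
    qed
    then show ?thesis using t by (auto simp: \<rho>_def)
  qed
  \<comment> \<open>Vanishing coordinates are counted through finite subfamilies, since
    \<open>card\<close> of an infinite set would be 0 and impose no bound.\<close>
  define B where "B n = {g \<in> topspace (Ck2 X). (\<forall>S\<in>\<T>. \<rho> S g = 0 \<or> \<rho> S g = n) \<and>
      (\<forall>\<G>. finite \<G> \<and> \<G> \<subseteq> \<T> \<and> (\<forall>S\<in>\<G>. \<rho> S g = 0) \<longrightarrow> card \<G> \<le> n)}" for n
  have BC: "B n \<subseteq> topspace (Ck2 X)" for n by (auto simp: B_def)
  have clB: "closedin (Ck2 X) (B n)" for n
    unfolding closedin_Ck2_iff
  proof (intro conjI ballI BC)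
    fix g assume g: "g \<in> topspace (Ck2 X) - B n"
    then consider S where "S \<in> \<T>" "\<rho> S g \<noteq> 0" "\<rho> S g \<noteq> n"
      | \<G> where "finite \<G>" "\<G> \<subseteq> \<T>" "\<forall>S\<in>\<G>. \<rho> S g = 0" "\<not> card \<G> \<le> n"
      unfolding B_def by blast
    then show "\<exists>K. compactin X K \<and> agree X g K \<inter> B n = {}"
    proof cases
      case 1
      have "h \<notin> B n" if h: "h \<in> agree X g (T S)" for h
      proof -
        have "\<rho> S h = \<rho> S g" using h by (intro \<rho>_cong) (simp add: agree_def)
        then have "\<not> (\<rho> S h = 0 \<or> \<rho> S h = n)" using 1(2,3) by simp
        then show ?thesis using 1(1) unfolding B_def by blast
      qed
      then show ?thesis using TA[OF 1(1)] by (intro exI[of _ "T S"]) blast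
    next
      case 2
      have "h \<notin> B n" if h: "h \<in> agree X g (\<Union>S\<in>\<G>. T S)" for h
      proof -
        have "\<rho> S h = \<rho> S g" if "S \<in> \<G>" for S using h that by (intro \<rho>_cong) (auto simp: agree_def)
        then have "\<forall>S\<in>\<G>. \<rho> S h = 0" using 2(3) by simp
        then show ?thesis using 2 by (auto simp: B_def)
      qed
      moreover have "compactin X (\<Union>S\<in>\<G>. T S)"
        using 2(1,2) TA by (intro compactin_Union) auto
      ultimately show ?thesis by (intro exI[of _ "\<Union>S\<in>\<G>. T S"]) blast
    qed
  qed
  define U where "U = (\<Union>n\<in>{0<..}. B n)"
  have "closedin (Ck2 X) (L \<inter> U)" if L: "compactin (Ck2 X) L" for L
  proof -
    have clL: "closedin (Ck2 X) L" using L Hausdorff_space_Ck2 compactin_imp_closedin by blast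
    have bd: "\<exists>b. \<forall>g\<in>L. \<rho> S g \<le> b" if S: "S \<in> \<T>" for S
    proof -
      have "compactin X (T S)" using TA[OF S] by simp
      from compactin_Ck2_traces[OF L this]
      obtain F where F: "finite F" "F \<subseteq> L" "\<And>g. g \<in> L \<Longrightarrow> \<exists>f\<in>F. \<forall>x\<in>T S. g x = f x" by blast
      have "\<rho> S g \<le> Max (\<rho> S ` F)" if g: "g \<in> L" for g
      proof -
        obtain f where f: "f \<in> F" "\<forall>x\<in>T S. g x = f x" using F(3)[OF g] by (elim bexE)
        then have "\<rho> S g = \<rho> S f" by (intro \<rho>_cong)
        then show ?thesis using F(1) f(1) by simp
      qed
      then show ?thesis by blast
    qed
    then obtain b where b: "\<And>S g. S \<in> \<T> \<Longrightarrow> g \<in> L \<Longrightarrow> \<rho> S g \<le> b S" by metis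
    \<comment> \<open>Uncountability enters here: one \<open>m\<close> bounds \<open>b S\<close> for
      infinitely many \<open>S\<close>. Among \<open>n + 1\<close> of these a function in
      \<open>B n\<close> has a nonzero coordinate, which is \<open>n\<close>, so
      \<open>n \<le> m\<close> and only finitely many \<open>B n\<close> matter on
      \<open>L\<close>.\<close>
    have "\<exists>m. infinite {S \<in> \<T>. b S \<le> m}"
    proof (rule ccontr)
      assume "\<not> ?thesis"
      then have "countable (\<Union>m. {S \<in> \<T>. b S \<le> m})" by (intro countable_UN) (auto intro: countable_finite)
      moreover have "(\<Union>m. {S \<in> \<T>. b S \<le> m}) = \<T>" by auto
      ultimately show False using unc by (simp add: \<T>_def)
    qed
    then obtain m where m: "infinite {S \<in> \<T>. b S \<le> m}" by blast
    have small: "n \<le> m" if g: "g \<in> L" "g \<in> B n" for g n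
    proof -
      obtain \<G> where G: "\<G> \<subseteq> {S \<in> \<T>. b S \<le> m}" "finite \<G>" "card \<G> = Suc n"
        using infinite_arbitrarily_large[OF m] by metis
      have "\<not> (\<forall>S\<in>\<G>. \<rho> S g = 0)"
      proof
        assume "\<forall>S\<in>\<G>. \<rho> S g = 0"
        then have "card \<G> \<le> n" using g(2) G(1,2) unfolding B_def by blast
        then show False using G(3) by simp
      qed
      then obtain S where S: "S \<in> \<G>" "\<rho> S g \<noteq> 0" by blast
      then have "S \<in> \<T>" "b S \<le> m" using G(1) by auto
      then show ?thesis using b[of S g] S(2) g by (auto simp: B_def)
    qed
    have "L \<inter> U = (\<Union>n\<in>{0<..m}. L \<inter> B n)"
    proof
      show "L \<inter> U \<subseteq> (\<Union>n\<in>{0<..m}. L \<inter> B n)"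
      proof
        fix g assume g: "g \<in> L \<inter> U"
        then obtain n where n: "0 < n" "g \<in> B n" by (auto simp: U_def)
        have "n \<le> m" using small[OF _ n(2)] g by blast
        then have "n \<in> {0<..m}" using n(1) by simp
        then show "g \<in> (\<Union>n\<in>{0<..m}. L \<inter> B n)" using g n(2) by blast
      qed
    qed (auto simp: U_def)
    moreover have "closedin (Ck2 X) (\<Union>n\<in>{0<..m}. L \<inter> B n)"
      using clL clB by (intro closedin_Union) auto
    ultimately show ?thesis by simp
  qed
  then have "closedin (subtopology (Ck2 X) L) (L \<inter> U)" if "compactin (Ck2 X) L" for L
    using that by (intro closedin_subset_topspace) auto
  moreover have "U \<subseteq> topspace (Ck2 X)" using BC by (auto simp: U_def)
  ultimately have clU: "closedin (Ck2 X) U" using ks unfolding k_space_def by blast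
  let ?z = "chi X {}"
  have z: "?z \<in> topspace (Ck2 X)" by (intro chi_mem) simp
  have TX: "T S \<subseteq> topspace X" if "S \<in> \<T>" for S using TA[OF that] compactin_subset_topspace by blast
  have "?z \<notin> U"
  proof
    assume "?z \<in> U"
    then obtain n where n: "?z \<in> B n" by (auto simp: U_def)
    obtain \<G> where G: "\<G> \<subseteq> \<T>" "finite \<G>" "card \<G> = Suc n"
      using infinite_arbitrarily_large[OF inf\<T>] by metis
    have "\<rho> S ?z = 0" if S: "S \<in> \<G>" for S
    proof (rule \<rho>_zero)
      show "S \<in> \<T>" using S G(1) by blast
      then show "\<forall>x\<in>T S. ?z x = 0" using TX by (auto simp: subset_iff)
    qed
    then have "card \<G> \<le> n" using n G(1,2) unfolding B_def by blast
    then show False using G(3) by simp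
  qed
  then obtain K where K: "compactin X K" "agree X ?z K \<inter> U = {}"
    using clU z unfolding closedin_Ck2_iff by blast
  have KX: "K \<subseteq> topspace X" using K(1) compactin_subset_topspace by blast
  have "\<exists>\<F>. finite \<F> \<and> \<F> \<subseteq> \<S> \<and> K \<subseteq> \<Union>\<F>"
    using op un KX by (intro compactinD[OF K(1)]) auto
  then obtain \<F> where F: "finite \<F>" "\<F> \<subseteq> \<S>" "K \<subseteq> \<Union>\<F>" by blast
  \<comment> \<open>The witness is zero on the pieces in \<open>\<F>\<close>, which cover
    \<open>K\<close>, and has coordinate \<open>Suc n\<close> elsewhere. This index is positive, and
    at most \<open>n\<close> coordinates vanish, so the witness belongs to
    \<open>B (Suc n)\<close>.\<close>
  define n where "n = card \<F>"
  define C where "C = (\<Union>S\<in>\<T> - \<F>. A S n)"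
  have "clopenin X C"
    unfolding C_def using TA \<T>\<S> by (intro clopenin_UN_pieces[OF disj un op]) auto
  then have gC: "chi X C \<in> topspace (Ck2 X)" by (rule chi_mem)
  have mem_C: "x \<in> C \<longleftrightarrow> S \<notin> \<F> \<and> S \<in> \<T> \<and> x \<in> A S n" if x: "x \<in> S" and S: "S \<in> \<S>" for x S
  proof
    assume "x \<in> C"
    then obtain R where R: "R \<in> \<T>" "R \<notin> \<F>" "x \<in> A R n" by (auto simp: C_def)
    then have "x \<in> R" using TA by blast
    then have "\<not> disjnt S R" using x by (auto simp: disjnt_iff)
    then have "S = R" using disj S R(1) \<T>\<S> by (meson pairwiseD subsetD)
    then show "S \<notin> \<F> \<and> S \<in> \<T> \<and> x \<in> A S n" using R by simp
  qed (auto simp: C_def)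
  have in_F: "\<rho> S (chi X C) = 0" if S: "S \<in> \<T>" "S \<in> \<F>" for S
  proof (rule \<rho>_zero[OF S(1)], rule ballI)
    fix x assume x: "x \<in> T S"
    then have "x \<in> S" "x \<in> topspace X" using TA[OF S(1)] TX[OF S(1)] by blast+
    then show "chi X C x = 0" using mem_C[of x S] S \<T>\<S> by auto
  qed
  have off_F: "\<rho> S (chi X C) = Suc n" if S: "S \<in> \<T>" "S \<notin> \<F>" for S
  proof (rule \<rho>_Suc[OF S(1)], rule ballI)
    fix x assume x: "x \<in> T S"
    then have "x \<in> S" "x \<in> topspace X" using TA[OF S(1)] TX[OF S(1)] by blast+
    then show "chi X C x = of_bool (x \<in> A S n)" using mem_C[of x S] S \<T>\<S> by auto
  qed
  have "chi X C \<in> B (Suc n)"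
    unfolding B_def
  proof (intro CollectI conjI gC ballI allI impI)
    show "\<rho> S (chi X C) = 0 \<or> \<rho> S (chi X C) = Suc n" if "S \<in> \<T>" for S
      using in_F off_F that by blast
    fix \<G> assume G: "finite \<G> \<and> \<G> \<subseteq> \<T> \<and> (\<forall>S\<in>\<G>. \<rho> S (chi X C) = 0)"
    have "\<G> \<subseteq> \<F>"
    proof
      fix S assume S: "S \<in> \<G>"
      then have "\<rho> S (chi X C) = 0" "S \<in> \<T>" using G by auto
      then show "S \<in> \<F>" using off_F by fastforce
    qed
    then show "card \<G> \<le> Suc n" using F(1) card_mono[of \<F> \<G>] by (simp add: n_def)
  qed
  then have "chi X C \<in> U" by (auto simp: U_def)
  moreover have "chi X C x = ?z x" if x: "x \<in> K" for x
  proof -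
    obtain S where S: "S \<in> \<F>" "x \<in> S" using F(3) x by blast
    then have "x \<notin> C" using mem_C[of x S] F(2) by blast
    then show ?thesis using x KX by (auto simp: subset_iff)
  qed
  then have "chi X C \<in> agree X ?z K" using gC by (simp add: agree_def)
  ultimately show False using K(2) by blast
qed


lemma k_network_point:
  assumes "k_network X \<N>" "openin X V" "x \<in> V"
  shows "\<exists>N\<in>\<N>. x \<in> N \<and> N \<subseteq> V"
proof -
  have x: "compactin X {x}" "{x} \<subseteq> V" using assms(2,3) openin_subset by auto
  obtain \<F> where F: "finite \<F>" "\<F> \<subseteq> \<N>" "{x} \<subseteq> \<Union>\<F>" "\<Union>\<F> \<subseteq> V"
    by (rule k_networkE[OF assms(1,2) x])
  then obtain N where "N \<in> \<F>" "x \<in> N" by blast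
  moreover then have "N \<subseteq> V" "N \<in> \<N>" using F(2,4) by auto
  ultimately show ?thesis by (intro bexI[of _ N] conjI)
qed

subsection \<open>Complete metrizability\<close>

text \<open>By compactness the metric neighbourhoods of \<open>X'\<close> of radius
  \<open>1/(n+1)\<close> form a base at \<open>X'\<close>. They are clopen, as every set containing
  \<open>X'\<close> is closed.\<close>

lemma metrizable_isolated_tails:
  assumes m: "metrizable_space X" and X': "compactin X (non_isolated_points X)"
  shows "\<exists>U. isolated_tails X U"
proof -
  let ?X' = "non_isolated_points X"
  obtain M d where "Metric_space M d" and X: "X = Metric_space.mtopology M d"
    using m metrizable_space_def by blast
  then interpret Metric_space M d by simp
  have X'M: "?X' \<subseteq> M" using compactin_subset_topspace[OF X'] X by simp
  define U where "U n = (\<Union>x\<in>?X'. mball x (inverse (real (Suc n))))" for n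
  have op: "openin X (U n)" for n unfolding U_def X by (intro openin_Union) auto
  have sub: "?X' \<subseteq> U n" for n using X'M by (force simp: U_def)
  show ?thesis
  proof (rule isolated_tailsI[of "range U"])
    show "clopenin X V \<and> ?X' \<subseteq> V" if V: "V \<in> range U" for V
    proof -
      obtain n where n: "V = U n" using V by blast
      have "closedin X (U n)"
        using closedin_non_isolated_superset[OF openin_subset[OF op] sub] .
      then show ?thesis using op sub n by (simp add: clopenin_def)
    qed
    fix W assume W: "openin X W" "?X' \<subseteq> W"
    \<comment> \<open>The factor 2 leaves room for the triangle inequality: \<open>x\<close> is
      within \<open>r z\<close> of a chosen centre \<open>z\<close>, and \<open>y\<close> is within
      another \<open>r z\<close> of \<open>x\<close>.\<close>
    have "\<forall>x\<in>?X'. \<exists>r>0. mball x (2 * r) \<subseteq> W"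
    proof
      fix x assume "x \<in> ?X'"
      then have "x \<in> W" using W(2) by blast
      then obtain r where r: "r > 0" "mball x r \<subseteq> W" using W(1) unfolding X openin_mtopology by blast
      have "mball x (2 * (r / 2)) \<subseteq> W" using r(2) by simp
      then show "\<exists>r>0. mball x (2 * r) \<subseteq> W" using r(1) by (intro exI[of _ "r / 2"]) auto
    qed
    then obtain r where r: "\<And>x. x \<in> ?X' \<Longrightarrow> r x > 0" "\<And>x. x \<in> ?X' \<Longrightarrow> mball x (2 * r x) \<subseteq> W" by metis
    have "\<exists>\<F>. finite \<F> \<and> \<F> \<subseteq> (\<lambda>x. mball x (r x)) ` ?X' \<and> ?X' \<subseteq> \<Union>\<F>"
    proof (rule compactinD[OF X'])
      show "openin X V" if "V \<in> (\<lambda>x. mball x (r x)) ` ?X'" for V using that by (auto simp: X)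
      show "?X' \<subseteq> \<Union>((\<lambda>x. mball x (r x)) ` ?X')"
      proof
        fix x assume x: "x \<in> ?X'"
        then have "x \<in> mball x (r x)" using X'M r(1) by auto
        then show "x \<in> \<Union>((\<lambda>x. mball x (r x)) ` ?X')" using x by blast
      qed
    qed
    then obtain \<F> where \<F>: "finite \<F>" "\<F> \<subseteq> (\<lambda>x. mball x (r x)) ` ?X'" "?X' \<subseteq> \<Union>\<F>"
      by (elim exE conjE)
    obtain F where F: "F \<subseteq> ?X'" "finite F" and \<F>_eq: "\<F> = (\<lambda>x. mball x (r x)) ` F"
      using finite_subset_image[OF \<F>(1,2)] by (elim exE conjE)
    obtain n where n: "\<forall>x\<in>F. inverse (real (Suc n)) < r x"
    proof (cases "F = {}")
      case False
      have "0 < Min (r ` F)" using F r(1) False by auto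
      then obtain n where "inverse (real (Suc n)) < Min (r ` F)" using reals_Archimedean by blast
      then have "\<forall>x\<in>F. inverse (real (Suc n)) < r x" using F(2) False by (subst (asm) Min_gr_iff) auto
      then show thesis by (rule that)
    qed simp
    have "U n \<subseteq> W"
    proof
      fix y assume "y \<in> U n"
      then obtain x where x: "x \<in> ?X'" "y \<in> mball x (inverse (real (Suc n)))" by (auto simp: U_def)
      obtain z where z: "z \<in> F" "x \<in> mball z (r z)" using \<F>(3) \<F>_eq x(1) by blast
      have "d z y \<le> d z x + d x y" using z x by (intro triangle) auto
      also have "\<dots> < r z + r z" using z x n by (intro add_strict_mono) (auto intro: less_trans)
      finally have "y \<in> mball z (2 * r z)" using z x by auto
      then show "y \<in> W" using r(2) z(1) F(1) by blast
    qed
    then show "\<exists>V\<in>range U. V \<subseteq> W" by blast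
  qed simp
qed

context bar_aleph_k_R begin

text \<open>Only countably many network members meet the compact set \<open>X'\<close>. One clopen
  set is chosen for every pair of them that can be separated at all, and small members around two
  points form such a pair.\<close>

lemma countable_clopen_separation:
  assumes X': "compactin X (non_isolated_points X)"
  obtains D :: "nat \<Rightarrow> 'a set" where "\<And>n. clopenin X (D n)"
    "\<And>x y. \<lbrakk>x \<in> non_isolated_points X; y \<in> non_isolated_points X; x \<noteq> y\<rbrakk> \<Longrightarrow> \<exists>n. x \<in> D n \<and> y \<notin> D n"
proof -
  let ?X' = "non_isolated_points X"
  have X'X: "?X' \<subseteq> topspace X" using compactin_subset_topspace[OF X'] .
  obtain \<N> where kn: "k_network X \<N>" and cc: "compact_countable X \<N>"
    and cl: "\<And>N. N \<in> \<N> \<Longrightarrow> closedin X N" by (fact closed_k_network)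
  define \<N>' where "\<N>' = {N \<in> \<N>. N \<inter> ?X' \<noteq> {}}"
  have cN': "countable \<N>'" using cc X' unfolding compact_countable_def \<N>'_def by blast
  have net: "\<exists>N\<in>\<N>'. x \<in> N \<and> N \<subseteq> V" if x: "x \<in> ?X'" "x \<in> V" and V: "openin X V" for x V
  proof -
    obtain N where "N \<in> \<N>" "x \<in> N" "N \<subseteq> V" using k_network_point[OF kn V x(2)] by blast
    then show ?thesis using x(1) by (intro bexI[of _ N]) (auto simp: \<N>'_def)
  qed
  define good where "good p C \<longleftrightarrow> clopenin X C \<and> fst p \<subseteq> C \<and> snd p \<inter> C = {}" for p :: "'a set \<times> 'a set" and C
  define c where "c p = (SOME C. good p C)" for p
  define \<P> where "\<P> = {p \<in> \<N>' \<times> \<N>'. \<exists>C. good p C}"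
  have c: "good p (c p)" if "p \<in> \<P>" for p
    using that unfolding \<P>_def c_def by (auto intro: someI_ex)
  define \<D> where "\<D> = insert {} (c ` \<P>)"
  define D where "D = from_nat_into \<D>"
  have "countable \<P>" unfolding \<P>_def using cN' by (intro countable_subset[OF Collect_restrict]) simp
  then have range_D: "range D = \<D>" unfolding D_def by (intro range_from_nat_into) (simp_all add: \<D>_def)
  show thesis
  proof (rule that)
    show "clopenin X (D n)" for n
    proof -
      have "D n \<in> \<D>" using range_D by blast
      then show ?thesis using c by (auto simp: \<D>_def good_def)
    qed
    fix x y assume xy: "x \<in> ?X'" "y \<in> ?X'" "x \<noteq> y"
    have "closedin X {y}" using xy(2) X'X by (intro compact_closedin finite_compactin) auto
    then have "openin X (topspace X - {y})" by blast
    then obtain C where C: "clopenin X C" "x \<in> C" "C \<subseteq> topspace X - {y}"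
      using clopen_nhd[of "topspace X - {y}" x] xy X'X by blast
    obtain N where N: "N \<in> \<N>'" "x \<in> N" "N \<subseteq> C"
      using net[OF xy(1) C(2)] C(1) by (auto simp: clopenin_def)
    obtain M where M: "M \<in> \<N>'" "y \<in> M" "M \<subseteq> topspace X - C"
      using net[of y "topspace X - C"] C xy(2) X'X by (auto simp: clopenin_def)
    have "good (N, M) C" using C(1) N(3) M(3) by (auto simp: good_def)
    then have "(N, M) \<in> \<P>" using N(1) M(1) by (auto simp: \<P>_def)
    then have "good (N, M) (c (N, M))" "c (N, M) \<in> \<D>" using c by (auto simp: \<D>_def)
    moreover obtain n where "c (N, M) = D n" using calculation(2) range_D by (metis imageE)
    ultimately have "x \<in> D n" "y \<notin> D n" using N(2) M(2) by (auto simp: good_def)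
    then show "\<exists>n. x \<in> D n \<and> y \<notin> D n" by blast
  qed
qed

text \<open>The coordinates \<open>u i\<close> collapse \<open>U i\<close> to a point and
  distinguish the isolated points outside; the \<open>v i\<close> separate the points of
  \<open>X'\<close>. A sequence with stabilizing coordinates is either eventually constant or
  eventually in every \<open>U i\<close>, and then it is compact together with
  \<open>X'\<close>.\<close>

lemma completely_metrizable_isolated_tails:
  assumes X': "compactin X (non_isolated_points X)" and t: "isolated_tails X U"
  shows "completely_metrizable_space X"
proof -
  let ?X' = "non_isolated_points X"
  have X'X: "?X' \<subseteq> topspace X" using compactin_subset_topspace[OF X'] .
  have Ucl: "clopenin X (U n)" "?X' \<subseteq> U n" for n using t by (simp_all add: isolated_tails_def)
  have base: "\<exists>n. U n \<subseteq> V" if "openin X V" "?X' \<subseteq> V" for V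
    using t that unfolding isolated_tails_def by blast
  obtain D :: "nat \<Rightarrow> 'a set" where D: "\<And>n. clopenin X (D n)"
    and sep: "\<And>x y. \<lbrakk>x \<in> ?X'; y \<in> ?X'; x \<noteq> y\<rbrakk> \<Longrightarrow> \<exists>n. x \<in> D n \<and> y \<notin> D n"
    by (fact countable_clopen_separation[OF X'])
  have in_all: "x \<in> ?X'" if x: "x \<in> topspace X" "\<And>i. x \<in> U i" for x
  proof (rule ccontr)
    assume "x \<notin> ?X'"
    moreover have "closedin X {x}" using x(1) by (intro compact_closedin finite_compactin) auto
    then have "openin X (topspace X - {x})" by blast
    ultimately obtain n where "U n \<subseteq> topspace X - {x}" using base X'X by blast
    then show False using x(2) by blast
  qed
  \<comment> \<open>Values are sets so that \<open>u\<close> and \<open>v\<close> have one type and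
    can be interleaved: \<open>{}\<close> codes membership, while \<open>{x}\<close> or
    \<open>topspace X\<close>, both nonempty at a point \<open>x\<close> of \<open>X\<close>, code
    the opposite.\<close>
  define u where "u i x = (if x \<in> U i then {} else {x})" for i x
  define v where "v i x = (if x \<in> D i then {} else topspace X)" for i x
  define e where "e n = (if even n then u (n div 2) else v (n div 2))" for n
  have eu: "e (2 * i) = u i" and ev: "e (Suc (2 * i)) = v i" for i by (simp_all add: e_def)
  show ?thesis
  proof (rule completely_metrizable_if_discrete_coordinates[where e = e])
    fix n
    have "openin X {x \<in> topspace X. u i x \<in> S}" for i S
    proof -
      have "{x \<in> topspace X. u i x \<in> S} = (if {} \<in> S then U i else {}) \<union> {x \<in> topspace X - U i. {x} \<in> S}"
        using clopenin_subset[OF Ucl(1)] by (auto simp: u_def split: if_splits)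
      moreover have "openin X {x \<in> topspace X - U i. {x} \<in> S}"
        using Ucl(2)[of i] by (intro openin_isolated) auto
      ultimately show ?thesis using Ucl(1)[of i] by (auto simp: clopenin_def openin_Un)
    qed
    moreover have "openin X {x \<in> topspace X. v i x \<in> S}" for i S
    proof -
      have "{x \<in> topspace X. v i x \<in> S} = (if {} \<in> S then D i else {}) \<union> (if topspace X \<in> S then topspace X - D i else {})"
        using clopenin_subset[OF D] by (auto simp: v_def split: if_splits)
      then show ?thesis using D[of i] by (auto simp: clopenin_def openin_Un)
    qed
    ultimately show "continuous_map X (discrete_topology UNIV) (e n)"
      by (simp add: continuous_map_def e_def)
  next
    fix x y assume xy: "x \<in> topspace X" "y \<in> topspace X" "\<And>i. e i x = e i y"
    have uxy: "u i x = u i y" for i using xy(3)[of "2 * i"] by (simp add: eu)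
    have vxy: "v i x = v i y" for i using xy(3)[of "Suc (2 * i)"] by (simp add: ev)
    show "x = y"
    proof (cases "\<forall>i. x \<in> U i \<and> y \<in> U i")
      case True
      then have X'xy: "x \<in> ?X'" "y \<in> ?X'" using in_all xy(1,2) by blast+
      have D_eq: "x \<in> D i \<longleftrightarrow> y \<in> D i" for i
        using vxy[of i] xy(1) by (auto simp: v_def split: if_splits)
      show ?thesis
      proof (rule ccontr)
        assume "x \<noteq> y"
        then show False using sep[OF X'xy] D_eq by blast
      qed
    next
      case False
      then obtain i where "x \<notin> U i \<or> y \<notin> U i" by blast
      then show ?thesis using uxy[of i] by (auto simp: u_def split: if_splits)
    qed
  next
    fix s :: "nat \<Rightarrow> 'a" and y
    assume s: "\<And>n. s n \<in> topspace X" and lim: "\<And>i. \<exists>N. \<forall>n\<ge>N. e i (s n) = y i"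
    show "\<exists>x\<in>topspace X. \<forall>V. openin X V \<and> x \<in> V \<longrightarrow> infinite {n. s n \<in> V}"
    proof (cases "\<exists>i. y (2 * i) \<noteq> {}")
      case True
      then obtain i where i: "y (2 * i) \<noteq> {}" by blast
      obtain N where N: "\<forall>n\<ge>N. u i (s n) = y (2 * i)" using lim[of "2 * i"] by (auto simp: eu)
      have const: "s n = s N" if "n \<ge> N" for n
        using N[rule_format, OF that] N[rule_format, of N] i by (auto simp: u_def split: if_splits)
      show ?thesis
      proof (intro bexI[of _ "s N"] allI impI)
        fix V assume "openin X V \<and> s N \<in> V"
        then have "s n \<in> V" if "n \<ge> N" for n using const[OF that] by simp
        then have "{N..} \<subseteq> {n. s n \<in> V}" by blast
        then show "infinite {n. s n \<in> V}" using infinite_Ici infinite_super by blast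
      qed (rule s)
    next
      case False
      have inU: "\<exists>N. \<forall>n\<ge>N. s n \<in> U i" for i
      proof -
        obtain N where N: "\<forall>n\<ge>N. u i (s n) = y (2 * i)" using lim[of "2 * i"] by (auto simp: eu)
        have "s n \<in> U i" if "n \<ge> N" for n
          using N[rule_format, OF that] False by (auto simp: u_def split: if_splits)
        then show ?thesis by blast
      qed
      have "compactin X (?X' \<union> range s)"
      proof (rule compactin_Un_range[OF X'])
        show "range s \<subseteq> topspace X" using s by blast
        fix V assume "openin X V" "?X' \<subseteq> V"
        then obtain i where i: "U i \<subseteq> V" using base by blast
        obtain N where "\<forall>n\<ge>N. s n \<in> U i" using inU by blast
        then show "\<exists>m. \<forall>i\<ge>m. s i \<in> V" using i by blast
      qed
      from compactin_cluster_point[OF this, of s] show ?thesis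
        using X'X s by blast
    qed
  qed
qed

lemma metrizable_compact_iff:
  "metrizable_space X \<and> compactin X (non_isolated_points X) \<longleftrightarrow>
    compactin X (non_isolated_points X) \<and> (\<exists>U. isolated_tails X U)"
  using metrizable_isolated_tails completely_metrizable_isolated_tails
    completely_metrizable_imp_metrizable_space by blast

text \<open>One point from each of the countably many network members meeting \<open>X'\<close>
  gives a set that comes close to every point of \<open>X'\<close>; the isolated points are added
  outright.\<close>

lemma separable_if_countable_isolated:
  assumes X': "compactin X (non_isolated_points X)" and c: "countable (topspace X - non_isolated_points X)"
  shows "separable_space X"
proof -
  let ?X' = "non_isolated_points X"
  obtain \<N> where kn: "k_network X \<N>" and cc: "compact_countable X \<N>"
    and cl: "\<And>N. N \<in> \<N> \<Longrightarrow> closedin X N" by (fact closed_k_network)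
  define \<N>' where "\<N>' = {N \<in> \<N>. N \<inter> ?X' \<noteq> {}}"
  have cN': "countable \<N>'" using cc X' unfolding compact_countable_def \<N>'_def by blast
  define p where "p N = (SOME x. x \<in> N)" for N :: "'a set"
  have p: "p N \<in> N" if "N \<in> \<N>'" for N
  proof -
    have "\<exists>x. x \<in> N" using that by (auto simp: \<N>'_def)
    then show ?thesis unfolding p_def by (rule someI_ex)
  qed
  have pX: "p N \<in> topspace X" if "N \<in> \<N>'" for N
    using p[OF that] cl closedin_subset that by (fastforce simp: \<N>'_def)
  let ?Q = "p ` \<N>' \<union> (topspace X - ?X')"
  have "topspace X \<subseteq> X closure_of ?Q"
  proof
    fix x assume x: "x \<in> topspace X"
    have "\<exists>y\<in>?Q. y \<in> V" if V: "x \<in> V" "openin X V" for V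
    proof (cases "x \<in> ?X'")
      case True
      obtain N where N: "N \<in> \<N>" "x \<in> N" "N \<subseteq> V" using k_network_point[OF kn V(2,1)] by blast
      then have "N \<in> \<N>'" using True by (auto simp: \<N>'_def)
      moreover then have "p N \<in> V" using p N(3) by blast
      ultimately show ?thesis by blast
    qed (use x V in blast)
    then show "x \<in> X closure_of ?Q" using x unfolding in_closure_of Bex_def by simp
  qed
  then have "X closure_of ?Q = topspace X" using closure_of_subset_topspace by (rule subset_antisym[rotated])
  moreover have "countable ?Q" using c cN' by simp
  moreover have "?Q \<subseteq> topspace X" using pX by auto
  ultimately show ?thesis unfolding separable_space_def by blast
qed

end


subsection \<open>Topological sums\<close>

lemma homeomorphic_sum_of_pieces:
  assumes op: "\<And>i. i \<in> I \<Longrightarrow> openin X (T i)" and disj: "disjoint_family_on T I"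
    and un: "(\<Union>i\<in>I. T i) = topspace X"
  shows "X homeomorphic_space sum_topology (\<lambda>i. subtopology X (T i)) I"
proof -
  let ?Y = "sum_topology (\<lambda>i. subtopology X (T i)) I"
  have top_i: "topspace (subtopology X (T i)) = T i" if "i \<in> I" for i
    using openin_subset[OF op[OF that]] by (simp add: Int_absorb1)
  have top: "topspace ?Y = Sigma I T"
    unfolding topspace_sum_topology by (rule Sigma_cong) (simp_all add: top_i del: topspace_subtopology)
  have opY: "openin ?Y U \<longleftrightarrow> U \<subseteq> Sigma I T \<and> (\<forall>i\<in>I. openin (subtopology X (T i)) {x. (i, x) \<in> U})" for U
    unfolding openin_sum_topology top[symmetric] topspace_sum_topology ..
  have "homeomorphic_map ?Y X snd"
  proof (rule bijective_open_imp_homeomorphic_map)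
    show "continuous_map ?Y X snd"
      unfolding continuous_map_def top
    proof (intro conjI allI impI)
      show "snd \<in> Sigma I T \<rightarrow> topspace X" using un by auto
      fix U assume U: "openin X U"
      have "openin (subtopology X (T i)) {x. (i, x) \<in> {p \<in> Sigma I T. snd p \<in> U}}" if i: "i \<in> I" for i
      proof -
        have "{x. (i, x) \<in> {p \<in> Sigma I T. snd p \<in> U}} = T i \<inter> U" using i by auto
        then show ?thesis using U openin_subtopology_Int2 by metis
      qed
      then show "openin ?Y {p \<in> Sigma I T. snd p \<in> U}" unfolding opY by auto
    qed
    show "open_map ?Y X snd"
      unfolding open_map_def
    proof (intro allI impI)
      fix U assume U: "openin ?Y U"
      have "snd ` U = (\<Union>i\<in>I. {x. (i, x) \<in> U})" using U unfolding opY by force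
      moreover have "openin X {x. (i, x) \<in> U}" if "i \<in> I" for i
        using U that op[OF that] unfolding opY by (meson openin_trans_full)
      ultimately show "openin X (snd ` U)" by auto
    qed
    show "snd ` topspace ?Y = topspace X" unfolding top using un by force
    show "inj_on snd (topspace ?Y)"
    proof (rule inj_onI)
      fix p q assume pq: "p \<in> topspace ?Y" "q \<in> topspace ?Y" "snd p = snd q"
      obtain i x j where ij: "p = (i, x)" "q = (j, x)" "i \<in> I" "j \<in> I" "x \<in> T i" "x \<in> T j"
        using pq unfolding top by (cases p; cases q) auto
      then have "i = j" using disj unfolding disjoint_family_on_def by blast
      then show "p = q" using ij by simp
    qed
  qed
  then show ?thesis using homeomorphic_map_imp_homeomorphic_space homeomorphic_space_sym by blast
qed

lemma sum_summand:
  assumes h: "homeomorphic_map (sum_topology Y I) X h" and i: "i \<in> I"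
  defines "e \<equiv> h \<circ> Pair i"
  shows "openin X (e ` topspace (Y i))" "embedding_map (Y i) X e"
proof -
  have "embedding_map (sum_topology Y I) X h" using h surjective_embedding_map by blast
  then show "embedding_map (Y i) X e"
    unfolding e_def by (rule embedding_map_compose[OF embedding_map_component_injection[OF i]])
  have "openin (sum_topology Y I) (Pair i ` topspace (Y i))"
    using open_map_component_injection[OF i, of Y] unfolding open_map_def by simp
  then have "openin X (h ` (Pair i ` topspace (Y i)))"
    using homeomorphic_imp_open_map[OF h] unfolding open_map_def by blast
  then show "openin X (e ` topspace (Y i))" by (simp add: e_def image_comp)
qed

lemma cosmic_imp_t1: "cosmic_space Y \<Longrightarrow> t1_space Y"
  by (simp add: cosmic_space_def)

lemma sum_of_cosmic_k_omega_imp_partition: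
  assumes "sum_of_cosmic_k_omega_spaces X"
  shows "\<exists>\<S>. hemicompact_partition X \<S>"
proof -
  obtain I :: "'a set" and Y :: "'a \<Rightarrow> 'a topology"
    where Y: "\<forall>i\<in>I. cosmic_space (Y i) \<and> k_omega_space (Y i)" and hom: "X homeomorphic_space sum_topology Y I"
    using assms unfolding sum_of_cosmic_k_omega_spaces_def by (elim exE conjE)
  obtain h where h: "homeomorphic_map (sum_topology Y I) X h"
    using homeomorphic_space_sym[THEN iffD1, OF hom] homeomorphic_space by blast
  define S where "S i = (h \<circ> Pair i) ` topspace (Y i)" for i
  have op: "openin X (S i)" if "i \<in> I" for i unfolding S_def using sum_summand(1)[OF h that] .
  have un: "(\<Union>i\<in>I. S i) = topspace X"
  proof -
    have "(\<Union>i\<in>I. S i) = h ` topspace (sum_topology Y I)"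
      by (auto simp: S_def topspace_sum_topology)
    then show ?thesis using homeomorphic_imp_surjective_map[OF h] by simp
  qed
  have S_disj: "i = j" if S: "i \<in> I" "j \<in> I" "x \<in> S i" "x \<in> S j" for i j x
  proof -
    obtain a b where ab: "a \<in> topspace (Y i)" "x = h (i, a)" "b \<in> topspace (Y j)" "x = h (j, b)"
      using S(3,4) by (auto simp: S_def)
    have "(i, a) = (j, b)"
      by (rule inj_onD[OF homeomorphic_imp_injective_map[OF h]])
        (use ab S(1,2) in \<open>auto simp: topspace_sum_topology\<close>)
    then show ?thesis by simp
  qed
  let ?\<S> = "S ` I - {{}}"
  have disj: "pairwise disjnt ?\<S>"
  proof (rule pairwiseI)
    fix A B assume AB: "A \<in> ?\<S>" "B \<in> ?\<S>" "A \<noteq> B"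
    then obtain i j where "i \<in> I" "A = S i" "j \<in> I" "B = S j" by blast
    then show "disjnt A B" using S_disj AB(3) by (auto simp: disjnt_iff)
  qed
  have cover: "\<Union>?\<S> = topspace X"
  proof -
    have "\<Union>?\<S> = \<Union>(S ` I)" by blast
    then show ?thesis using un by simp
  qed
  have "hemicompact_partition X ?\<S>"
    unfolding hemicompact_partition_def
  proof (intro conjI ballI disj cover)
    fix A assume A: "A \<in> ?\<S>"
    then obtain i where i: "i \<in> I" "A = S i" by blast
    show "A \<noteq> {}" using A by blast
    have opS: "\<And>A. A \<in> ?\<S> \<Longrightarrow> openin X A" using op by blast
    have "clopenin X (\<Union>{A})" using A by (intro clopenin_subunion[OF disj cover opS]) auto
    then show "clopenin X A" by simp
    have "hemicompact_in (Y i) (topspace (Y i))"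
      using Y i(1) cosmic_imp_t1 k_omega_imp_hemicompact by blast
    then show "hemicompact_in X A"
      unfolding i(2) S_def by (rule hemicompact_in_embedding[OF sum_summand(2)[OF h i(1)]])
  qed
  then show ?thesis by blast
qed

lemma sum_of_cosmic_k_omega_and_discrete_imp:
  assumes "sum_of_cosmic_k_omega_and_discrete X"
  shows "\<exists>S. clopenin X S \<and> hemicompact_in X S \<and> non_isolated_points X \<subseteq> S"
proof -
  obtain K :: "'a topology" and D :: "'a set" where K: "cosmic_space K" "k_omega_space K"
    and hom: "X homeomorphic_space sum_topology (\<lambda>b. if b then K else discrete_topology D) UNIV"
    using assms unfolding sum_of_cosmic_k_omega_and_discrete_def by (elim exE conjE)
  define Y where "Y b = (if b then K else discrete_topology D)" for b
  have "sum_topology Y UNIV homeomorphic_space X"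
    using homeomorphic_space_sym[THEN iffD1, OF hom] by (simp add: Y_def[abs_def])
  then obtain h where h: "homeomorphic_map (sum_topology Y UNIV) X h"
    using homeomorphic_space by blast
  define S where "S b = (h \<circ> Pair b) ` topspace (Y b)" for b
  have op: "openin X (S b)" for b unfolding S_def using sum_summand(1)[OF h UNIV_I] .
  have "S True \<union> S False = h ` topspace (sum_topology Y UNIV)"
    unfolding S_def topspace_sum_topology by (auto simp: image_iff) (metis (full_types))+
  then have un: "S True \<union> S False = topspace X" using homeomorphic_imp_surjective_map[OF h] by simp
  have dis: "S True \<inter> S False = {}"
  proof -
    have "h (True, a) \<noteq> h (False, b)" if "a \<in> topspace (Y True)" "b \<in> topspace (Y False)" for a b
      using inj_onD[OF homeomorphic_imp_injective_map[OF h], of "(True, a)" "(False, b)"] that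
      by (auto simp: topspace_sum_topology)
    then show ?thesis by (auto simp: S_def)
  qed
  have "topspace X - S True = S False" using un dis by blast
  then have "closedin X (S True)" using op[of False] un by (auto simp: closedin_def)
  then have "clopenin X (S True)" using op by (simp add: clopenin_def)
  moreover have "hemicompact_in X (S True)"
  proof -
    have "hemicompact_in (Y True) (topspace (Y True))"
      using K cosmic_imp_t1 k_omega_imp_hemicompact by (auto simp: Y_def)
    then show ?thesis unfolding S_def by (rule hemicompact_in_embedding[OF sum_summand(2)[OF h UNIV_I]])
  qed
  moreover have "non_isolated_points X \<subseteq> S True"
  proof
    fix x assume x: "x \<in> non_isolated_points X"
    show "x \<in> S True"
    proof (rule ccontr)
      assume "x \<notin> S True"
      then have "x \<in> S False" using x un by (auto simp: non_isolated_points_def)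
      then obtain a where a: "a \<in> D" "x = h (False, a)" by (auto simp: S_def Y_def)
      have "openin (Y False) {a}" using a(1) by (simp add: Y_def)
      then have "openin (sum_topology Y UNIV) (Pair False ` {a})"
        using open_map_component_injection[of False UNIV Y] unfolding open_map_def by blast
      then have "openin X (h ` Pair False ` {a})"
        using homeomorphic_imp_open_map[OF h] unfolding open_map_def by blast
      then show False using x a(2) by (simp add: non_isolated_points_def)
    qed
  qed
  ultimately show ?thesis by blast
qed

section \<open>Hemicompact pieces versus cosmic k-omega summands\<close>

lemma hemicompact_in_Union:
  assumes c: "countable \<S>" and S: "\<And>S. S \<in> \<S> \<Longrightarrow> clopenin X S \<and> hemicompact_in X S"
  shows "hemicompact_in X (\<Union>\<S>)"
proof -
  have "\<forall>S\<in>\<S>. \<exists>K :: nat \<Rightarrow> 'a set. mono K \<and> (\<forall>n. compactin X (K n) \<and> K n \<subseteq> S) \<and>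
     (\<forall>L. compactin X L \<and> L \<subseteq> S \<longrightarrow> (\<exists>n. L \<subseteq> K n))"
    using S unfolding hemicompact_in_def by simp
  then obtain K where K0: "\<forall>S\<in>\<S>. mono (K S :: nat \<Rightarrow> 'a set) \<and> (\<forall>n. compactin X (K S n) \<and> K S n \<subseteq> S) \<and>
     (\<forall>L. compactin X L \<and> L \<subseteq> S \<longrightarrow> (\<exists>n. L \<subseteq> K S n))" by (rule bchoice[THEN exE])
  have Kcof: "\<exists>n. L \<subseteq> K S n" if "S \<in> \<S>" "compactin X L" "L \<subseteq> S" for S L using K0 that by simp
  show ?thesis
  proof (rule hemicompact_inI)
    show "countable (\<Union>S\<in>\<S>. range (K S))" using c by simp
    show "compactin X L \<and> L \<subseteq> \<Union>\<S>" if L: "L \<in> (\<Union>S\<in>\<S>. range (K S))" for L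
    proof -
      obtain S n where Sn: "S \<in> \<S>" "L = K S n" using L by blast
      then have "compactin X L" "L \<subseteq> S" using K0 by simp_all
      then show ?thesis using Sn(1) by blast
    qed
    fix L assume L: "compactin X L" "L \<subseteq> \<Union>\<S>"
    have "\<exists>\<F>. finite \<F> \<and> \<F> \<subseteq> \<S> \<and> L \<subseteq> \<Union>\<F>"
      using L(2) S by (intro compactinD[OF L(1)]) (auto simp: clopenin_def)
    then obtain \<F> where F: "finite \<F>" "\<F> \<subseteq> \<S>" "L \<subseteq> \<Union>\<F>" by (elim exE conjE)
    have "\<exists>n. L \<inter> S \<subseteq> K S n" if "S \<in> \<F>" for S
    proof (rule Kcof)
      show SS: "S \<in> \<S>" using that F(2) by blast
      show "compactin X (L \<inter> S)" using L(1) S[OF SS] compact_Int_closedin by (auto simp: clopenin_def)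
    qed simp
    then obtain n where n: "\<And>S. S \<in> \<F> \<Longrightarrow> L \<inter> S \<subseteq> K S (n S)" by metis
    have "L \<subseteq> \<Union>((\<lambda>S. K S (n S)) ` \<F>)"
    proof
      fix x assume x: "x \<in> L"
      then obtain R where R: "R \<in> \<F>" "x \<in> R" using F(3) by blast
      then have "x \<in> K R (n R)" using n[OF R(1)] x by blast
      then show "x \<in> \<Union>((\<lambda>S. K S (n S)) ` \<F>)" using R(1) by blast
    qed
    moreover have "(\<lambda>S. K S (n S)) ` \<F> \<subseteq> (\<Union>S\<in>\<S>. range (K S))" using F(2) by blast
    ultimately show "\<exists>\<F>. finite \<F> \<and> \<F> \<subseteq> (\<Union>S\<in>\<S>. range (K S)) \<and> L \<subseteq> \<Union>\<F>"
      using F(1) by (intro exI[of _ "(\<lambda>S. K S (n S)) ` \<F>"]) simp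
  qed
qed

lemma hemicompact_in_compact:
  assumes "compactin X K" shows "hemicompact_in X K"
  by (rule hemicompact_inI[of "{K}"]) (use assms in auto)

context bar_aleph_k_R begin

text \<open>A network member that meets \<open>S\<close> meets one of the countably many compact
  sets \<open>K n\<close>, so only countably many do; their traces form the network.\<close>

lemma cosmic_k_omega_subtopology:
  assumes S: "clopenin X S" and h: "hemicompact_in X S"
  shows "cosmic_space (subtopology X S) \<and> k_omega_space (subtopology X S)"
proof
  show "k_omega_space (subtopology X S)" by (rule hemicompact_imp_k_omega[OF S h])
  obtain \<N> where kn: "k_network X \<N>" and cc: "compact_countable X \<N>"
    and cl: "\<And>N. N \<in> \<N> \<Longrightarrow> closedin X N" by (fact closed_k_network)
  obtain K :: "nat \<Rightarrow> 'a set" where K: "mono K" "\<And>n. compactin X (K n)" "\<And>n. K n \<subseteq> S"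
    and cof: "\<And>L. compactin X L \<Longrightarrow> L \<subseteq> S \<Longrightarrow> \<exists>n. L \<subseteq> K n"
    by (fact hemicompact_inE[OF h])
  have SX: "S \<subseteq> topspace X" using S clopenin_subset by blast
  let ?\<M> = "{N \<inter> S | N. N \<in> \<N> \<and> N \<inter> S \<noteq> {}}"
  have "{N \<in> \<N>. N \<inter> S \<noteq> {}} \<subseteq> (\<Union>n. {N \<in> \<N>. N \<inter> K n \<noteq> {}})"
  proof
    fix N assume N: "N \<in> {N \<in> \<N>. N \<inter> S \<noteq> {}}"
    then obtain x where x: "x \<in> N" "x \<in> S" by blast
    then have "compactin X {x}" using SX by auto
    then obtain n where "{x} \<subseteq> K n" using cof[of "{x}"] x(2) by blast
    then show "N \<in> (\<Union>n. {N \<in> \<N>. N \<inter> K n \<noteq> {}})" using N x by blast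
  qed
  moreover have "countable (\<Union>n. {N \<in> \<N>. N \<inter> K n \<noteq> {}})"
    using cc K(2) unfolding compact_countable_def by (intro countable_UN) auto
  ultimately have "countable {N \<in> \<N>. N \<inter> S \<noteq> {}}" by (rule countable_subset)
  then have "countable ((\<lambda>N. N \<inter> S) ` {N \<in> \<N>. N \<inter> S \<noteq> {}})" by (rule countable_image)
  moreover have "?\<M> = (\<lambda>N. N \<inter> S) ` {N \<in> \<N>. N \<inter> S \<noteq> {}}" by blast
  ultimately have "countable ?\<M>" by simp
  moreover have "network (subtopology X S) ?\<M>"
    unfolding network_def
  proof (intro conjI ballI allI impI)
    show "M \<subseteq> topspace (subtopology X S)" if "M \<in> ?\<M>" for M using that SX by auto
    fix U x assume U: "openin (subtopology X S) U \<and> x \<in> U"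
    have "openin X U" "U \<subseteq> S"
      using U S openin_trans_full[of X S U] openin_subset[of "subtopology X S" U] by (auto simp: clopenin_def)
    moreover then obtain N where N: "N \<in> \<N>" "x \<in> N" "N \<subseteq> U" using k_network_point[OF kn, of U x] U by blast
    ultimately have "N \<inter> S \<in> ?\<M>" "x \<in> N \<inter> S" "N \<inter> S \<subseteq> U" using U by auto
    then show "\<exists>M\<in>?\<M>. x \<in> M \<and> M \<subseteq> U" by (intro bexI[of _ "N \<inter> S"] conjI)
  qed
  ultimately have "\<exists>\<M>. countable \<M> \<and> network (subtopology X S) \<M>" by (intro exI[of _ ?\<M>] conjI)
  moreover have "regular_space (subtopology X S)" "t1_space (subtopology X S)"
    using bar regular_space_subtopology t1_space_subtopology unfolding bar_aleph_k_space_def by blast+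
  ultimately show "cosmic_space (subtopology X S)" unfolding cosmic_space_def by simp
qed

lemma cosmic_k_omega_iff: "cosmic_space X \<and> k_omega_space X \<longleftrightarrow> hemicompact_in X (topspace X)"
  using cosmic_k_omega_subtopology[OF clopenin_topspace] k_omega_imp_hemicompact cosmic_imp_t1
  by (auto simp: subtopology_topspace)

lemma sum_of_cosmic_k_omega_iff:
  "sum_of_cosmic_k_omega_spaces X \<longleftrightarrow> (\<exists>\<S>. hemicompact_partition X \<S>)"
proof
  assume "\<exists>\<S>. hemicompact_partition X \<S>"
  then obtain \<S> where "hemicompact_partition X \<S>" by blast
  then have disj: "pairwise disjnt \<S>" and un: "\<Union>\<S> = topspace X"
    and S: "\<And>S. S \<in> \<S> \<Longrightarrow> S \<noteq> {} \<and> clopenin X S \<and> hemicompact_in X S"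
    by (simp_all add: hemicompact_partition_def)
  \<comment> \<open>The summands must be indexed by elements of the point type, so each piece is
    named by one of its points.\<close>
  define p where "p S = (SOME x. x \<in> S)" for S :: "'a set"
  have p: "p S \<in> S" if "S \<in> \<S>" for S
    unfolding p_def using S[OF that] by (simp add: some_in_eq)
  have inj: "inj_on p \<S>"
  proof (rule inj_onI)
    fix A B assume AB: "A \<in> \<S>" "B \<in> \<S>" "p A = p B"
    then have "\<not> disjnt A B" using p by (metis disjnt_iff)
    then show "A = B" using disj AB(1,2) by (meson pairwiseD)
  qed
  define T where "T = inv_into \<S> p"
  have T: "T i \<in> \<S>" if "i \<in> p ` \<S>" for i unfolding T_def using that by (rule inv_into_into)
  have Tp: "T (p A) = A" if "A \<in> \<S>" for A unfolding T_def using inj that by simp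
  have "X homeomorphic_space sum_topology (\<lambda>i. subtopology X (T i)) (p ` \<S>)"
  proof (rule homeomorphic_sum_of_pieces)
    show "openin X (T i)" if "i \<in> p ` \<S>" for i using S[OF T[OF that]] by (simp add: clopenin_def)
    show "disjoint_family_on T (p ` \<S>)"
      unfolding disjoint_family_on_def
    proof (intro ballI impI)
      fix i j assume ij: "i \<in> p ` \<S>" "j \<in> p ` \<S>" "i \<noteq> j"
      then obtain A B where AB: "A \<in> \<S>" "i = p A" "B \<in> \<S>" "j = p B" by blast
      then have "A \<noteq> B" using ij(3) by blast
      then have "disjnt A B" using disj AB(1,3) by (simp add: pairwise_def)
      then show "T i \<inter> T j = {}" using AB Tp by (simp add: disjnt_def)
    qed
    have "T ` p ` \<S> = \<S>" using Tp by force
    then show "(\<Union>i\<in>p ` \<S>. T i) = topspace X" using un by simp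
  qed
  moreover have "\<forall>i\<in>p ` \<S>. cosmic_space (subtopology X (T i)) \<and> k_omega_space (subtopology X (T i))"
    using S T cosmic_k_omega_subtopology by blast
  ultimately show "sum_of_cosmic_k_omega_spaces X"
    unfolding sum_of_cosmic_k_omega_spaces_def
    by (intro exI[of _ "p ` \<S>"] exI[of _ "\<lambda>i. subtopology X (T i)"] conjI)
qed (rule sum_of_cosmic_k_omega_imp_partition)

lemma sum_of_cosmic_k_omega_and_discrete_iff:
  "sum_of_cosmic_k_omega_and_discrete X \<longleftrightarrow>
    (\<exists>S. clopenin X S \<and> hemicompact_in X S \<and> non_isolated_points X \<subseteq> S)"
proof
  assume "\<exists>S. clopenin X S \<and> hemicompact_in X S \<and> non_isolated_points X \<subseteq> S"
  then obtain S where S: "clopenin X S" "hemicompact_in X S" "non_isolated_points X \<subseteq> S" by blast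
  let ?D = "topspace X - S"
  define T where "T b = (if b then S else ?D)" for b
  have SX: "S \<subseteq> topspace X" using S(1) clopenin_subset by blast
  have D: "subtopology X ?D = discrete_topology ?D"
  proof -
    have "openin (subtopology X ?D) {x}" if "x \<in> ?D" for x
    proof -
      have "openin X {x}" using that S(3) by (intro openin_isolated) auto
      then show ?thesis using that by (metis openin_subset_topspace_eq openin_subtopology_Int2 Int_insert_right_if1 Int_empty_right)
    qed
    then have "discrete_topology ?D = subtopology X ?D"
      by (subst discrete_topology_unique) auto
    then show ?thesis by simp
  qed
  have "X homeomorphic_space sum_topology (\<lambda>b. subtopology X (T b)) UNIV"
  proof (rule homeomorphic_sum_of_pieces)
    show "openin X (T b)" for b using S(1) by (auto simp: T_def clopenin_def)
    show "disjoint_family_on T UNIV" by (auto simp: disjoint_family_on_def T_def)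
    show "(\<Union>b\<in>UNIV. T b) = topspace X" using SX by (auto simp: T_def UNIV_bool)
  qed
  moreover have "(\<lambda>b. subtopology X (T b)) = (\<lambda>b. if b then subtopology X S else discrete_topology ?D)"
    using D by (auto simp: T_def fun_eq_iff)
  ultimately show "sum_of_cosmic_k_omega_and_discrete X"
    unfolding sum_of_cosmic_k_omega_and_discrete_def
    using cosmic_k_omega_subtopology[OF S(1,2)]
    by (intro exI[of _ "subtopology X S"] exI[of _ ?D]) simp
qed (rule sum_of_cosmic_k_omega_and_discrete_imp)

subsection \<open>The characterizations\<close>

lemma hemicompact_topspace_if_sequential:
  assumes seq: "sequential_space (Ck2 X)" and part: "hemicompact_partition X \<S>"
  shows "hemicompact_in X (topspace X)"
proof -
  have disj: "pairwise disjnt \<S>" and un: "\<Union>\<S> = topspace X"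
    and S: "\<And>S. S \<in> \<S> \<Longrightarrow> clopenin X S \<and> hemicompact_in X S"
    using part by (simp_all add: hemicompact_partition_def)
  have "openin X S" if "S \<in> \<S>" for S using S[OF that] by (simp add: clopenin_def)
  then have "countable \<S>" using not_sequential_Ck2[OF disj un] seq by blast
  then have "hemicompact_in X (\<Union>\<S>)" using S by (rule hemicompact_in_Union)
  then show ?thesis by (simp add: un)
qed

text \<open>The first obstruction is excluded directly, so a partition exists, and sequentiality
  makes it countable.\<close>

lemma frechet_urysohn_imp_hemicompact:
  assumes FU: "frechet_urysohn_space (Ck2 X)"
  shows "hemicompact_in X (topspace X)"
proof -
  obtain \<S> where "hemicompact_partition X \<S>"
    using hemicompact_partition_if_no_shrinking not_frechet_urysohn_Ck2 FU by metis
  then show ?thesis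
    using hemicompact_topspace_if_sequential frechet_urysohn_imp_sequential[OF FU] by blast
qed

text \<open>The sigma-product argument is applied to the partition into \<open>S\<close> and the
  isolated singletons outside it.\<close>

lemma countable_off_clopen_if_sequential:
  assumes seq: "sequential_space (Ck2 X)" and S: "clopenin X S" and iso: "non_isolated_points X \<subseteq> S"
  shows "countable (topspace X - S)"
proof -
  let ?\<S> = "insert S ((\<lambda>x. {x}) ` (topspace X - S))"
  have SX: "S \<subseteq> topspace X" using S clopenin_subset by blast
  have "countable ?\<S>"
  proof (rule ccontr)
    assume unc: "uncountable ?\<S>"
    have "\<not> sequential_space (Ck2 X)"
    proof (rule not_sequential_Ck2[OF _ _ _ unc])
      show "pairwise disjnt ?\<S>" by (auto simp: pairwise_def disjnt_def)
      show "\<Union>?\<S> = topspace X" using SX by auto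
      show "openin X A" if "A \<in> ?\<S>" for A
      proof (cases "A = S")
        case False
        then show ?thesis using that iso by (intro openin_isolated) auto
      qed (use S in \<open>simp add: clopenin_def\<close>)
    qed
    then show False using seq by blast
  qed
  then have "countable ((\<lambda>x. {x}) ` (topspace X - S))" by simp
  then show ?thesis by (rule countable_image_inj_on) simp
qed

text \<open>Only countably many pieces can contain non-isolated points, and their union is the
  hemicompact part.\<close>

lemma k_space_imp:
  assumes k: "k_space (Ck2 X)" and part: "hemicompact_partition X \<S>"
  shows "\<exists>S. clopenin X S \<and> hemicompact_in X S \<and> non_isolated_points X \<subseteq> S"
proof -
  let ?\<T> = "{S \<in> \<S>. S \<inter> non_isolated_points X \<noteq> {}}"
  have disj: "pairwise disjnt \<S>" and un: "\<Union>\<S> = topspace X"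
    and S: "\<And>S. S \<in> \<S> \<Longrightarrow> clopenin X S \<and> hemicompact_in X S"
    using part by (simp_all add: hemicompact_partition_def)
  have op: "openin X S" if "S \<in> \<S>" for S using S[OF that] by (simp add: clopenin_def)
  have "countable ?\<T>" using not_k_space_Ck2[OF disj un op] k by blast
  then have "hemicompact_in X (\<Union>?\<T>)" using S by (intro hemicompact_in_Union) auto
  moreover have "clopenin X (\<Union>?\<T>)" by (rule clopenin_subunion[OF disj un op]) auto
  moreover have "non_isolated_points X \<subseteq> \<Union>?\<T>"
  proof
    fix x assume x: "x \<in> non_isolated_points X"
    then have "x \<in> \<Union>\<S>" unfolding un by (simp add: non_isolated_points_def)
    then show "x \<in> \<Union>?\<T>" using x by blast
  qed
  ultimately show ?thesis by blast
qed

lemma k_R_space_Ck2_iff: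
  "(k_R_space (Ck2 X) \<longleftrightarrow> ascoli_space (Ck2 X)) \<and>
   (ascoli_space (Ck2 X) \<longleftrightarrow> \<not> (\<exists>F. strong_Fin_fan (Ck2 X) F)) \<and>
   (\<not> (\<exists>F. strong_Fin_fan (Ck2 X) F) \<longleftrightarrow>
     (\<exists>\<S>. hemicompact_partition X \<S>) \<or>
     (compactin X (non_isolated_points X) \<and> (\<exists>U. isolated_tails X U)))"
  using k_R_imp_ascoli[OF tychonoff_space_Ck2] ascoli_imp_no_strong_Fin_fan
    partition_or_tails_if_no_fan k_R_space_Ck2 k_space_Ck2_isolated_tails k_space_imp_k_R_space
  by metis

lemma k_space_Ck2_iff:
  "k_space (Ck2 X) \<longleftrightarrow>
     (\<exists>S. clopenin X S \<and> hemicompact_in X S \<and> non_isolated_points X \<subseteq> S) \<or>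
     (compactin X (non_isolated_points X) \<and> (\<exists>U. isolated_tails X U))"
proof
  assume k: "k_space (Ck2 X)"
  then have "k_R_space (Ck2 X)" by (rule k_space_imp_k_R_space)
  then have "(\<exists>\<S>. hemicompact_partition X \<S>) \<or>
     (compactin X (non_isolated_points X) \<and> (\<exists>U. isolated_tails X U))"
    using k_R_space_Ck2_iff by blast
  then show "(\<exists>S. clopenin X S \<and> hemicompact_in X S \<and> non_isolated_points X \<subseteq> S) \<or>
     (compactin X (non_isolated_points X) \<and> (\<exists>U. isolated_tails X U))"
    using k_space_imp[OF k] by blast
next
  show "k_space (Ck2 X)" if "(\<exists>S. clopenin X S \<and> hemicompact_in X S \<and> non_isolated_points X \<subseteq> S) \<or>
     (compactin X (non_isolated_points X) \<and> (\<exists>U. isolated_tails X U))"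
    using that k_space_Ck2_hemicompact k_space_Ck2_isolated_tails by blast
qed

lemma sequential_Ck2_iff:
  "sequential_space (Ck2 X) \<longleftrightarrow> hemicompact_in X (topspace X) \<or>
     (polish_space X \<and> compactin X (non_isolated_points X))"
proof
  assume seq: "sequential_space (Ck2 X)"
  then consider S where "clopenin X S" "hemicompact_in X S" "non_isolated_points X \<subseteq> S"
    | U where "compactin X (non_isolated_points X)" "isolated_tails X U"
    using sequential_imp_k_space k_space_Ck2_iff by metis
  then show "hemicompact_in X (topspace X) \<or> (polish_space X \<and> compactin X (non_isolated_points X))"
  proof cases
    case 1
    \<comment> \<open>Outside \<open>S\<close> only countably many isolated points remain, and
      adding countably many compact clopen singletons keeps hemicompactness.\<close>
    let ?\<S> = "insert S ((\<lambda>x. {x}) ` (topspace X - S))"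
    have c: "countable ?\<S>" using countable_off_clopen_if_sequential[OF seq 1(1,3)] by simp
    have "clopenin X A \<and> hemicompact_in X A" if A: "A \<in> ?\<S>" for A
    proof (cases "A = S")
      case False
      then obtain x where x: "x \<in> topspace X - S" "A = {x}" using A by blast
      have "compactin X {x}" using x(1) by (intro finite_compactin) auto
      moreover have "openin X {x}" using x(1) 1(3) by (intro openin_isolated) auto
      ultimately show ?thesis
        using compact_closedin[of "{x}"] hemicompact_in_compact[of X "{x}"] x(2) by (simp add: clopenin_def)
    qed (use 1 in simp)
    then have "hemicompact_in X (\<Union>?\<S>)" using c by (intro hemicompact_in_Union) auto
    moreover have "\<Union>?\<S> = topspace X" using clopenin_subset[OF 1(1)] by auto
    ultimately show ?thesis by simp
  next
    case 2
    have U: "clopenin X (U n)" "non_isolated_points X \<subseteq> U n" for n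
      using 2(2) by (simp_all add: isolated_tails_def)
    \<comment> \<open>Removing an isolated point leaves a neighbourhood of \<open>X'\<close>, so
      some \<open>U n\<close> omits it; the countable complements of the \<open>U n\<close> exhaust
      the isolated points.\<close>
    have "topspace X - non_isolated_points X \<subseteq> (\<Union>n. topspace X - U n)"
    proof
      fix x assume x: "x \<in> topspace X - non_isolated_points X"
      have "closedin X {x}" using x by (intro compact_closedin finite_compactin) auto
      then have V: "openin X (topspace X - {x})" by blast
      have "non_isolated_points X \<subseteq> topspace X - {x}"
        using x by (auto simp: non_isolated_points_def)
      then obtain n where "U n \<subseteq> topspace X - {x}"
        using 2(2) V unfolding isolated_tails_def by blast
      then show "x \<in> (\<Union>n. topspace X - U n)" using x by blast
    qed
    moreover have "countable (\<Union>n. topspace X - U n)"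
      using countable_off_clopen_if_sequential[OF seq U] by (intro countable_UN) auto
    ultimately have "separable_space X"
      using separable_if_countable_isolated[OF 2(1)] countable_subset by blast
    then show ?thesis
      using completely_metrizable_isolated_tails[OF 2] 2(1) by (simp add: polish_space_def)
  qed
next
  assume R: "hemicompact_in X (topspace X) \<or> (polish_space X \<and> compactin X (non_isolated_points X))"
  show "sequential_space (Ck2 X)"
  proof (cases "hemicompact_in X (topspace X)")
    case True
    then show ?thesis
      using metrizable_Ck2 metrizable_imp_frechet_urysohn frechet_urysohn_imp_sequential by blast
  next
    case False
    then have p: "polish_space X" "compactin X (non_isolated_points X)" using R by auto
    then have "metrizable_space X" "separable_space X"
      using completely_metrizable_imp_metrizable_space by (auto simp: polish_space_def)
    then show ?thesis
      using metrizable_isolated_tails[OF _ p(2)] k_space_Ck2_isolated_tails[OF p(2)]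
        sequential_Ck2_if_k_space by blast
  qed
qed

end

theorem theorem1p12:
  fixes X :: "'a topology"
  assumes "zero_dimensional X"
    and "mu_complete_space X"
    and "bar_aleph_k_space X"
    and "k_R_space X"
  shows
    "((metrizable_space (Ck2 X) \<longleftrightarrow> frechet_urysohn_space (Ck2 X)) \<and>
      (frechet_urysohn_space (Ck2 X) \<longleftrightarrow> cosmic_space X \<and> k_omega_space X))
     \<and>
     (sequential_space (Ck2 X) \<longleftrightarrow>
        (cosmic_space X \<and> k_omega_space X) \<or>
        (polish_space X \<and> compactin X (non_isolated_points X)))
     \<and>
     (k_space (Ck2 X) \<longleftrightarrow>
        sum_of_cosmic_k_omega_and_discrete X \<or>
        (metrizable_space X \<and> compactin X (non_isolated_points X)))
     \<and>
     ((k_R_space (Ck2 X) \<longleftrightarrow> ascoli_space (Ck2 X)) \<and>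
      (ascoli_space (Ck2 X) \<longleftrightarrow> \<not> (\<exists>F. strong_Fin_fan (Ck2 X) F)) \<and>
      (\<not> (\<exists>F. strong_Fin_fan (Ck2 X) F) \<longleftrightarrow>
        sum_of_cosmic_k_omega_spaces X \<or>
        (metrizable_space X \<and> compactin X (non_isolated_points X))))"
proof -
  have "Hausdorff_space X"
    using assms(3) regular_t1_imp_Hausdorff_space unfolding bar_aleph_k_space_def by blast
  then interpret bar_aleph_k_R X
    using assms by unfold_locales
  have 1: "(metrizable_space (Ck2 X) \<longleftrightarrow> frechet_urysohn_space (Ck2 X)) \<and>
      (frechet_urysohn_space (Ck2 X) \<longleftrightarrow> hemicompact_in X (topspace X))"
    using metrizable_imp_frechet_urysohn frechet_urysohn_imp_hemicompact metrizable_Ck2 by blast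
  show ?thesis
    unfolding cosmic_k_omega_iff sum_of_cosmic_k_omega_iff sum_of_cosmic_k_omega_and_discrete_iff
      metrizable_compact_iff
    using 1 sequential_Ck2_iff k_space_Ck2_iff k_R_space_Ck2_iff by (intro conjI) simp_all
qed

end
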